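(* Let $n\ge2$ and let $F\in\mathrm{End}(\mathbb{C}^n,O)$ be such that $dF_O=J_n$. Assume that $F$ is generic, i.e. $a_{11}^n\neq0$, where $a_{11}^n$ is the coefficient of $(z_1)^2$ in the power series expansion at $O$ of the $n$-th component of $F$. Then every regular orbit of $F$ is standard.
   Context: $\mathrm{End}(\mathbb{C}^n,O)$ is the set of germs at $O$ of holomorphic self-maps of $\mathbb{C}^n$ fixing $O$. $J_n$ is the $n\times n$ Jordan block with eigenvalue $1$, i.e. the linear part of the $j$-th component of $F$ is $z_j+z_{j+1}$ for $1\le j\le n-1$ and $z_n$ for $j=n$. Blow-ups. For a complex manifold $M$ of dimension $n$ and a closed submanifold $X$, $\sigma\colon\tilde M_X=(M\setminus X)\cup E_X\to M$ is the blow-up of $M$ along $X$, with exceptional divisor $E_X=\mathbb{P}(N_{X/M})=\sigma^{-1}(X)$; the proper transform of a submanifold $Y\subseteq M$ is $\overline{\sigma^{-1}(Y\setminus X)}$. Define: $M^0=\mathbb{C}^n$, $X^0=\{O\}$, $\chi_0=\mathrm{id}$; $\sigma_1\colon M^1\to M^0$ the blow-up of $O$, with $E^1=\sigma_1^{-1}(O)$ identified with $\mathbb{P}^{n-1}(\mathbb{C})$; for $1\le k\le n-1$, $Y^k\subset E^1$ is the linear subspace generated by $[e_1],\ldots,[e_k]$ ($e_1,\dots,e_n$ the canonical basis); $X^1=Y^1=\{[e_1]\}$; for $2\le k\le n$, $\sigma_k\colon M^k\to M^{k-1}$ is the blow-up along $X^{k-1}$, where $X^{k-1}\subset M^{k-1}$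 is the iterated proper transform of $Y^{k-1}$; $E^k=\sigma_k^{-1}(X^{k-1})$ and $\pi_k=\sigma_1\circ\cdots\circ\sigma_k\colon M^k\to\mathbb{C}^n$. The map $\pi_k$ is a biholomorphism from $M^k\setminus\pi_k^{-1}(O)$ onto $\mathbb{C}^n\setminus\{O\}$; $\pi_k^{-1}(O)$ is the singular divisor. $M^k$ has a canonical chart $\chi_k$ centered at a distinguished point $\mathbf{e}_k\in E^k$, the standard blow-up chart characterized by $$\chi_0\circ\sigma_1\circ\chi_1^{-1}(w)=(w_1,w_1w_2,\ldots,w_1w_n),$$ $$\chi_{k-1}\circ\sigma_k\circ\chi_k^{-1}(w)=(w_1w_k,w_2,\ldots,w_k,w_kw_{k+1},\ldots,w_kw_n)\quad(2\le k\le n),$$ with $\mathbf{e}_k=\chi_k^{-1}(0)$; in its domain $X^k=\{w_1=w_{k+1}=\cdots=w_n=0\}$ for $1\le k\le n-1$. In particular, where $z_1,\dots,z_k\neq 0$, the coordinates $w=\chi_k(\pi_k^{-1}(z))$ are $w_1=z_1^2/z_k$, $w_j=z_j/z_{j-1}$ for $2\le j\le k$, $w_j=z_j/z_k$ for $k+1\le j\le n$ (for $k=1$: $w_1=z_1$). Regular sequences. Let $\{z^k\}\subset\mathbb{C}^n\setminus\{O\}$ be a sequence converging to $O$. It is $0$-regular if $\{[z^k]\}$ converges to some $[v]\in\mathbb{P}^{n-1}(\mathbb{C})$ (equivalently, $\pi_1^{-1}(z^k)$ converges to $[v]\in E^1$). It is $1$-regular if it is $0$-regular and either $[v]\neq\mathbf{e}_1$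 ($1$-regular of first kind), or $[v]=\mathbf{e}_1$ and $\{\chi_1(\pi_1^{-1}(z^k))\}$ is $0$-regular ($1$-regular of second kind). Inductively, for $r\ge2$: if $\{z^k\}$ is $(r-1)$-regular of first kind, then it is also $r$-regular (of first kind). If it is $(r-1)$-regular of second kind, it is $r$-regular if $\pi_r^{-1}(z^k)$ converges to some $[v]\in E^r$ and either $[v]\neq\mathbf{e}_r$ ($r$-regular of first kind), or $[v]=\mathbf{e}_r$ and $\{\chi_r(\pi_r^{-1}(z^k))\}$ is $0$-regular ($r$-regular of second kind). (Here $\chi_r(\pi_r^{-1}(z^k))$ is considered for $k$ large enough that it is defined.) Regular orbits. An $F$-orbit $\{z^k=F^k(z^o)\}\subset\mathbb{C}^n\setminus\{O\}$ is regular if it converges to the origin and is $n$-regular. Standard orbits. $F$ lifts uniquely to a germ of holomorphic self-map $\tilde F=\tilde F_n$ of $M^n$ (near $\mathbf{e}_n$) with $F\circ\pi_n=\pi_n\circ\tilde F$; it satisfies $\tilde F(\mathbf{e}_n)=\mathbf{e}_n$ and $d\tilde F_{\mathbf{e}_n}=\mathrm{id}$. Let $P_2\colon\mathbb{C}^n\to\mathbb{C}^n$ be the quadratic part of the homogeneous expansion at $0$ of $\chi_n\circ\tilde F\circ\chi_n^{-1}$. A characteristic direction of $P_2$ is a $v\in\mathbb{C}^n\setminus\{O\}$ with $P_2(v)=\lambda v$ for some $\lambda\in\mathbb{C}$; it is allowable if it is not tangent to the singular divisor $\pi_n^{-1}(O)$, which in the chart $\chi_n$ is $\bigcup_{h=1}^n\{w_h=0\}$,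 i.e. if $v_1,\ldots,v_n$ are all nonzero. An $F$-orbit $\{z^k\}$ is standard if it is obtained by pushing down via $\pi_n$ a $0$-regular $\tilde F$-orbit tangent to an allowable characteristic direction, i.e. if $\pi_n^{-1}(z^k)\to\mathbf{e}_n$ and $[\chi_n(\pi_n^{-1}(z^k))]\to[v]$ in $\mathbb{P}^{n-1}(\mathbb{C})$ for some allowable characteristic direction $v$ of $P_2$. *)

theory Defs
  imports "HOL-Analysis.Analysis"
begin

section \<open>Coordinates\<close>

type_synonym 'n cvec = "(complex, 'n) vec"

text \<open>
  \<open>\<complex>\<^sup>n\<close> is the type \<open>'n cvec = complex ^ 'n\<close> with \<open>n = CARD('n)\<close>. The coordinates are numbered \<open>1, \<dots>, n\<close>
  along the linear order of the index type: \<open>pos i\<close> is the number of the index \<open>i\<close>, and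
  \<open>ix k\<close> is the index with number \<open>k\<close>, so that the coordinate \<open>z\<^sub>k\<close> is \<open>z $ ix k\<close>.
\<close>

definition pos :: "'n::{finite,linorder} \<Rightarrow> nat" where
  "pos i = card {..i}"

definition ix :: "nat \<Rightarrow> 'n::{finite,linorder}" where
  "ix k = (THE i. pos i = k)"

lemma pos_less_iff: "pos i < pos j \<longleftrightarrow> i < j"
proof -
  have mono: "a < b \<Longrightarrow> pos a < pos b" for a b :: 'a
    unfolding pos_def by (rule psubset_card_mono) auto
  show ?thesis
    by (metis mono less_asym less_irrefl linorder_less_linear)
qed

lemma inj_pos: "inj pos"
  by (metis injI linorder_neqE order_less_irrefl pos_less_iff)

lemma bij_betw_pos: "bij_betw pos (UNIV :: 'n::{finite,linorder} set) {1..CARD('n)}"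
proof -
  have "pos i \<in> {1..CARD('n)}" for i :: 'n
    by (auto simp: pos_def Suc_le_eq card_gt_0_iff intro: card_mono)
  then have "pos ` (UNIV :: 'n set) \<subseteq> {1..CARD('n)}" by blast
  moreover have "card (pos ` (UNIV :: 'n set)) = CARD('n)"
    by (rule card_image) (rule inj_pos)
  ultimately have "pos ` (UNIV :: 'n set) = {1..CARD('n)}"
    by (intro card_subset_eq) auto
  then show ?thesis using inj_pos by (auto simp: bij_betw_def)
qed

lemma ix_pos [simp]: "ix (pos i) = i"
  unfolding ix_def using inj_pos by (auto dest: injD)

lemma pos_ix: "1 \<le> k \<Longrightarrow> k \<le> CARD('n) \<Longrightarrow> pos (ix k :: 'n::{finite,linorder}) = k"
  by (metis atLeastAtMost_iff bij_betw_imp_surj_on bij_betw_pos imageE ix_pos)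

definition jordan_block :: "((complex, 'n) vec, 'n::{finite,linorder}) vec" where
  "jordan_block = (\<chi> i j. if j = i \<or> pos j = Suc (pos i) then 1 else 0)"


section \<open>Holomorphic maps\<close>

text \<open>A multi-index is a function \<open>'n \<Rightarrow> nat\<close>.\<close>

definition mpow :: "'n cvec \<Rightarrow> ('n::finite \<Rightarrow> nat) \<Rightarrow> complex" where
  "mpow z \<alpha> = (\<Prod>i\<in>UNIV. (z $ i) ^ \<alpha> i)"

definition has_power_series ::
  "('n cvec \<Rightarrow> 'n cvec) \<Rightarrow> 'n cvec \<Rightarrow> (('n::finite \<Rightarrow> nat) \<Rightarrow> 'n cvec) \<Rightarrow> bool" where
  "has_power_series f p a \<longleftrightarrow>
     (\<exists>r>0. \<forall>z\<in>ball p r. ((\<lambda>\<alpha>. mpow (z - p) \<alpha> *s a \<alpha>) has_sum f z) UNIV)"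

text \<open>To be used on open sets \<open>S\<close> only; the values of \<open>f\<close> outside \<open>S\<close> are then irrelevant.\<close>

definition holo_on :: "('n cvec \<Rightarrow> 'n cvec) \<Rightarrow> ('n::finite) cvec set \<Rightarrow> bool" where
  "holo_on f S \<longleftrightarrow> (\<forall>p\<in>S. \<exists>a. has_power_series f p a)"

definition quadratic_part ::
  "(('n::finite \<Rightarrow> nat) \<Rightarrow> 'n cvec) \<Rightarrow> 'n cvec \<Rightarrow> 'n cvec" where
  "quadratic_part a v = (\<Sum>\<alpha> | (\<Sum>i\<in>UNIV. \<alpha> i) = 2. mpow v \<alpha> *s a \<alpha>)"

lemma finite_degree_eq: "finite {\<alpha> :: 'n::finite \<Rightarrow> nat. (\<Sum>i\<in>UNIV. \<alpha> i) = d}"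
proof (rule finite_subset)
  show "{\<alpha> :: 'n \<Rightarrow> nat. (\<Sum>i\<in>UNIV. \<alpha> i) = d} \<subseteq> (\<Pi>\<^sub>E i\<in>UNIV. {..d})"
    by (auto simp: PiE_def Pi_def) (metis finite_code UNIV_I member_le_sum zero_le)
  show "finite (\<Pi>\<^sub>E i\<in>(UNIV :: 'n set). {..d})"
    by (rule finite_PiE) auto
qed


section \<open>Projective space\<close>

text \<open>The point \<open>[v]\<close> of \<open>\<pp>\<^sup>n\<^sup>-\<^sup>1(\<complex>)\<close> is the complex line spanned by \<open>v \<noteq> 0\<close>.\<close>

definition line :: "'n cvec \<Rightarrow> ('n::finite) cvec set" where
  "line v = vec.span {v}"

definition proj_space :: "('n::finite) cvec set set" where
  "proj_space = line ` (- {0})"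

text \<open>The quotient topology under \<open>v \<mapsto> [v]\<close>.\<close>

definition proj_topology :: "('n::finite) cvec set topology" where
  "proj_topology = topology (\<lambda>W. W \<subseteq> proj_space \<and> open {v. v \<noteq> 0 \<and> line v \<in> W})"

lemma openin_proj_topology:
  fixes W :: "('n::finite) cvec set set"
  shows "openin proj_topology W \<longleftrightarrow> W \<subseteq> proj_space \<and> open {v. v \<noteq> 0 \<and> line v \<in> W}"
proof -
  have "istopology (\<lambda>W. W \<subseteq> proj_space \<and> open {v :: 'n cvec. v \<noteq> 0 \<and> line v \<in> W})"
    unfolding istopology_def
  proof (intro conjI allI impI)
    fix S T :: "'n cvec set set"
    assume S: "S \<subseteq> proj_space \<and> open {v. v \<noteq> 0 \<and> line v \<in> S}"
      and T: "T \<subseteq> proj_space \<and> open {v. v \<noteq> 0 \<and> line v \<in> T}"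
    show "S \<inter> T \<subseteq> proj_space" using S by blast
    have "{v. v \<noteq> 0 \<and> line v \<in> S \<inter> T} = {v. v \<noteq> 0 \<and> line v \<in> S} \<inter> {v. v \<noteq> 0 \<and> line v \<in> T}"
      by blast
    then show "open {v. v \<noteq> 0 \<and> line v \<in> S \<inter> T}" using S T by auto
  next
    fix K :: "'n cvec set set set"
    assume K: "\<forall>W\<in>K. W \<subseteq> proj_space \<and> open {v. v \<noteq> 0 \<and> line v \<in> W}"
    show "\<Union> K \<subseteq> proj_space" using K by blast
    have "{v. v \<noteq> 0 \<and> line v \<in> \<Union> K} = (\<Union>W\<in>K. {v. v \<noteq> 0 \<and> line v \<in> W})" by blast
    then show "open {v. v \<noteq> 0 \<and> line v \<in> \<Union> K}" using K by auto
  qed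
  then show ?thesis by (simp add: proj_topology_def topology_inverse')
qed

lemma topspace_proj_topology: "topspace proj_topology = (proj_space :: ('n::finite) cvec set set)"
proof (rule subset_antisym)
  show "topspace proj_topology \<subseteq> (proj_space :: 'n cvec set set)"
    by (rule openin_proj_topology[THEN iffD1, THEN conjunct1]) (rule openin_topspace)
  have eq: "{v :: 'n cvec. v \<noteq> 0 \<and> line v \<in> proj_space} = - {0}"
    by (auto simp: proj_space_def)
  have "openin proj_topology (proj_space :: 'n cvec set set)"
    unfolding openin_proj_topology eq by auto
  then show "(proj_space :: 'n cvec set set) \<subseteq> topspace proj_topology"
    by (rule openin_subset)
qed


section \<open>Complex manifolds\<close>

type_synonym ('a, 'n) chart = "'a set \<times> ('a \<Rightarrow> 'n cvec)"

record ('a, 'n) manifold =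
  mtop :: "'a topology"
  atlas :: "('a, 'n) chart set"

abbreviation points :: "('a, 'n::finite) manifold \<Rightarrow> 'a set" where
  "points M \<equiv> topspace (mtop M)"

definition chart_inv :: "('a, 'n::finite) chart \<Rightarrow> 'n cvec \<Rightarrow> 'a" where
  "chart_inv c = inv_into (fst c) (snd c)"

definition compatible :: "('a, 'n::finite) chart \<Rightarrow> ('a, 'n) chart \<Rightarrow> bool" where
  "compatible c d \<longleftrightarrow> holo_on (snd d \<circ> chart_inv c) (snd c ` (fst c \<inter> fst d))"

text \<open>The charts of the maximal atlas of \<open>M\<close>.\<close>

definition is_chart :: "('a, 'n::finite) manifold \<Rightarrow> ('a, 'n) chart \<Rightarrow> bool" where
  "is_chart M c \<longleftrightarrow>
     openin (mtop M) (fst c) \<and> open (snd c ` fst c) \<and>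
     homeomorphic_map (subtopology (mtop M) (fst c)) (top_of_set (snd c ` fst c)) (snd c) \<and>
     (\<forall>d\<in>atlas M. compatible c d \<and> compatible d c)"

definition complex_manifold :: "('a, 'n::finite) manifold \<Rightarrow> bool" where
  "complex_manifold M \<longleftrightarrow>
     Hausdorff_space (mtop M) \<and> second_countable (mtop M) \<and>
     (\<forall>c\<in>atlas M. is_chart M c) \<and> points M = (\<Union>c\<in>atlas M. fst c)"

definition affine_space :: "('n cvec, 'n::finite) manifold" where
  "affine_space = \<lparr>mtop = euclidean, atlas = {(UNIV, id)}\<rparr>"

definition adapted :: "'a set \<Rightarrow> ('a, 'n::finite) chart \<Rightarrow> 'n set \<Rightarrow> bool" where
  "adapted X c I \<longleftrightarrow> I \<noteq> {} \<and> snd c ` (fst c \<inter> X) = snd c ` fst c \<inter> {w. \<forall>i\<in>I. w $ i = 0}"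

definition closed_submanifold :: "('a, 'n::finite) manifold \<Rightarrow> 'a set \<Rightarrow> bool" where
  "closed_submanifold M X \<longleftrightarrow>
     closedin (mtop M) X \<and> (\<forall>p\<in>X. \<exists>c I. is_chart M c \<and> p \<in> fst c \<and> adapted X c I)"


section \<open>Blow-ups\<close>

text \<open>
  The blow-up of an open set \<open>W \<subseteq> \<complex>\<^sup>n\<close> along \<open>{w \<in> W. w\<^sub>i = 0 for i \<in> I}\<close>: the pairs \<open>(w, [u])\<close>
  with \<open>[u]\<close> in the projective space of \<open>\<complex>\<^sup>I\<close> and \<open>(w\<^sub>i)\<^sub>i\<^sub>\<in>\<^sub>I \<in> [u]\<close>. Over a point of the centre the
  fibre is the projectivisation of the normal space, which the coordinates \<open>w\<^sub>i\<close>, \<open>i \<in> I\<close>,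
  identify with \<open>\<complex>\<^sup>I\<close>.
\<close>

definition coord_subspace :: "'n set \<Rightarrow> ('n::finite) cvec set" where
  "coord_subspace I = {u. \<forall>j. j \<notin> I \<longrightarrow> u $ j = 0}"

definition coord_proj :: "'n set \<Rightarrow> 'n cvec \<Rightarrow> ('n::finite) cvec" where
  "coord_proj I w = (\<chi> j. if j \<in> I then w $ j else 0)"

definition local_blowup ::
  "'n set \<Rightarrow> ('n::finite) cvec set \<Rightarrow> ('n cvec \<times> 'n cvec set) set" where
  "local_blowup I W =
     {(w, L). w \<in> W \<and> L \<in> proj_space \<and> L \<subseteq> coord_subspace I \<and> coord_proj I w \<in> L}"

text \<open>
  The standard chart on \<open>{(w, [u]). u\<^sub>i \<noteq> 0}\<close>, where \<open>i \<in> I\<close>: its components are \<open>u\<^sub>j / u\<^sub>i\<close> for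
  \<open>j \<in> I - {i}\<close> and \<open>w\<^sub>j\<close> for the other indices \<open>j\<close>.
\<close>

definition local_dom :: "'n \<Rightarrow> ('n::finite) cvec set \<Rightarrow> bool" where
  "local_dom i L \<longleftrightarrow> (\<exists>u\<in>L. u $ i \<noteq> 0)"

definition local_coords ::
  "'n set \<Rightarrow> 'n \<Rightarrow> 'n cvec \<times> 'n cvec set \<Rightarrow> ('n::finite) cvec" where
  "local_coords I i = (\<lambda>(w, L).
     let u = (THE u. u \<in> L \<and> u $ i = 1)
     in \<chi> j. if j \<in> I - {i} then u $ j else w $ j)"

text \<open>
  \<open>h\<close> is a biholomorphism over the adapted chart \<open>c\<close> from \<open>\<sigma>\<^sup>-\<^sup>1(fst c)\<close> onto the blow-up of the
  image of \<open>c\<close> along the coordinate subspace given by \<open>I\<close>.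
\<close>

definition trivializes ::
  "('a, 'n::finite) manifold \<Rightarrow> ('a \<Rightarrow> 'b) \<Rightarrow> ('b, 'n) chart \<Rightarrow> 'n set \<Rightarrow>
   ('a \<Rightarrow> 'n cvec \<times> 'n cvec set) \<Rightarrow> bool" where
  "trivializes M' \<sigma> c I h \<longleftrightarrow>
     bij_betw h {p \<in> points M'. \<sigma> p \<in> fst c} (local_blowup I (snd c ` fst c)) \<and>
     (\<forall>p\<in>points M'. \<sigma> p \<in> fst c \<longrightarrow> fst (h p) = snd c (\<sigma> p)) \<and>
     (\<forall>i\<in>I. is_chart M' ({p \<in> points M'. \<sigma> p \<in> fst c \<and> local_dom i (snd (h p))},
                           local_coords I i \<circ> h))"

text \<open>
  \<open>\<sigma> : M' \<rightarrow> M\<close> is the blow-up of \<open>M\<close> along \<open>X\<close>: a biholomorphism outside \<open>X\<close>, and the standard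
  local blow-up over every chart adapted to \<open>X\<close>. This determines \<open>(M', \<sigma>)\<close> up to a unique
  biholomorphism over \<open>M\<close>.
\<close>

definition is_blowup ::
  "('b, 'n::finite) manifold \<Rightarrow> 'b set \<Rightarrow> ('a, 'n) manifold \<Rightarrow> ('a \<Rightarrow> 'b) \<Rightarrow> bool" where
  "is_blowup M X M' \<sigma> \<longleftrightarrow>
     complex_manifold M \<and> closed_submanifold M X \<and> complex_manifold M' \<and>
     \<sigma> ` points M' \<subseteq> points M \<and>
     bij_betw \<sigma> {p \<in> points M'. \<sigma> p \<notin> X} (points M - X) \<and>
     (\<forall>c. is_chart M c \<and> fst c \<inter> X = {} \<longrightarrow>
        is_chart M' ({p \<in> points M'. \<sigma> p \<in> fst c}, snd c \<circ> \<sigma>)) \<and>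
     (\<forall>c I. is_chart M c \<and> adapted X c I \<longrightarrow> (\<exists>h. trivializes M' \<sigma> c I h))"


section \<open>The tower of blow-ups\<close>

text \<open>
  The manifolds \<open>M\<^sup>k\<close> and the charts \<open>\<chi>\<^sub>k\<close> for \<open>1 \<le> k \<le> n\<close>, the maps \<open>\<sigma>\<^sub>1 : M\<^sup>1 \<rightarrow> \<complex>\<^sup>n\<close> and
  \<open>\<sigma>\<^sub>k : M\<^sup>k \<rightarrow> M\<^sup>k\<^sup>-\<^sup>1\<close> for \<open>2 \<le> k \<le> n\<close>, and the identification \<open>p \<mapsto> (\<sigma>\<^sub>1(p), [v])\<close> of \<open>M\<^sup>1\<close> with the
  standard blow-up of \<open>\<complex>\<^sup>n\<close> at \<open>O\<close>, through which \<open>E\<^sup>1\<close> is identified with \<open>\<pp>\<^sup>n\<^sup>-\<^sup>1(\<complex>)\<close>. The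
  values of the fields at other \<open>k\<close> are irrelevant. All \<open>M\<^sup>k\<close> with \<open>k \<ge> 1\<close> have their points in
  one type \<open>'a\<close>, which is no restriction when \<open>'a\<close> has at least the cardinality of the continuum.
\<close>

record ('a, 'n) tower =
  Mfd :: "nat \<Rightarrow> ('a, 'n) manifold"
  sigma1 :: "'a \<Rightarrow> 'n cvec"
  sigma :: "nat \<Rightarrow> 'a \<Rightarrow> 'a"
  triv1 :: "'a \<Rightarrow> 'n cvec \<times> 'n cvec set"
  chi :: "nat \<Rightarrow> ('a, 'n) chart"

text \<open>The linear subspace \<open>Y\<^sup>k\<close> of \<open>E\<^sup>1\<close> generated by \<open>[e\<^sub>1], \<dots>, [e\<^sub>k]\<close>.\<close>

definition lin_subspace :: "('a, 'n::{finite,linorder}) tower \<Rightarrow> nat \<Rightarrow> 'a set" where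
  "lin_subspace B k = {p \<in> points (Mfd B 1). sigma1 B p = 0 \<and>
              snd (triv1 B p) \<subseteq> vec.span {axis (ix j) 1 | j. 1 \<le> j \<and> j \<le> k}}"

text \<open>
  \<open>proper_transform B k j\<close> is the iterated proper transform of \<open>Y\<^sup>j\<close> in \<open>M\<^sup>k\<close>; the centre of the
  next blow-up is \<open>X\<^sup>k = proper_transform B k k\<close>.
\<close>

fun proper_transform :: "('a, 'n::{finite,linorder}) tower \<Rightarrow> nat \<Rightarrow> nat \<Rightarrow> 'a set" where
  "proper_transform B 0 j = {}"
| "proper_transform B (Suc 0) j = lin_subspace B j"
| "proper_transform B (Suc (Suc k)) j =
     mtop (Mfd B (Suc (Suc k))) closure_of
       {p \<in> points (Mfd B (Suc (Suc k))).
          sigma B (Suc (Suc k)) p \<in> proper_transform B (Suc k) j - proper_transform B (Suc k) (Suc k)}"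

definition centre :: "('a, 'n::{finite,linorder}) tower \<Rightarrow> nat \<Rightarrow> 'a set" where
  "centre B k = proper_transform B k k"

definition exc_divisor :: "('a, 'n::{finite,linorder}) tower \<Rightarrow> nat \<Rightarrow> 'a set" where
  "exc_divisor B k = (if k = 1 then {p \<in> points (Mfd B 1). sigma1 B p = 0}
            else {p \<in> points (Mfd B k). sigma B k p \<in> centre B (k - 1)})"

text \<open>The expression of \<open>\<sigma>\<^sub>k\<close> in the charts \<open>\<chi>\<^sub>k\<close> and \<open>\<chi>\<^sub>k\<^sub>-\<^sub>1\<close>.\<close>

definition sigma_coords :: "nat \<Rightarrow> 'n cvec \<Rightarrow> ('n::{finite,linorder}) cvec" where
  "sigma_coords k w =
     (if k = 1 then \<chi> i. if pos i = 1 then w $ i else w $ ix 1 * w $ i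
      else \<chi> i. if pos i = 1 \<or> k < pos i then w $ ix k * w $ i else w $ i)"

text \<open>
  The standard chart \<open>\<chi>\<^sub>k\<close> maps its domain onto \<open>\<complex>\<^sup>n\<close>. The expression of \<open>\<sigma>\<^sub>k\<close> in coordinates
  determines \<open>\<chi>\<^sub>k\<close>, its domain included, because \<open>\<sigma>\<^sub>k\<close> is injective outside \<open>E\<^sup>k\<close>.
\<close>

definition blowup_tower :: "('a, 'n::{finite,linorder}) tower \<Rightarrow> bool" where
  "blowup_tower B \<longleftrightarrow>
     is_blowup affine_space {0} (Mfd B 1) (sigma1 B) \<and>
     trivializes (Mfd B 1) (sigma1 B) (UNIV, id) UNIV (triv1 B) \<and>
     (\<forall>k\<in>{2..CARD('n)}. is_blowup (Mfd B (k - 1)) (centre B (k - 1)) (Mfd B k) (sigma B k)) \<and>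
     (\<forall>k\<in>{1..CARD('n)}. is_chart (Mfd B k) (chi B k) \<and> snd (chi B k) ` fst (chi B k) = UNIV) \<and>
     (\<forall>p\<in>fst (chi B 1). sigma1 B p = sigma_coords 1 (snd (chi B 1) p)) \<and>
     (\<forall>k\<in>{2..CARD('n)}. \<forall>p\<in>fst (chi B k).
        sigma B k p \<in> fst (chi B (k - 1)) \<and>
        snd (chi B (k - 1)) (sigma B k p) = sigma_coords k (snd (chi B k) p))"

text \<open>The distinguished point of \<open>E\<^sup>k\<close>, at which \<open>\<chi>\<^sub>k\<close> is centred.\<close>

definition base_pt :: "('a, 'n::{finite,linorder}) tower \<Rightarrow> nat \<Rightarrow> 'a" where
  "base_pt B k = chart_inv (chi B k) 0"

text \<open>\<open>\<pi>\<^sub>k = \<sigma>\<^sub>1 \<circ> \<dots> \<circ> \<sigma>\<^sub>k\<close>\<close>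

fun proj :: "('a, 'n::{finite,linorder}) tower \<Rightarrow> nat \<Rightarrow> 'a \<Rightarrow> 'n cvec" where
  "proj B 0 = (\<lambda>_. 0)"
| "proj B (Suc 0) = sigma1 B"
| "proj B (Suc (Suc k)) = proj B (Suc k) \<circ> sigma B (Suc (Suc k))"

text \<open>The inverse of the biholomorphism \<open>\<pi>\<^sub>k\<close> from \<open>M\<^sup>k - \<pi>\<^sub>k\<^sup>-\<^sup>1(O)\<close> onto \<open>\<complex>\<^sup>n - {O}\<close>.\<close>

definition proj_inv :: "('a, 'n::{finite,linorder}) tower \<Rightarrow> nat \<Rightarrow> 'n cvec \<Rightarrow> 'a" where
  "proj_inv B k = inv_into {p \<in> points (Mfd B k). proj B k p \<noteq> 0} (proj B k)"


section \<open>Regular sequences\<close>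

definition zero_regular_to :: "(nat \<Rightarrow> 'n cvec) \<Rightarrow> ('n::finite) cvec set \<Rightarrow> bool" where
  "zero_regular_to s L \<longleftrightarrow>
     (\<forall>\<^sub>F m in sequentially. s m \<noteq> 0) \<and> s \<longlonglongrightarrow> 0 \<and>
     limitin proj_topology (\<lambda>m. line (s m)) L sequentially"

text \<open>The sequence \<open>\<chi>\<^sub>k(\<pi>\<^sub>k\<^sup>-\<^sup>1(z\<^sup>m))\<close>; only its values for large \<open>m\<close> are meaningful.\<close>

definition chart_seq ::
  "('a, 'n::{finite,linorder}) tower \<Rightarrow> nat \<Rightarrow> (nat \<Rightarrow> 'n cvec) \<Rightarrow> nat \<Rightarrow> 'n cvec" where
  "chart_seq B k z = (\<lambda>m. snd (chi B k) (proj_inv B k (z m)))"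

abbreviation lift_tendsto ::
  "('a, 'n::{finite,linorder}) tower \<Rightarrow> nat \<Rightarrow> (nat \<Rightarrow> 'n cvec) \<Rightarrow> 'a \<Rightarrow> bool" where
  "lift_tendsto B k z p \<equiv> limitin (mtop (Mfd B k)) (\<lambda>m. proj_inv B k (z m)) p sequentially"

text \<open>\<open>r\<close>-regular sequences of second and of first kind; there are none for \<open>r = 0\<close>.\<close>

fun regular_second_kind ::
  "('a, 'n::{finite,linorder}) tower \<Rightarrow> nat \<Rightarrow> (nat \<Rightarrow> 'n cvec) \<Rightarrow> bool" where
  "regular_second_kind B 0 z \<longleftrightarrow> False"
| "regular_second_kind B (Suc 0) z \<longleftrightarrow>
     zero_regular_to z (line (axis (ix 1) 1)) \<and> (\<exists>L. zero_regular_to (chart_seq B 1 z) L)"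
| "regular_second_kind B (Suc (Suc r)) z \<longleftrightarrow>
     regular_second_kind B (Suc r) z \<and>
     lift_tendsto B (Suc (Suc r)) z (base_pt B (Suc (Suc r))) \<and>
     (\<exists>L. zero_regular_to (chart_seq B (Suc (Suc r)) z) L)"

fun regular_first_kind ::
  "('a, 'n::{finite,linorder}) tower \<Rightarrow> nat \<Rightarrow> (nat \<Rightarrow> 'n cvec) \<Rightarrow> bool" where
  "regular_first_kind B 0 z \<longleftrightarrow> False"
| "regular_first_kind B (Suc 0) z \<longleftrightarrow>
     (\<exists>L. zero_regular_to z L \<and> L \<noteq> line (axis (ix 1) 1))"
| "regular_first_kind B (Suc (Suc r)) z \<longleftrightarrow>
     regular_first_kind B (Suc r) z \<or>
     regular_second_kind B (Suc r) z \<and>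
       (\<exists>p\<in>exc_divisor B (Suc (Suc r)). p \<noteq> base_pt B (Suc (Suc r)) \<and> lift_tendsto B (Suc (Suc r)) z p)"


section \<open>Orbits\<close>

text \<open>
  \<open>F\<close> represents a germ at \<open>O\<close>; its values far from \<open>O\<close> are arbitrary. Only the behaviour of orbits
  converging to \<open>O\<close> is considered, and these are eventually in any neighbourhood of \<open>O\<close>.
\<close>

definition is_orbit ::
  "('n cvec \<Rightarrow> 'n cvec) \<Rightarrow> (nat \<Rightarrow> ('n::finite) cvec) \<Rightarrow> bool" where
  "is_orbit F z \<longleftrightarrow> (\<exists>z0. z = (\<lambda>m. (F ^^ m) z0)) \<and> (\<forall>m. z m \<noteq> 0)"

definition regular_orbit ::
  "('a, 'n::{finite,linorder}) tower \<Rightarrow> ('n cvec \<Rightarrow> 'n cvec) \<Rightarrow>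
   (nat \<Rightarrow> 'n cvec) \<Rightarrow> bool" where
  "regular_orbit B F z \<longleftrightarrow>
     is_orbit F z \<and> z \<longlonglongrightarrow> 0 \<and>
     (regular_first_kind B (CARD('n)) z \<or> regular_second_kind B (CARD('n)) z)"

text \<open>
  \<open>F'\<close> represents the lift of \<open>F\<close> to \<open>M\<^sup>n\<close> near \<open>base_pt B n\<close>, and \<open>b\<close> is the family of coefficients of its
  power series at \<open>0\<close> in the chart \<open>\<chi>\<^sub>n\<close>.
\<close>

definition is_lift ::
  "('a, 'n::{finite,linorder}) tower \<Rightarrow> ('n cvec \<Rightarrow> 'n cvec) \<Rightarrow> ('a \<Rightarrow> 'a) \<Rightarrow>
   (('n \<Rightarrow> nat) \<Rightarrow> 'n cvec) \<Rightarrow> bool" where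
  "is_lift B F F' b \<longleftrightarrow>
     (let n = CARD('n); c = chi B n in
        F' (base_pt B n) = base_pt B n \<and>
        (\<exists>N. openin (mtop (Mfd B n)) N \<and> base_pt B n \<in> N \<and>
             (\<forall>p\<in>N. F' p \<in> fst c \<and> proj B n (F' p) = F (proj B n p))) \<and>
        has_power_series (snd c \<circ> F' \<circ> chart_inv c) 0 b)"

definition characteristic_direction ::
  "('n cvec \<Rightarrow> 'n cvec) \<Rightarrow> ('n::finite) cvec \<Rightarrow> bool" where
  "characteristic_direction P v \<longleftrightarrow> v \<noteq> 0 \<and> (\<exists>l. P v = l *s v)"

text \<open>
  Not tangent to the singular divisor \<open>\<pi>\<^sub>n\<^sup>-\<^sup>1(O)\<close>, whose components are \<open>{w\<^sub>h = 0}\<close>, \<open>1 \<le> h \<le> n\<close>, in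
  the chart \<open>\<chi>\<^sub>n\<close>.
\<close>

definition allowable :: "('n::finite) cvec \<Rightarrow> bool" where
  "allowable v \<longleftrightarrow> (\<forall>i. v $ i \<noteq> 0)"

definition standard_orbit ::
  "('a, 'n::{finite,linorder}) tower \<Rightarrow> ('n cvec \<Rightarrow> 'n cvec) \<Rightarrow>
   (nat \<Rightarrow> 'n cvec) \<Rightarrow> bool" where
  "standard_orbit B F z \<longleftrightarrow>
     is_orbit F z \<and> lift_tendsto B (CARD('n)) z (base_pt B (CARD('n))) \<and>
     (\<exists>F' b v. is_lift B F F' b \<and>
        characteristic_direction (quadratic_part b) v \<and> allowable v \<and>
        zero_regular_to (chart_seq B (CARD('n)) z) (line v))"

end

theory Submission
  imports Defs
begin

text \<open>
  Let \<open>z\<^sup>m\<close> be an orbit converging to the origin whose lifts to \<open>M\<^sup>s\<close> converge to \<open>e\<^sub>s\<close>. The coordinates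
  \<open>w = \<chi>\<^sub>s(\<pi>\<^sub>s\<^sup>-\<^sup>1(z))\<close> satisfy \<open>z\<^sub>1\<^sup>2 = w\<^sub>1 z\<^sub>s\<close>, \<open>z\<^sub>j = w\<^sub>j z\<^sub>j\<^sub>-\<^sub>1\<close> for \<open>2 \<le> j \<le> s\<close> and \<open>z\<^sub>j = w\<^sub>j z\<^sub>s\<close> for
  \<open>j > s\<close>. As they tend to zero, the orbit is asymptotic to the \<open>z\<^sub>1\<close>-axis, and the nonlinear part of
  \<open>F\<close> along it is \<open>c z\<^sub>1\<^sup>2 + o(z\<^sub>1\<^sup>2)\<close> with \<open>c\<^sub>n = a\<^sup>n\<^sub>1\<^sub>1 \<noteq> 0\<close> (\<open>nonlinear_part_near_axis\<close>). This one
  expansion drives the whole argument.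

  \<^item> The orbit is never of first kind (\<open>orbit_not_first_kind\<close>). The limit of the lifts to \<open>M\<^sup>s\<^sup>+\<^sup>1\<close> is a
    point of the fibre over \<open>e\<^sub>s\<close>, that is, a limit of the normal directions
    \<open>[z\<^sub>1\<^sup>2 : z\<^sub>s\<^sub>+\<^sub>1 : \<dots> : z\<^sub>n]\<close> to the centre. On these directions \<open>F\<close> acts asymptotically by a linear map, so
    the limit is an eigenvector. Because \<open>c\<^sub>n \<noteq> 0\<close>, this linear map is a single unipotent Jordan block;
    its only eigenvector is the direction of \<open>z\<^sub>s\<^sub>+\<^sub>1\<close>, which is the point \<open>e\<^sub>s\<^sub>+\<^sub>1\<close>. At the first level
    \<open>J\<^sub>n\<close> itself plays the role of that linear map.

  \<^item> Consequently the lifts to \<open>M\<^sup>n\<close> converge to \<open>e\<^sub>n\<close>, tangentially to some \<open>[v]\<close>. There one step of the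
    orbit multiplies each coordinate \<open>w\<^sub>j\<close> by \<open>1 + q\<^sub>j(w) + o(\<parallel>w\<parallel>)\<close> with linear forms \<open>q\<^sub>j\<close>. If
    \<open>v\<^sub>j \<noteq> 0\<close>, the increments of \<open>1 / w\<^sub>j\<close> converge, and averaging them determines \<open>q\<^sub>j(v)\<close> from the common
    scale \<open>x\<^sub>m\<close> of the \<open>w\<^sub>j\<close> as the limit of \<open>-1 / (m x\<^sub>m)\<close>. Hence all these \<open>q\<^sub>j(v)\<close> agree.

  \<^item> No \<open>v\<^sub>j\<close> vanishes (\<open>tangent_direction_allowable\<close>): the forms \<open>q\<^sub>j\<close> have a cyclic structure, which
    otherwise would make the modulus of some coordinate \<open>w\<^sub>i\<close> with \<open>v\<^sub>i = 0\<close> increase along the orbit,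
    although \<open>w\<^sub>i\<close> is nonzero and tends to zero.

  \<^item> The map \<open>\<pi>\<^sub>n\<close> is monomial in the chart \<open>\<chi>\<^sub>n\<close>, and \<open>F\<^sub>j \<circ> \<pi>\<^sub>n\<close> is divisible by the \<open>j\<close>-th monomial.
    The quotients \<open>U\<^sub>j\<close> are power series with \<open>U\<^sub>j(0) = 1\<close>, and the lift is a rational expression in
    them. Its quadratic part has the components \<open>w\<^sub>j q\<^sub>j(w)\<close> (\<open>lift_in_coordinates\<close>), so \<open>v\<close> is
    a characteristic direction.

  The relation with the abstract tower of blow-ups rests on three facts: \<open>\<pi>\<^sub>k\<close> is a bijection away from
  the origin (\<open>proj_bij\<close>), the centres have the expected equations in the canonical charts
  (\<open>adapted_centre\<close>), and a chart in which the blow-down map has its standard form is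
  one of the standard charts of the local blow-up (\<open>standard_chart_direction\<close>).
\<close>

section \<open>Power series in several variables\<close>

lemma mpow_add: "mpow w (\<lambda>l. \<alpha> l + \<beta> l) = mpow w \<alpha> * mpow w \<beta>"
  by (simp add: mpow_def power_add prod.distrib)

lemma mpow_eq_0_iff: "mpow w \<alpha> = 0 \<longleftrightarrow> (\<exists>l. w $ l = 0 \<and> \<alpha> l > 0)"
  by (auto simp: mpow_def)

lemma norm_mpow_mono:
  assumes "\<And>l. norm (w $ l) \<le> norm (v $ l)"
  shows "norm (mpow w \<alpha>) \<le> norm (mpow v \<alpha>)"
  unfolding mpow_def by (simp add: norm_power prod_norm[symmetric]) (intro prod_mono conjI power_mono assms; simp)

lemma norm_mpow_le:
  assumes "\<And>l. norm (w $ l) \<le> t"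
  shows "norm (mpow w \<alpha>) \<le> t ^ (\<Sum>l\<in>UNIV. \<alpha> l)"
proof -
  have "norm (mpow w \<alpha>) = (\<Prod>l\<in>UNIV. norm (w $ l) ^ \<alpha> l)"
    by (simp add: mpow_def norm_power prod_norm[symmetric])
  also have "\<dots> \<le> (\<Prod>l\<in>UNIV. t ^ \<alpha> l)"
    by (intro prod_mono conjI power_mono assms) auto
  finally show ?thesis by (simp add: power_sum)
qed

text \<open>
  A point with equal coordinates and thus, for \<open>t \<noteq> 0\<close>, off all coordinate hyperplanes: a monomial
  series that converges absolutely there does so on the polydisc of radius \<open>\<bar>t\<bar>\<close>.
\<close>

definition const_vec :: "complex \<Rightarrow> ('n::finite) cvec" where
  "const_vec t = (\<chi> l. t)"

lemma const_vec_nth [simp]: "const_vec t $ l = t"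
  by (simp add: const_vec_def)

lemma norm_const_vec_le: "norm (const_vec t :: ('n::finite) cvec) \<le> real CARD('n) * norm t"
  unfolding norm_vec_def by (rule order_trans[OF L2_set_le_sum]) auto

lemma exists_const_vec_in_ball:
  assumes "r > 0"
  obtains t :: real where "t > 0" "const_vec (of_real t) \<in> ball (0 :: ('n::finite) cvec) r"
proof
  have n: "real CARD('n) > 0" by (simp add: card_gt_0_iff)
  show "r / (2 * real CARD('n)) > 0" using assms n by simp
  show "const_vec (of_real (r / (2 * real CARD('n)))) \<in> ball (0 :: 'n cvec) r"
  proof -
    have "norm (const_vec (of_real (r / (2 * real CARD('n)))) :: 'n cvec) \<le>
        real CARD('n) * norm (of_real (r / (2 * real CARD('n))) :: complex)"
      by (rule norm_const_vec_le)
    also have "\<dots> = r / 2" using assms n by (simp only: norm_of_real) (simp add: field_simps)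
    finally show ?thesis using assms by simp
  qed
qed

definition germ_series :: "(('n::finite) cvec \<Rightarrow> complex) \<Rightarrow> (('n \<Rightarrow> nat) \<Rightarrow> complex) \<Rightarrow> bool" where
  "germ_series f c \<longleftrightarrow> (\<exists>r>0. \<forall>w\<in>ball 0 r. ((\<lambda>\<alpha>. mpow w \<alpha> * c \<alpha>) has_sum f w) UNIV)"

definition germ_analytic :: "(('n::finite) cvec \<Rightarrow> complex) \<Rightarrow> bool" where
  "germ_analytic f \<longleftrightarrow> (\<exists>c. germ_series f c)"

text \<open>
  A convergent sum of monomials over an arbitrary index set is a power series: convergence at one
  point with nonzero coordinates makes the coefficients of equal monomials summable. Products,
  geometric series and monomial substitutions are all obtained from this by a choice of indices.
\<close>

lemma germ_analytic_monomial_sum: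
  fixes e :: "'i \<Rightarrow> 'n::finite \<Rightarrow> nat" and c :: "'i \<Rightarrow> complex"
  assumes r: "r > 0"
    and f: "\<And>w. w \<in> ball 0 r \<Longrightarrow> ((\<lambda>i. mpow w (e i) * c i) has_sum f w) A"
  shows "germ_analytic f"
proof -
  obtain t :: real where t: "t > 0" "const_vec (of_real t) \<in> ball (0 :: 'n cvec) r"
    using exists_const_vec_in_ball[OF r] .
  define v :: "'n cvec" where "v = const_vec (of_real t)"
  have v: "mpow v \<beta> \<noteq> 0" for \<beta> using t by (auto simp: mpow_eq_0_iff v_def)
  define b where "b \<beta> = infsum c {i \<in> A. e i = \<beta>}" for \<beta>
  have b: "(c has_sum b \<beta>) {i \<in> A. e i = \<beta>}" for \<beta>
  proof -
    have "(\<lambda>i. mpow v (e i) * c i) summable_on {i \<in> A. e i = \<beta>}"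
      by (rule summable_on_subset_banach[OF has_sum_imp_summable[OF f]]) (use t in \<open>auto simp: v_def\<close>)
    then have "(\<lambda>i. mpow v \<beta> * c i) summable_on {i \<in> A. e i = \<beta>}"
      using summable_on_cong[of "{i \<in> A. e i = \<beta>}" "\<lambda>i. mpow v (e i) * c i" "\<lambda>i. mpow v \<beta> * c i"] by simp
    then have "c summable_on {i \<in> A. e i = \<beta>}"
      using summable_on_cmult_right'[OF v] by blast
    then show ?thesis unfolding b_def by (rule has_sum_infsum)
  qed
  have "((\<lambda>\<beta>. mpow w \<beta> * b \<beta>) has_sum f w) UNIV" if w: "w \<in> ball 0 r" for w
  proof (rule has_sum_SigmaD[where f = "\<lambda>(\<beta>, i). mpow w \<beta> * c i"])
    show "((\<lambda>i. (\<lambda>(\<beta>, i). mpow w \<beta> * c i) (\<beta>, i)) has_sum mpow w \<beta> * b \<beta>) {i \<in> A. e i = \<beta>}" for \<beta>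
      using has_sum_cmult_right[OF b] by simp
    show "((\<lambda>(\<beta>, i). mpow w \<beta> * c i) has_sum f w) (Sigma UNIV (\<lambda>\<beta>. {i \<in> A. e i = \<beta>}))"
      using has_sum_reindex_bij_witness[of A snd "\<lambda>i. (e i, i)" "Sigma UNIV (\<lambda>\<beta>. {i \<in> A. e i = \<beta>})"
          "\<lambda>(\<beta>, i). mpow w \<beta> * c i" "\<lambda>i. mpow w (e i) * c i" "f w" "f w"] f[OF w]
      by auto
  qed
  then show ?thesis using r unfolding germ_analytic_def germ_series_def by blast
qed

lemma has_sum_times:
  fixes f :: "'i \<Rightarrow> 'a::{real_normed_field,banach}" and g :: "'j \<Rightarrow> 'a"
  assumes "(f has_sum a) A" "(\<lambda>x. norm (f x)) summable_on A" "(g has_sum b) B" "(\<lambda>x. norm (g x)) summable_on B"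
  shows "((\<lambda>(x, y). f x * g y) has_sum a * b) (A \<times> B)"
    and "(\<lambda>p. norm ((\<lambda>(x, y). f x * g y) p)) summable_on (A \<times> B)"
proof -
  show abs: "(\<lambda>p. norm ((\<lambda>(x, y). f x * g y) p)) summable_on (A \<times> B)"
  proof -
    obtain H where H: "((\<lambda>y. norm (g y)) has_sum H) B" using assms(4) by (auto simp: summable_on_def)
    have "(\<lambda>p. norm (f (fst p) * g (snd p))) summable_on (A \<times> B)"
    proof (rule summable_on_SigmaI)
      show "((\<lambda>y. norm (f (fst (x, y)) * g (snd (x, y)))) has_sum norm (f x) * H) B" for x
        using has_sum_cmult_right[OF H, of "norm (f x)"] by (simp add: norm_mult)
      show "(\<lambda>x. norm (f x) * H) summable_on A" using assms(2) by (rule summable_on_cmult_left)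
    qed simp
    then show ?thesis by (simp add: case_prod_unfold)
  qed
  show "((\<lambda>(x, y). f x * g y) has_sum a * b) (A \<times> B)"
  proof (rule has_sum_SigmaI)
    show "((\<lambda>y. case (x, y) of (x, y) \<Rightarrow> f x * g y) has_sum f x * b) B" for x
      using has_sum_cmult_right[OF assms(3)] by simp
    show "((\<lambda>x. f x * b) has_sum a * b) A" by (rule has_sum_cmult_left[OF assms(1)])
    show "(\<lambda>(x, y). f x * g y) summable_on (A \<times> B)" by (rule abs_summable_summable[OF abs])
  qed
qed

text \<open>
  Multiplying out the powers of a sum indexes the terms by lists, so that a geometric series becomes
  a single unordered sum.
\<close>

lemma has_sum_list_power:
  fixes g :: "'i \<Rightarrow> 'a::{real_normed_field,banach}"
  assumes "(g has_sum a) UNIV" "(\<lambda>i. norm (g i)) summable_on UNIV"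
  shows "((\<lambda>xs. prod_list (map g xs)) has_sum a ^ m) {xs. length xs = m} \<and>
         (\<lambda>xs. norm (prod_list (map g xs))) summable_on {xs. length xs = m}"
proof (induction m)
  case 0
  have "{xs :: 'i list. length xs = 0} = {[]}" by auto
  then show ?case by (auto intro!: has_sum_finiteI)
next
  case (Suc m)
  define S :: "'i list set" where "S = {xs. length xs = m}"
  have bij: "bij_betw (\<lambda>(x, xs). x # xs) (UNIV \<times> S) {xs. length xs = Suc m}"
    by (rule bij_betwI[of _ _ _ "\<lambda>xs. (hd xs, tl xs)"]) (auto simp: length_Suc_conv S_def)
  note prod = has_sum_times[OF assms Suc[THEN conjunct1, folded S_def] Suc[THEN conjunct2, folded S_def]]
  have eq: "(\<lambda>(x, xs). g x * prod_list (map g xs)) =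
      (\<lambda>p. prod_list (map g ((\<lambda>(x, xs). x # xs) p)))"
    by (auto simp: fun_eq_iff)
  show ?case
    using prod has_sum_reindex_bij_betw[OF bij, of "\<lambda>xs. prod_list (map g xs)" "a ^ Suc m"]
      summable_on_reindex_bij_betw[OF bij, of "\<lambda>xs. norm (prod_list (map g xs))"]
    unfolding eq by simp
qed

lemma has_sum_list_geometric:
  fixes g :: "'i \<Rightarrow> complex"
  assumes g: "(g has_sum a) UNIV" and H: "((\<lambda>i. norm (g i)) has_sum H) UNIV" "H < 1"
  shows "((\<lambda>xs. prod_list (map g xs)) has_sum 1 / (1 - a)) UNIV"
proof -
  have H0: "H \<ge> 0" using H(1) by (rule has_sum_nonneg) simp
  have "norm a \<le> H" by (rule norm_has_sum_bound[OF H(1) g])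
  then have a1: "norm a < 1" using H(2) by simp
  have abs: "(\<lambda>i. norm (g i)) summable_on UNIV" using H(1) by (rule has_sum_imp_summable)
  have "(\<lambda>i. norm (norm (g i))) summable_on UNIV" using abs by simp
  note hs = has_sum_list_power[OF g abs] and hn = has_sum_list_power[OF H(1) this]
  have geo: "((\<lambda>m. c ^ m) has_sum 1 / (1 - c)) UNIV" if "norm c < 1"
    for c :: "'b::{real_normed_field,banach}"
    using that geometric_sums[OF that]
    by (intro norm_summable_imp_has_sum) (auto simp: norm_power intro!: summable_geometric)
  have "((\<lambda>(m, xs). prod_list (map g xs)) has_sum 1 / (1 - a)) (Sigma UNIV (\<lambda>m. {xs. length xs = m}))"
  proof (rule has_sum_SigmaI)
    show "((\<lambda>m. a ^ m) has_sum 1 / (1 - a)) UNIV" by (rule geo[OF a1])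
    have "(\<lambda>(m, xs). prod_list (map (\<lambda>i. norm (g i)) xs)) summable_on (Sigma UNIV (\<lambda>m. {xs. length xs = m}))"
      by (rule summable_on_SigmaI[where g = "\<lambda>m. H ^ m"])
        (use hn geo[of H] H H0 in \<open>auto intro!: prod_list_nonneg simp: has_sum_iff\<close>)
    moreover have "norm (prod_list (map g xs)) = prod_list (map (\<lambda>i. norm (g i)) xs)" for xs
      by (induction xs) (auto simp: norm_mult)
    ultimately have "(\<lambda>p. norm ((\<lambda>(m, xs). prod_list (map g xs)) p)) summable_on (Sigma UNIV (\<lambda>m. {xs. length xs = m}))"
      by (simp add: case_prod_unfold)
    then show "(\<lambda>(m, xs). prod_list (map g xs)) summable_on (Sigma UNIV (\<lambda>m. {xs. length xs = m}))"
      by (rule abs_summable_summable)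
  qed (use hs in auto)
  then show ?thesis
    using has_sum_reindex_bij_witness[of "Sigma UNIV (\<lambda>m. {xs. length xs = m})" "\<lambda>xs. (length xs, xs)" snd
        UNIV "\<lambda>xs. prod_list (map g xs)" "\<lambda>(m, xs). prod_list (map g xs)" "1 / (1 - a)" "1 / (1 - a)"]
    by auto
qed

lemma complex_has_sum_abs:
  "((f :: 'i \<Rightarrow> complex) has_sum s) A \<Longrightarrow> (\<lambda>i. norm (f i)) summable_on A"
  using summable_on_iff_abs_summable_on_complex[of f A] by (simp add: has_sum_imp_summable)

lemma germ_analytic_mult:
  assumes "germ_analytic f" "germ_analytic g"
  shows "germ_analytic (\<lambda>w. f w * g w)"
proof -
  obtain r c where r: "r > 0" and c: "\<And>w. w \<in> ball 0 r \<Longrightarrow> ((\<lambda>\<alpha>. mpow w \<alpha> * c \<alpha>) has_sum f w) UNIV"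
    using assms(1) unfolding germ_analytic_def germ_series_def by blast
  obtain s d where s: "s > 0" and d: "\<And>w. w \<in> ball 0 s \<Longrightarrow> ((\<lambda>\<alpha>. mpow w \<alpha> * d \<alpha>) has_sum g w) UNIV"
    using assms(2) unfolding germ_analytic_def germ_series_def by blast
  show ?thesis
  proof (rule germ_analytic_monomial_sum[where r = "min r s" and A = "UNIV \<times> UNIV" and
        e = "\<lambda>(\<alpha>, \<beta>) l. \<alpha> l + \<beta> l" and c = "\<lambda>(\<alpha>, \<beta>). c \<alpha> * d \<beta>"])
    fix w :: "'a cvec" assume w: "w \<in> ball 0 (min r s)"
    note hc = c[of w] and hd = d[of w]
    have "((\<lambda>(\<alpha>, \<beta>). (mpow w \<alpha> * c \<alpha>) * (mpow w \<beta> * d \<beta>)) has_sum f w * g w) (UNIV \<times> UNIV)"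
      using hc hd w by (intro has_sum_times complex_has_sum_abs[OF hc] complex_has_sum_abs[OF hd]) auto
    then show "((\<lambda>i. mpow w (case i of (\<alpha>, \<beta>) \<Rightarrow> \<lambda>l. \<alpha> l + \<beta> l) * (case i of (\<alpha>, \<beta>) \<Rightarrow> c \<alpha> * d \<beta>)) has_sum f w * g w) (UNIV \<times> UNIV)"
      by (simp add: case_prod_unfold mpow_add mult_ac)
  qed (use r s in auto)
qed

lemma mpow_single: "mpow w (\<lambda>l. if l = i then 1 else 0) = w $ i"
proof -
  have "mpow w (\<lambda>l. if l = i then 1 else 0) = (\<Prod>l\<in>UNIV. if l = i then w $ l else 1)"
    unfolding mpow_def by (rule prod.cong) auto
  then show ?thesis by simp
qed

lemma germ_analytic_coord: "germ_analytic (\<lambda>w. w $ i)"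
  by (rule germ_analytic_monomial_sum[where r = 1 and A = "{()}" and
        e = "\<lambda>_ l. if l = i then 1 else 0" and c = "\<lambda>_. 1"])
    (auto simp: mpow_single intro!: has_sum_finiteI)

text \<open>
  Comparing the series at \<open>w\<close> with the series at a point whose coordinates all have modulus \<open>t\<close>
  gains a factor \<open>\<parallel>w\<parallel> / t\<close> per degree.
\<close>

lemma germ_series_taylor:
  fixes f :: "('n::finite) cvec \<Rightarrow> complex"
  assumes "germ_series f c"
  obtains \<rho> C where "\<rho> > 0" "C \<ge> 0"
    "\<And>w. norm w \<le> \<rho> \<Longrightarrow>
      norm (f w - (\<Sum>\<alpha> | (\<Sum>i\<in>UNIV. \<alpha> i) < d. mpow w \<alpha> * c \<alpha>)) \<le> C * norm w ^ d"
proof -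
  obtain r where r: "r > 0" and f: "\<And>w. w \<in> ball 0 r \<Longrightarrow> ((\<lambda>\<alpha>. mpow w \<alpha> * c \<alpha>) has_sum f w) UNIV"
    using assms unfolding germ_series_def by blast
  obtain t :: real where t: "t > 0" "const_vec (of_real t) \<in> ball (0 :: 'n cvec) r"
    using exists_const_vec_in_ball[OF r] .
  define v :: "'n cvec" where "v = const_vec (of_real t)"
  define deg where "deg \<alpha> = (\<Sum>i\<in>UNIV. \<alpha> i)" for \<alpha> :: "'n \<Rightarrow> nat"
  have nv: "norm (mpow v \<alpha>) = t ^ deg \<alpha>" for \<alpha>
    using t by (simp add: mpow_def v_def deg_def power_sum prod_norm[symmetric] norm_power)
  have fin: "finite {\<alpha> :: 'n \<Rightarrow> nat. deg \<alpha> < d}"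
  proof -
    have "{\<alpha> :: 'n \<Rightarrow> nat. deg \<alpha> < d} = (\<Union>k<d. {\<alpha>. (\<Sum>i\<in>UNIV. \<alpha> i) = k})" by (auto simp: deg_def)
    then show ?thesis by (simp add: finite_degree_eq)
  qed
  have vb: "v \<in> ball 0 r" using t by (simp add: v_def)
  have "(\<lambda>\<alpha>. norm (mpow v \<alpha> * c \<alpha>)) summable_on UNIV"
    using complex_has_sum_abs[OF f[OF vb]] .
  then have "(\<lambda>\<alpha>. norm (mpow v \<alpha> * c \<alpha>)) summable_on {\<alpha>. \<not> deg \<alpha> < d}"
    by (rule summable_on_subset_banach) simp
  then obtain S where S: "((\<lambda>\<alpha>. norm (mpow v \<alpha> * c \<alpha>)) has_sum S) {\<alpha>. \<not> deg \<alpha> < d}"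
    by (auto simp: summable_on_def)
  have S0: "S \<ge> 0" using S by (rule has_sum_nonneg) simp
  define \<rho> where "\<rho> = min t (r / 2)"
  show ?thesis
  proof (rule that[of \<rho> "S / t ^ d"])
    show "\<rho> > 0" "S / t ^ d \<ge> 0" using t r S0 by (auto simp: \<rho>_def)
    fix w :: "'n cvec" assume w: "norm w \<le> \<rho>"
    then have wb: "w \<in> ball 0 r" "norm w \<le> t" using r by (auto simp: \<rho>_def)
    have "((\<lambda>\<alpha>. mpow w \<alpha> * c \<alpha>) has_sum (\<Sum>\<alpha> | deg \<alpha> < d. mpow w \<alpha> * c \<alpha>)) {\<alpha>. deg \<alpha> < d}"
      using fin by simp
    from has_sum_Diff[OF f[OF wb(1)] this]
    have tail: "((\<lambda>\<alpha>. mpow w \<alpha> * c \<alpha>) has_sum (f w - (\<Sum>\<alpha> | deg \<alpha> < d. mpow w \<alpha> * c \<alpha>))) {\<alpha>. \<not> deg \<alpha> < d}"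
      by (simp add: Collect_neg_eq Compl_eq_Diff_UNIV)
    have le: "norm (mpow w \<alpha> * c \<alpha>) \<le> (norm w / t) ^ d * norm (mpow v \<alpha> * c \<alpha>)"
      if "\<alpha> \<in> {\<alpha>. \<not> deg \<alpha> < d}" for \<alpha>
    proof -
      have "norm (mpow w \<alpha>) \<le> norm w ^ deg \<alpha>"
        unfolding deg_def by (rule norm_mpow_le) (rule Finite_Cartesian_Product.norm_nth_le)
      also have "\<dots> = (norm w / t) ^ deg \<alpha> * t ^ deg \<alpha>" using t by (simp add: power_divide)
      also have "\<dots> \<le> (norm w / t) ^ d * t ^ deg \<alpha>"
        using that wb(2) t by (intro mult_right_mono power_decreasing) auto
      finally have "norm (mpow w \<alpha>) \<le> (norm w / t) ^ d * norm (mpow v \<alpha>)" by (simp only: nv)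
      from mult_right_mono[OF this, of "norm (c \<alpha>)"] show ?thesis by (simp add: norm_mult mult.assoc)
    qed
    have "norm (f w - (\<Sum>\<alpha> | deg \<alpha> < d. mpow w \<alpha> * c \<alpha>)) \<le> (norm w / t) ^ d * S"
      by (rule norm_infsum_le[OF tail has_sum_cmult_right[OF S]]) (use le in auto)
    then show "norm (f w - (\<Sum>\<alpha> | (\<Sum>i\<in>UNIV. \<alpha> i) < d. mpow w \<alpha> * c \<alpha>)) \<le> S / t ^ d * norm w ^ d"
      by (simp add: deg_def power_divide mult.commute)
  qed
qed

lemma degree_zero_iff: "(\<Sum>i\<in>UNIV. \<alpha> i) = 0 \<longleftrightarrow> \<alpha> = (\<lambda>_. 0)" for \<alpha> :: "'n::finite \<Rightarrow> nat"
  by (auto simp: fun_eq_iff)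

lemma mpow_zero_exponent [simp]: "mpow w (\<lambda>_. 0) = 1"
  by (simp add: mpow_def)

lemma germ_series_tendsto:
  assumes "germ_series f c" "s \<longlonglongrightarrow> 0"
  shows "(\<lambda>m. f (s m)) \<longlonglongrightarrow> c (\<lambda>_. 0)"
proof -
  obtain \<rho> C where \<rho>: "\<rho> > 0" and C: "C \<ge> 0"
    "\<And>w. norm w \<le> \<rho> \<Longrightarrow>
      norm (f w - (\<Sum>\<alpha> | (\<Sum>i\<in>UNIV. \<alpha> i) < 1. mpow w \<alpha> * c \<alpha>)) \<le> C * norm w ^ 1"
    using germ_series_taylor[OF assms(1), of 1] by blast
  have deg: "{\<alpha> :: 'a \<Rightarrow> nat. (\<Sum>i\<in>UNIV. \<alpha> i) < 1} = {\<lambda>_. 0}"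
    by (auto simp: fun_eq_iff)
  have "\<forall>\<^sub>F m in sequentially. norm (s m) < \<rho>"
    using assms(2) \<rho> by (auto simp: tendsto_iff)
  then have "\<forall>\<^sub>F m in sequentially. norm (f (s m) - c (\<lambda>_. 0)) \<le> C * norm (s m)"
    proof eventually_elim
    case (elim m)
    then show ?case using C(2)[of "s m", unfolded deg] by simp
  qed
  moreover have "(\<lambda>m. C * norm (s m)) \<longlonglongrightarrow> 0"
    using tendsto_mult_right_zero[OF tendsto_norm_zero[OF assms(2)]] .
  ultimately have "(\<lambda>m. f (s m) - c (\<lambda>_. 0)) \<longlonglongrightarrow> 0" by (rule Lim_null_comparison)
  then show ?thesis by (rule LIM_zero_cancel)
qed

lemma germ_series_constant:
  assumes "germ_series f c"
  shows "c (\<lambda>_. 0) = f 0"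
proof -
  have "(\<lambda>m::nat. f 0) \<longlonglongrightarrow> c (\<lambda>_. 0)" by (rule germ_series_tendsto[OF assms]) simp
  then show ?thesis by (simp add: LIMSEQ_const_iff)
qed

lemma null_sequence_complex:
  "(\<lambda>m. of_real (\<delta> / real (Suc m)) :: complex) \<longlonglongrightarrow> 0"
  using tendsto_of_real[OF tendsto_mult_right_zero[OF LIMSEQ_inverse_real_of_nat, of \<delta>], where 'a = complex]
  by (simp add: divide_inverse)

lemma degree_one_exponent:
  fixes \<alpha> :: "'n::finite \<Rightarrow> nat"
  assumes "(\<Sum>i\<in>UNIV. \<alpha> i) = 1"
  obtains k where "\<alpha> = (\<lambda>l. if l = k then 1 else 0)"
proof -
  obtain k where k: "\<alpha> k \<noteq> 0" using assms by (metis sum.neutral zero_neq_one)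
  have "(\<Sum>l\<in>UNIV. \<alpha> l) = \<alpha> k + (\<Sum>l\<in>UNIV - {k}. \<alpha> l)" by (rule sum.remove) auto
  then have "\<alpha> k = 1" "(\<Sum>l\<in>UNIV - {k}. \<alpha> l) = 0" using assms k by linarith+
  then have "\<alpha> = (\<lambda>l. if l = k then 1 else 0)" by (auto simp: fun_eq_iff)
  then show ?thesis by (rule that)
qed

text \<open>
  The reciprocal is the geometric series in \<open>1 - f\<close>; expanding its powers gives one monomial for
  each list of exponents.
\<close>

lemma germ_analytic_inverse:
  fixes f :: "('n::finite) cvec \<Rightarrow> complex"
  assumes "germ_series f c" "c (\<lambda>_. 0) = 1"
  shows "germ_analytic (\<lambda>w. 1 / f w)"
proof -
  obtain r where r: "r > 0" and f: "\<And>w. w \<in> ball 0 r \<Longrightarrow> ((\<lambda>\<alpha>. mpow w \<alpha> * c \<alpha>) has_sum f w) UNIV"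
    using assms unfolding germ_series_def by blast
  define h where "h \<alpha> = (if \<alpha> = (\<lambda>_. 0) then 0 else - c \<alpha>)" for \<alpha> :: "'n \<Rightarrow> nat"
  have h: "((\<lambda>\<alpha>. mpow w \<alpha> * h \<alpha>) has_sum (1 - f w)) UNIV" if "w \<in> ball 0 r" for w
  proof -
    have "((\<lambda>\<alpha>. if \<alpha> = (\<lambda>_. 0) then 1 else 0 :: complex) has_sum 1) (UNIV :: ('n \<Rightarrow> nat) set)"
      by (rule has_sum_finite_neutralI[where B = "{\<lambda>_. 0}"]) auto
    from has_sum_add[OF this has_sum_uminusI[OF f[OF that]]]
    have "((\<lambda>\<alpha>. (if \<alpha> = (\<lambda>_. 0) then 1 else 0) + - (mpow w \<alpha> * c \<alpha>)) has_sum 1 - f w) UNIV" by simp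
    also have "(\<lambda>\<alpha>. (if \<alpha> = (\<lambda>_. 0) then 1 else 0) + - (mpow w \<alpha> * c \<alpha>)) = (\<lambda>\<alpha>. mpow w \<alpha> * h \<alpha>)"
    proof (rule ext)
      show "(if \<alpha> = (\<lambda>_. 0) then 1 else 0) + - (mpow w \<alpha> * c \<alpha>) = mpow w \<alpha> * h \<alpha>" for \<alpha>
        by (cases "\<alpha> = (\<lambda>_. 0)") (simp_all add: h_def assms(2))
    qed
    finally show ?thesis .
  qed
  obtain t :: real where t: "t > 0" "const_vec (of_real t) \<in> ball (0 :: 'n cvec) r"
    using exists_const_vec_in_ball[OF r] .
  define v :: "'n cvec" where "v = const_vec (of_real t)"
  have "(\<lambda>\<alpha>. norm (mpow v \<alpha> * h \<alpha>)) summable_on UNIV"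
    using complex_has_sum_abs[OF h] t by (simp add: v_def)
  then obtain S where S: "((\<lambda>\<alpha>. norm (mpow v \<alpha> * h \<alpha>)) has_sum S) UNIV"
    by (auto simp: summable_on_def)
  have S0: "S \<ge> 0" using S by (rule has_sum_nonneg) simp
  have nv: "norm (mpow v \<alpha>) = t ^ (\<Sum>i\<in>UNIV. \<alpha> i)" for \<alpha>
    using t by (simp add: mpow_def v_def power_sum prod_norm[symmetric] norm_power)
  \<comment> \<open>For \<open>\<parallel>w\<parallel> < \<rho>\<close> the absolute sum of the series of \<open>1 - f\<close> at \<open>w\<close> is at most \<open>1 / 2\<close>.\<close>
  define \<rho> where "\<rho> = min (min t (r / 2)) (t / (2 * (S + 1)))"
  have \<rho>: "\<rho> > 0" using t r S0 by (auto simp: \<rho>_def)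
  show ?thesis
  proof (rule germ_analytic_monomial_sum[OF \<rho>, where A = UNIV and
        e = "\<lambda>xs l. sum_list (map (\<lambda>\<alpha>. \<alpha> l) xs)" and c = "\<lambda>xs. prod_list (map h xs)"])
    fix w :: "'n cvec" assume "w \<in> ball 0 \<rho>"
    then have w: "w \<in> ball 0 r" "norm w \<le> t" "norm w / t * (2 * (S + 1)) \<le> 1"
      using r t S0 by (auto simp: \<rho>_def field_simps)
    have le: "norm (mpow w \<alpha> * h \<alpha>) \<le> norm w / t * norm (mpow v \<alpha> * h \<alpha>)" for \<alpha>
    proof (cases "\<alpha> = (\<lambda>_. 0)")
      case False
      then have d: "(\<Sum>i\<in>UNIV. \<alpha> i) \<ge> 1" using degree_zero_iff[of \<alpha>] by linarith
      have "norm (mpow w \<alpha>) \<le> norm w ^ (\<Sum>i\<in>UNIV. \<alpha> i)"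
        by (rule norm_mpow_le) (rule Finite_Cartesian_Product.norm_nth_le)
      also have "\<dots> = (norm w / t) ^ (\<Sum>i\<in>UNIV. \<alpha> i) * t ^ (\<Sum>i\<in>UNIV. \<alpha> i)" using t by (simp add: power_divide)
      also have "\<dots> \<le> (norm w / t) ^ 1 * t ^ (\<Sum>i\<in>UNIV. \<alpha> i)"
        using d w(2) t by (intro mult_right_mono power_decreasing) auto
      finally have "norm (mpow w \<alpha>) \<le> norm w / t * norm (mpow v \<alpha>)" by (simp only: nv power_one_right)
      from mult_right_mono[OF this, of "norm (h \<alpha>)"] show ?thesis by (simp add: norm_mult mult.assoc)
    qed (simp add: h_def)
    obtain H where H: "((\<lambda>\<alpha>. norm (mpow w \<alpha> * h \<alpha>)) has_sum H) UNIV"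
      using complex_has_sum_abs[OF h[OF w(1)]] by (auto simp: summable_on_def)
    have "H \<le> norm w / t * S"
      by (rule has_sum_mono[OF H has_sum_cmult_right[OF S]]) (use le in auto)
    moreover have "norm w / t * S < 1"
    proof -
      have "2 * (norm w / t * S) \<le> 2 * (norm w / t * (S + 1))" using t S0 by (intro mult_left_mono) auto
      also have "\<dots> \<le> 1" using w(3) by (simp only: mult_ac)
      finally show ?thesis by simp
    qed
    ultimately have "H < 1" by simp
    from has_sum_list_geometric[OF h[OF w(1)] H this]
    have "((\<lambda>xs. prod_list (map (\<lambda>\<alpha>. mpow w \<alpha> * h \<alpha>) xs)) has_sum 1 / f w) UNIV" by simp
    moreover have "prod_list (map (\<lambda>\<alpha>. mpow w \<alpha> * h \<alpha>) xs) =
        mpow w (\<lambda>l. sum_list (map (\<lambda>\<alpha>. \<alpha> l) xs)) * prod_list (map h xs)" for xs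
      by (induction xs) (simp_all add: mpow_add)
    ultimately show "((\<lambda>xs. mpow w (\<lambda>l. sum_list (map (\<lambda>\<alpha>. \<alpha> l) xs)) * prod_list (map h xs)) has_sum 1 / f w) UNIV"
      by simp
  qed
qed

lemma has_sum_vec_iff:
  fixes f :: "'i \<Rightarrow> ('a::real_normed_vector, 'n::finite) vec"
  shows "(f has_sum s) A \<longleftrightarrow> (\<forall>j. ((\<lambda>i. f i $ j) has_sum s $ j) A)"
proof
  assume "(f has_sum s) A"
  then show "\<forall>j. ((\<lambda>i. f i $ j) has_sum s $ j) A"
    by (auto intro: has_sum_bounded_linear[OF bounded_linear_vec_nth])
next
  assume "\<forall>j. ((\<lambda>i. f i $ j) has_sum s $ j) A"
  then have "((\<lambda>F. sum f F $ j) \<longlongrightarrow> s $ j) (finite_subsets_at_top A)" for j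
    by (simp add: has_sum_def)
  then show "(f has_sum s) A"
    unfolding has_sum_def by (rule vec_tendstoI)
qed

lemma has_power_series_nth:
  assumes "has_power_series f 0 a"
  shows "germ_series (\<lambda>w. f w $ j) (\<lambda>\<alpha>. a \<alpha> $ j)"
  using assms unfolding has_power_series_def germ_series_def has_sum_vec_iff
  by auto

lemma germ_analytic_components_power_series:
  fixes f :: "('n::finite) cvec \<Rightarrow> 'n cvec"
  assumes "\<And>j. germ_analytic (\<lambda>w. f w $ j)"
  obtains a where "has_power_series f 0 a"
proof -
  have "\<forall>j. \<exists>c r. r > 0 \<and> (\<forall>w\<in>ball 0 r. ((\<lambda>\<alpha>. mpow w \<alpha> * c \<alpha>) has_sum f w $ j) UNIV)"
    using assms unfolding germ_analytic_def germ_series_def by blast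
  then obtain c r where c: "\<And>j. r j > 0"
    "\<And>j w. w \<in> ball 0 (r j) \<Longrightarrow> ((\<lambda>\<alpha>. mpow w \<alpha> * c j \<alpha>) has_sum f w $ j) UNIV"
    by metis
  have "has_power_series f 0 (\<lambda>\<alpha>. \<chi> j. c j \<alpha>)"
    unfolding has_power_series_def has_sum_vec_iff
  proof (intro exI conjI ballI allI)
    show "Min (range r) > 0" using c(1) by auto
    fix w j assume "w \<in> ball (0 :: 'n cvec) (Min (range r))"
    then have "w \<in> ball 0 (r j)" by auto
    from c(2)[OF this]
    show "((\<lambda>\<alpha>. (mpow (w - 0) \<alpha> *s (\<chi> j. c j \<alpha>)) $ j) has_sum f w $ j) UNIV" by simp
  qed
  then show ?thesis by (rule that)
qed

section \<open>The second-order expansion of F\<close>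

lemma degree_split:
  "{\<alpha> :: 'n::finite \<Rightarrow> nat. (\<Sum>i\<in>UNIV. \<alpha> i) < Suc d} =
   {\<alpha>. (\<Sum>i\<in>UNIV. \<alpha> i) < d} \<union> {\<alpha>. (\<Sum>i\<in>UNIV. \<alpha> i) = d}"
  by auto

lemma finite_degree_less: "finite {\<alpha> :: 'n::finite \<Rightarrow> nat. (\<Sum>i\<in>UNIV. \<alpha> i) < d}"
  by (induction d) (simp_all add: degree_split finite_degree_eq del: sum_eq_0_iff)

lemma sum_degree_Suc:
  fixes f :: "('n::finite \<Rightarrow> nat) \<Rightarrow> 'a::comm_monoid_add"
  shows "(\<Sum>\<alpha> | (\<Sum>i\<in>UNIV. \<alpha> i) < Suc d. f \<alpha>) =
    (\<Sum>\<alpha> | (\<Sum>i\<in>UNIV. \<alpha> i) < d. f \<alpha>) + (\<Sum>\<alpha> | (\<Sum>i\<in>UNIV. \<alpha> i) = d. f \<alpha>)"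
  unfolding degree_split
  by (rule sum.union_disjoint) (auto simp: finite_degree_less finite_degree_eq simp del: sum_eq_0_iff)

definition homog :: "(('n::finite \<Rightarrow> nat) \<Rightarrow> complex) \<Rightarrow> nat \<Rightarrow> 'n cvec \<Rightarrow> complex" where
  "homog c d w = (\<Sum>\<alpha> | (\<Sum>i\<in>UNIV. \<alpha> i) = d. mpow w \<alpha> * c \<alpha>)"

lemma homog_scale: "homog c d (t *s w) = t ^ d * homog c d w"
proof -
  have "mpow (t *s w) \<alpha> = t ^ (\<Sum>i\<in>UNIV. \<alpha> i) * mpow w \<alpha>" for \<alpha>
    by (simp add: mpow_def power_mult_distrib prod.distrib power_sum)
  then show ?thesis by (simp add: homog_def sum_distrib_left mult.assoc)
qed

lemma sum_degree_homog:
  "(\<Sum>\<alpha> | (\<Sum>i\<in>UNIV. \<alpha> i) < d. mpow w \<alpha> * c \<alpha>) = (\<Sum>k<d. homog c k w)"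
proof (induction d)
  case (Suc d)
  then show ?case by (simp add: sum_degree_Suc homog_def)
qed simp

lemma germ_series_expansion:
  fixes f :: "('n::finite) cvec \<Rightarrow> complex"
  assumes "germ_series f c"
  obtains \<rho> C where "\<rho> > 0" "C \<ge> 0"
    "\<And>w. norm w \<le> \<rho> \<Longrightarrow> norm (f w - (\<Sum>k<d. homog c k w)) \<le> C * norm w ^ d"
  using germ_series_taylor[OF assms, of d] unfolding sum_degree_homog by blast

lemma homog_0: "homog c 0 w = c (\<lambda>_. 0)"
proof -
  have "{\<alpha> :: 'a \<Rightarrow> nat. (\<Sum>i\<in>UNIV. \<alpha> i) = 0} = {\<lambda>_. 0}" by (auto simp: fun_eq_iff)
  then show ?thesis by (simp add: homog_def del: sum_eq_0_iff)
qed

text \<open>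
  Successive divisions by \<open>t\<close> isolate one coefficient at a time.
\<close>

lemma quadratic_little_o:
  fixes A B C :: complex
  assumes lim: "(\<lambda>m. (A + t m * B + (t m)\<^sup>2 * C) / (t m)\<^sup>2) \<longlonglongrightarrow> 0"
    and t: "t \<longlonglongrightarrow> 0" "\<And>m. t m \<noteq> 0"
  shows "A = 0" "B = 0" "C = 0"
proof -
  define e where "e m = (A + t m * B + (t m)\<^sup>2 * C) / (t m)\<^sup>2" for m
  have e: "e \<longlonglongrightarrow> 0" using lim unfolding e_def .
  have A: "A = e m * (t m)\<^sup>2 - t m * B - (t m)\<^sup>2 * C" for m
    using t(2)[of m] by (simp add: e_def)
  have "(\<lambda>m. e m * (t m)\<^sup>2 - t m * B - (t m)\<^sup>2 * C) \<longlonglongrightarrow> 0 * 0\<^sup>2 - 0 * B - 0\<^sup>2 * C"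
    by (intro tendsto_intros e t)
  then have "(\<lambda>m. A) \<longlonglongrightarrow> 0" by (simp flip: A)
  then show A0: "A = 0" by (simp add: LIMSEQ_const_iff)
  have B: "B = e m * t m - t m * C" for m
  proof -
    have "t m * B = t m * (e m * t m - t m * C)" using A[of m] A0
      by (simp add: algebra_simps power2_eq_square)
    then show ?thesis using t(2) by simp
  qed
  have "(\<lambda>m. e m * t m - t m * C) \<longlonglongrightarrow> 0 * 0 - 0 * C"
    by (intro tendsto_intros e t)
  then have "(\<lambda>m. B) \<longlonglongrightarrow> 0" by (simp flip: B)
  then show B0: "B = 0" by (simp add: LIMSEQ_const_iff)
  have "e m = C" for m using A[of m] A0 B0 t(2)[of m] by simp
  then have "e = (\<lambda>m. C)" by (rule ext)
  then have "(\<lambda>m. C) \<longlonglongrightarrow> 0" using e by simp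
  then show "C = 0" by (simp add: LIMSEQ_const_iff)
qed

text \<open>
  Along a ray the Taylor remainder is \<open>O(t\<^sup>3)\<close>, so the second-order behaviour determines the homogeneous
  parts up to degree two.
\<close>

lemma germ_series_ray:
  fixes f :: "('n::finite) cvec \<Rightarrow> complex"
  assumes f: "germ_series f c" and t: "t \<longlonglongrightarrow> 0" "\<And>m. t m \<noteq> 0"
    and lim: "(\<lambda>m. (f (t m *s v) - t m * p) / (t m)\<^sup>2) \<longlonglongrightarrow> q"
  shows "homog c 0 v = 0" "homog c 1 v = p" "homog c 2 v = q"
proof -
  obtain \<rho> C where \<rho>: "\<rho> > 0" and C: "C \<ge> 0"
    "\<And>w. norm w \<le> \<rho> \<Longrightarrow> norm (f w - (\<Sum>k<3. homog c k w)) \<le> C * norm w ^ 3"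
    using germ_series_expansion[OF f, of 3] by blast
  have sv: "norm (x *s v) = norm x * norm v" for x :: complex
  proof -
    have "norm (x *s v) = L2_set (\<lambda>i. norm x * norm (v $ i)) UNIV" by (simp add: norm_vec_def norm_mult)
    also have "\<dots> = norm x * norm v" by (simp add: norm_vec_def L2_set_right_distrib)
    finally show ?thesis .
  qed
  have "(\<lambda>m. norm (t m) * norm v) \<longlonglongrightarrow> 0"
    using tendsto_mult_left_zero[OF tendsto_norm_zero[OF t(1)]] .
  then have "\<forall>\<^sub>F m in sequentially. norm (t m) * norm v < \<rho>"
    using \<rho> by (rule order_tendstoD)
  then have "\<forall>\<^sub>F m in sequentially.
      norm ((f (t m *s v) - (\<Sum>k<3. homog c k (t m *s v))) / (t m)\<^sup>2) \<le> C * norm v ^ 3 * norm (t m)"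
  proof eventually_elim
    case (elim m)
    then have "norm (f (t m *s v) - (\<Sum>k<3. homog c k (t m *s v))) \<le> C * (norm (t m) * norm v) ^ 3"
      using C(2)[of "t m *s v"] by (simp add: sv)
    then have "norm ((f (t m *s v) - (\<Sum>k<3. homog c k (t m *s v))) / (t m)\<^sup>2)
        \<le> C * (norm (t m) * norm v) ^ 3 / (norm (t m))\<^sup>2"
      by (simp add: norm_divide norm_power divide_right_mono)
    also have "\<dots> = C * norm v ^ 3 * norm (t m)"
      using t(2)[of m] by (simp add: field_simps power2_eq_square power3_eq_cube)
    finally show ?case .
  qed
  moreover have "(\<lambda>m. C * norm v ^ 3 * norm (t m)) \<longlonglongrightarrow> 0"
    using tendsto_mult_right_zero[OF tendsto_norm_zero[OF t(1)]] .
  ultimately have "(\<lambda>m. (f (t m *s v) - (\<Sum>k<3. homog c k (t m *s v))) / (t m)\<^sup>2) \<longlonglongrightarrow> 0"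
    by (rule Lim_null_comparison)
  from tendsto_diff[OF lim this]
  have "(\<lambda>m. (f (t m *s v) - t m * p) / (t m)\<^sup>2 -
      (f (t m *s v) - (\<Sum>k<3. homog c k (t m *s v))) / (t m)\<^sup>2 - q) \<longlonglongrightarrow> 0"
    by (simp add: LIM_zero_iff)
  also have "(\<lambda>m. (f (t m *s v) - t m * p) / (t m)\<^sup>2 -
      (f (t m *s v) - (\<Sum>k<3. homog c k (t m *s v))) / (t m)\<^sup>2 - q) =
      (\<lambda>m. (homog c 0 v + t m * (homog c 1 v - p) + (t m)\<^sup>2 * (homog c 2 v - q)) / (t m)\<^sup>2)"
  proof (rule ext)
    fix m
    have "(\<Sum>k<3. homog c k (t m *s v)) = homog c 0 v + t m * homog c 1 v + (t m)\<^sup>2 * homog c 2 v"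
      by (simp add: homog_scale eval_nat_numeral)
    then show "(f (t m *s v) - t m * p) / (t m)\<^sup>2 -
      (f (t m *s v) - (\<Sum>k<3. homog c k (t m *s v))) / (t m)\<^sup>2 - q =
      (homog c 0 v + t m * (homog c 1 v - p) + (t m)\<^sup>2 * (homog c 2 v - q)) / (t m)\<^sup>2"
      using t(2)[of m] by (simp add: field_simps)
  qed
  finally have "(\<lambda>m. (homog c 0 v + t m * (homog c 1 v - p) + (t m)\<^sup>2 * (homog c 2 v - q)) / (t m)\<^sup>2) \<longlonglongrightarrow> 0" .
  from quadratic_little_o[OF this t] show "homog c 0 v = 0" "homog c 1 v = p" "homog c 2 v = q" by auto
qed

text \<open>
  Every quadratic monomial other than \<open>z\<^sub>1\<^sup>2\<close> contains one of the coordinates \<open>z\<^sub>2, \<dots>, z\<^sub>n\<close>.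
\<close>

lemma homog_2_estimate:
  fixes c :: "('n::finite \<Rightarrow> nat) \<Rightarrow> complex" and p :: 'n
  obtains C where "C \<ge> 0"
    "\<And>z. norm (homog c 2 z - (z $ p)\<^sup>2 * c (\<lambda>i. if i = p then 2 else 0))
        \<le> C * (norm z * (\<Sum>i\<in>-{p}. norm (z $ i)))"
proof -
  define D where "D = {\<alpha> :: 'n \<Rightarrow> nat. (\<Sum>i\<in>UNIV. \<alpha> i) = 2}"
  define \<epsilon> where "\<epsilon> = (\<lambda>i. if i = p then 2 else 0 :: nat)"
  have finD: "finite D" unfolding D_def by (rule finite_degree_eq)
  have \<epsilon>D: "\<epsilon> \<in> D" by (simp add: \<epsilon>_def D_def)
  have mono: "norm (mpow z \<alpha>) \<le> norm z * (\<Sum>i\<in>-{p}. norm (z $ i))"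
    if \<alpha>: "\<alpha> \<in> D" "\<alpha> \<noteq> \<epsilon>" for z \<alpha>
  proof -
    have "\<exists>i. i \<noteq> p \<and> \<alpha> i \<noteq> 0"
    proof (rule ccontr)
      assume none: "\<nexists>i. i \<noteq> p \<and> \<alpha> i \<noteq> 0"
      then have "(\<Sum>i\<in>UNIV. \<alpha> i) = (\<Sum>i\<in>UNIV. if i = p then \<alpha> p else 0)"
        by (intro sum.cong) auto
      then have "\<alpha> p = 2" using \<alpha>(1) by (simp add: D_def)
      then have "\<alpha> = \<epsilon>" using none by (auto simp: \<epsilon>_def fun_eq_iff)
      then show False using \<alpha>(2) by simp
    qed
    then obtain i where i: "i \<noteq> p" "\<alpha> i \<noteq> 0" by blast
    define \<beta> where "\<beta> = \<alpha>(i := \<alpha> i - 1)"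
    have split: "\<alpha> = (\<lambda>l. (if l = i then 1 else 0) + \<beta> l)"
      using i by (auto simp: \<beta>_def fun_eq_iff)
    have "(\<Sum>l\<in>UNIV. \<alpha> l) = 1 + (\<Sum>l\<in>UNIV. \<beta> l)"
      by (subst split) (simp add: sum.distrib)
    then have b: "(\<Sum>l\<in>UNIV. \<beta> l) = 1" using \<alpha>(1) by (simp add: D_def)
    have "norm (mpow z \<alpha>) = norm (z $ i) * norm (mpow z \<beta>)"
      by (subst split) (simp add: mpow_add mpow_single norm_mult)
    also have "norm (mpow z \<beta>) \<le> norm z"
      using norm_mpow_le[of z "norm z" \<beta>] b by (simp add: Finite_Cartesian_Product.norm_nth_le)
    also have "norm (z $ i) \<le> (\<Sum>i\<in>-{p}. norm (z $ i))"
      using i by (intro member_le_sum) auto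
    finally show ?thesis by (simp add: mult.commute mult_left_mono mult_right_mono sum_nonneg)
  qed
  define C where "C = (\<Sum>\<alpha>\<in>D. norm (c \<alpha>))"
  have "norm (homog c 2 z - (z $ p)\<^sup>2 * c \<epsilon>) \<le> C * (norm z * (\<Sum>i\<in>-{p}. norm (z $ i)))" for z
  proof -
    have "mpow z \<epsilon> = (z $ p)\<^sup>2"
    proof -
      have "mpow z \<epsilon> = (\<Prod>i\<in>UNIV. if i = p then (z $ p)\<^sup>2 else 1)"
        unfolding mpow_def by (rule prod.cong) (auto simp: \<epsilon>_def)
      then show ?thesis by simp
    qed
    then have "homog c 2 z - (z $ p)\<^sup>2 * c \<epsilon> = (\<Sum>\<alpha>\<in>D - {\<epsilon>}. mpow z \<alpha> * c \<alpha>)"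
      unfolding homog_def D_def[symmetric] using finD \<epsilon>D by (simp add: sum_diff1)
    also have "norm \<dots> \<le> (\<Sum>\<alpha>\<in>D - {\<epsilon>}. norm (mpow z \<alpha> * c \<alpha>))" by (rule norm_sum)
    also have "\<dots> \<le> (\<Sum>\<alpha>\<in>D - {\<epsilon>}. (norm z * (\<Sum>i\<in>-{p}. norm (z $ i))) * norm (c \<alpha>))"
      using mono by (intro sum_mono) (auto simp: norm_mult intro!: mult_right_mono)
    also have "\<dots> \<le> (\<Sum>\<alpha>\<in>D. (norm z * (\<Sum>i\<in>-{p}. norm (z $ i))) * norm (c \<alpha>))"
      using finD by (intro sum_mono2) (auto intro!: mult_nonneg_nonneg sum_nonneg)
    also have "\<dots> = C * (norm z * (\<Sum>i\<in>-{p}. norm (z $ i)))"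
      unfolding C_def sum_distrib_left[symmetric] by (rule mult.commute)
    finally show ?thesis .
  qed
  moreover have "C \<ge> 0" by (simp add: C_def sum_nonneg)
  ultimately show ?thesis using that unfolding \<epsilon>_def by blast
qed

lemma scaleR_eq_vector_scale: "t *\<^sub>R v = of_real t *s v" for v :: "('n::finite) cvec"
  unfolding vec_eq_iff vector_scaleR_component by (simp add: scaleR_conv_of_real)

text \<open>
  The coefficients of degree one and the Frechet derivative are both limits of the difference
  quotients along a ray.
\<close>

lemma homog_1_derivative:
  fixes F :: "('n::finite) cvec \<Rightarrow> 'n cvec"
  assumes F: "has_power_series F 0 a" "F 0 = 0" and L: "(F has_derivative L) (at 0)"
  shows "homog (\<lambda>\<alpha>. a \<alpha> $ j) 1 v = L v $ j"
proof (cases "v = 0")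
  case True
  have "L 0 = 0" by (rule linear_0[OF has_derivative_linear[OF L]])
  then show ?thesis using True homog_scale[of "\<lambda>\<alpha>. a \<alpha> $ j" 1 0 0] by simp
next
  case False
  define c where "c = (\<lambda>\<alpha>. a \<alpha> $ j)"
  have s: "germ_series (\<lambda>w. F w $ j) c" unfolding c_def by (rule has_power_series_nth[OF F(1)])
  define t where "t m = 1 / real (Suc m)" for m
  have t: "t \<longlonglongrightarrow> 0" "t m > 0" for m
    using LIMSEQ_inverse_real_of_nat by (simp_all add: t_def[abs_def] inverse_eq_divide)
  define h where "h m = t m *\<^sub>R v" for m
  have hh: "homog c k (h m) = of_real (t m) ^ k * homog c k v" for k m
    unfolding h_def scaleR_eq_vector_scale by (rule homog_scale)
  have hn: "norm (h m) = t m * norm v" for m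
    unfolding h_def using t(2)[of m] by simp
  have hL: "L (h m) $ j = of_real (t m) * L v $ j" for m
    unfolding h_def linear_scale[OF has_derivative_linear[OF L]]
    by (subst vector_scaleR_component) (rule scaleR_conv_of_real)
  have h: "h \<longlonglongrightarrow> 0"
    unfolding h_def using tendsto_scaleR[OF t(1) tendsto_const[of v]] by simp
  have hne: "h m \<noteq> 0" for m using hn[of m] t(2)[of m] False by auto
  have tc: "of_real (t m) \<noteq> (0 :: complex)" for m using t(2)[of m] by simp
  have h0: "homog c 0 w = 0" for w
    using germ_series_constant[OF s] F(2) by (simp add: homog_0)
  obtain \<rho> C where \<rho>: "\<rho> > 0" and C: "C \<ge> 0"
    "\<And>w. norm w \<le> \<rho> \<Longrightarrow> norm (F w $ j - (\<Sum>k<2. homog c k w)) \<le> C * norm w ^ 2"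
    using germ_series_expansion[OF s, of 2] by blast
  have "\<forall>\<^sub>F m in sequentially. norm (h m) < \<rho>"
    by (rule order_tendstoD(2)[OF tendsto_norm_zero[OF h] \<rho>])
  then have "\<forall>\<^sub>F m in sequentially. norm (F (h m) $ j / of_real (t m) - homog c 1 v) \<le> C * norm v ^ 2 * t m"
  proof eventually_elim
    case (elim m)
    have "(\<Sum>k<2. homog c k (h m)) = of_real (t m) * homog c 1 v"
      using hh[of 1 m] by (simp add: numeral_2_eq_2 h0)
    then have "norm (F (h m) $ j - of_real (t m) * homog c 1 v) \<le> C * (t m * norm v) ^ 2"
      using C(2)[of "h m"] elim by (simp add: hn)
    moreover have "F (h m) $ j / of_real (t m) - homog c 1 v =
        (F (h m) $ j - of_real (t m) * homog c 1 v) / of_real (t m)"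
      using tc[of m] by (simp add: diff_divide_distrib)
    ultimately have "norm (F (h m) $ j / of_real (t m) - homog c 1 v) \<le> C * (t m * norm v) ^ 2 / t m"
      using t(2)[of m] by (simp add: norm_divide divide_right_mono)
    also have "\<dots> = C * norm v ^ 2 * t m"
      using t(2)[of m] by (simp add: power2_eq_square)
    finally show ?case .
  qed
  moreover have "(\<lambda>m. C * norm v ^ 2 * t m) \<longlonglongrightarrow> 0" using tendsto_mult_right_zero[OF t(1)] .
  ultimately have "(\<lambda>m. F (h m) $ j / of_real (t m) - homog c 1 v) \<longlonglongrightarrow> 0"
    by (rule Lim_null_comparison)
  then have lim1: "(\<lambda>m. F (h m) $ j / of_real (t m)) \<longlonglongrightarrow> homog c 1 v" by (rule LIM_zero_cancel)
  have "((\<lambda>x. norm (F x - L x) / norm x) \<longlongrightarrow> 0) (at 0)"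
    using L[unfolded has_derivative_at, THEN conjunct2] by (simp add: F(2))
  moreover have "filterlim h (at 0) sequentially"
    unfolding filterlim_at using h hne by simp
  ultimately have "(\<lambda>m. norm (F (h m) - L (h m)) / norm (h m)) \<longlonglongrightarrow> 0"
    by (rule filterlim_compose)
  from tendsto_mult_right_zero[OF this, of "norm v"]
  have d0: "(\<lambda>m. norm v * (norm (F (h m) - L (h m)) / norm (h m))) \<longlonglongrightarrow> 0" .
  have le: "norm (F (h m) $ j / of_real (t m) - L v $ j) \<le> norm v * (norm (F (h m) - L (h m)) / norm (h m))" for m
  proof -
    have "F (h m) $ j / of_real (t m) - L v $ j = (F (h m) - L (h m)) $ j / of_real (t m)"
      using tc[of m] by (simp add: hL diff_divide_distrib)
    then have "norm (F (h m) $ j / of_real (t m) - L v $ j) = norm ((F (h m) - L (h m)) $ j) / t m"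
      using t(2)[of m] by (simp only: norm_divide norm_of_real abs_of_pos)
    also have "\<dots> \<le> norm (F (h m) - L (h m)) / t m"
      by (rule divide_right_mono[OF Finite_Cartesian_Product.norm_nth_le less_imp_le[OF t(2)]])
    also have "\<dots> = norm v * (norm (F (h m) - L (h m)) / norm (h m))"
      using False t(2)[of m] by (simp add: hn)
    finally show ?thesis .
  qed
  have "(\<lambda>m. F (h m) $ j / of_real (t m) - L v $ j) \<longlonglongrightarrow> 0"
    by (rule Lim_null_comparison[OF always_eventually[OF allI[OF le]] d0])
  from LIMSEQ_unique[OF lim1 LIM_zero_cancel[OF this]] show ?thesis by (simp add: c_def)
qed

lemma ix_cases:
  obtains k where "1 \<le> k" "k \<le> CARD('n)" "(i :: 'n::{finite,linorder}) = ix k"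
proof -
  have "pos i \<in> {1..CARD('n)}" using bij_betw_pos[where 'n = 'n] by (auto simp: bij_betw_def)
  then show ?thesis using that[of "pos i"] by simp
qed

lemma ix_eq_iff:
  "1 \<le> j \<Longrightarrow> j \<le> CARD('n) \<Longrightarrow> 1 \<le> k \<Longrightarrow> k \<le> CARD('n) \<Longrightarrow>
    (ix j :: 'n::{finite,linorder}) = ix k \<longleftrightarrow> j = k"
  by (metis pos_ix)

lemma jordan_block_nth:
  fixes z :: "('n::{finite,linorder}) cvec"
  assumes "1 \<le> j" "j \<le> CARD('n)"
  shows "(jordan_block *v z) $ ix j = z $ ix j + (if j < CARD('n) then z $ ix (Suc j) else 0)"
proof -
  have sum: "(jordan_block *v z) $ ix j =
      (\<Sum>i\<in>UNIV. (if i = ix j \<or> pos i = Suc (pos (ix j :: 'n)) then 1 else 0) * z $ i)"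
    by (simp only: matrix_vector_mult_def jordan_block_def vec_lambda_beta)
  show ?thesis
  proof (cases "j < CARD('n)")
    case True
    have "(jordan_block *v z) $ ix j = (\<Sum>i\<in>UNIV. (if i = ix j \<or> i = ix (Suc j) then z $ i else 0))"
      unfolding sum
    proof (rule sum.cong)
      fix i :: 'n
      obtain k where k: "1 \<le> k" "k \<le> CARD('n)" "i = ix k" by (rule ix_cases)
      show "(if i = ix j \<or> pos i = Suc (pos (ix j :: 'n)) then 1 else 0) * z $ i =
          (if i = ix j \<or> i = ix (Suc j) then z $ i else 0)"
        using k assms True by (auto simp: pos_ix ix_eq_iff)
    qed simp
    also have "\<dots> = (\<Sum>i\<in>{ix j, ix (Suc j)}. z $ i)"
      by (rule sum.mono_neutral_cong_right) auto
    also have "\<dots> = z $ ix j + z $ ix (Suc j)"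
      using assms True by (simp add: ix_eq_iff)
    finally show ?thesis using True by simp
  next
    case False
    have "(jordan_block *v z) $ ix j = (\<Sum>i\<in>UNIV. (if i = ix j then z $ i else 0))"
      unfolding sum
    proof (rule sum.cong)
      fix i :: 'n
      obtain k where k: "1 \<le> k" "k \<le> CARD('n)" "i = ix k" by (rule ix_cases)
      show "(if i = ix j \<or> pos i = Suc (pos (ix j :: 'n)) then 1 else 0) * z $ i =
          (if i = ix j then z $ i else 0)"
        using k assms False by (auto simp: pos_ix ix_eq_iff)
    qed simp
    then show ?thesis using False by simp
  qed
qed

text \<open>
  The second-order expansion at the origin of a map with linear part \<open>J\<^sub>n\<close>, with \<open>c j\<close> the
  coefficient of \<open>z\<^sub>1\<^sup>2\<close> in the \<open>j\<close>-th component. The other quadratic terms are absorbed in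
  the error, which is \<open>o(z\<^sub>1\<^sup>2)\<close> on sequences asymptotic to the \<open>z\<^sub>1\<close>-axis.
\<close>

definition jordan_expansion ::
  "(('n::{finite,linorder}) cvec \<Rightarrow> 'n cvec) \<Rightarrow> (nat \<Rightarrow> complex) \<Rightarrow> bool" where
  "jordan_expansion F c \<longleftrightarrow> (\<exists>\<rho>>0. \<exists>C\<ge>0. \<forall>z j. norm z \<le> \<rho> \<longrightarrow> 1 \<le> j \<longrightarrow> j \<le> CARD('n) \<longrightarrow>
     norm (F z $ ix j - (z $ ix j + (if j < CARD('n) then z $ ix (Suc j) else 0)) - (z $ ix 1)\<^sup>2 * c j)
        \<le> C * (norm z * (\<Sum>i\<in>-{ix 1}. norm (z $ i)) + norm z ^ 3))"

lemma jordan_map_expansion: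
  fixes F :: "('n::{finite,linorder}) cvec \<Rightarrow> 'n cvec"
  assumes F: "has_power_series F 0 a" "F 0 = 0" "(F has_derivative (\<lambda>v. jordan_block *v v)) (at 0)"
  shows "jordan_expansion F (\<lambda>j. a (\<lambda>i. if pos i = 1 then 2 else 0) $ ix j)"
proof -
  define S :: "'n cvec \<Rightarrow> real" where "S z = norm z * (\<Sum>i\<in>-{ix 1}. norm (z $ i))" for z
  have S0: "S z \<ge> 0" for z by (simp add: S_def sum_nonneg)
  define sq :: "'n \<Rightarrow> nat" where "sq = (\<lambda>i. if pos i = 1 then 2 else 0)"
  have sq: "sq = (\<lambda>i. if i = ix 1 then 2 else 0)"
  proof
    fix i :: 'n
    obtain k where k: "1 \<le> k" "k \<le> CARD('n)" "i = ix k" by (rule ix_cases)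
    then show "sq i = (if i = ix 1 then 2 else 0)" by (simp add: sq_def pos_ix ix_eq_iff)
  qed
  have "\<exists>\<rho> C. \<rho> > 0 \<and> C \<ge> 0 \<and> (\<forall>z. norm z \<le> \<rho> \<longrightarrow>
      norm (F z $ j - (jordan_block *v z) $ j - (z $ ix 1)\<^sup>2 * a sq $ j) \<le> C * (S z + norm z ^ 3))" for j
  proof -
    define c where "c = (\<lambda>\<alpha>. a \<alpha> $ j)"
    have s: "germ_series (\<lambda>w. F w $ j) c" unfolding c_def by (rule has_power_series_nth[OF F(1)])
    have h0: "homog c 0 w = 0" for w
      using germ_series_constant[OF s] F(2) by (simp add: homog_0)
    obtain \<rho> C where \<rho>: "\<rho> > 0" and C: "C \<ge> 0"
      "\<And>w. norm w \<le> \<rho> \<Longrightarrow> norm (F w $ j - (\<Sum>k<3. homog c k w)) \<le> C * norm w ^ 3"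
      using germ_series_expansion[OF s, of 3] by blast
    obtain D where D: "D \<ge> 0"
      "\<And>z. norm (homog c 2 z - (z $ ix 1)\<^sup>2 * c (\<lambda>i. if i = ix 1 then 2 else 0)) \<le> D * S z"
      using homog_2_estimate[of c "ix 1"] unfolding S_def by blast
    show ?thesis
    proof (intro exI conjI allI impI)
      fix z :: "'n cvec" assume z: "norm z \<le> \<rho>"
      have "(\<Sum>k<3. homog c k z) = (jordan_block *v z) $ j + homog c 2 z"
        using homog_1_derivative[OF F, of j z] h0 by (simp add: eval_nat_numeral c_def)
      then have eq: "F z $ j - (jordan_block *v z) $ j - (z $ ix 1)\<^sup>2 * a sq $ j =
          (F z $ j - (\<Sum>k<3. homog c k z)) + (homog c 2 z - (z $ ix 1)\<^sup>2 * c (\<lambda>i. if i = ix 1 then 2 else 0))"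
        by (simp add: c_def sq)
      have "norm (F z $ j - (jordan_block *v z) $ j - (z $ ix 1)\<^sup>2 * a sq $ j) \<le> C * norm z ^ 3 + D * S z"
        unfolding eq by (rule norm_triangle_mono[OF C(2)[OF z] D(2)])
      also have "\<dots> \<le> (C + D) * (S z + norm z ^ 3)"
        using C(1) D(1) S0[of z] by (simp add: algebra_simps)
      finally show "norm (F z $ j - (jordan_block *v z) $ j - (z $ ix 1)\<^sup>2 * a sq $ j)
          \<le> (C + D) * (S z + norm z ^ 3)" .
    qed (use \<rho> C(1) D(1) in auto)
  qed
  then obtain \<rho> C where R: "\<And>j. \<rho> j > 0" "\<And>j. C j \<ge> 0"
    "\<And>j z. norm z \<le> \<rho> j \<Longrightarrow>
      norm (F z $ j - (jordan_block *v z) $ j - (z $ ix 1)\<^sup>2 * a sq $ j) \<le> C j * (S z + norm z ^ 3)"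
    by metis
  show ?thesis unfolding jordan_expansion_def
  proof (intro exI conjI allI impI)
    show "Min (range \<rho>) > 0" using R(1) by auto
    show "(\<Sum>j\<in>UNIV. C j) \<ge> 0" using R(2) by (simp add: sum_nonneg)
    fix z :: "'n cvec" and j assume z: "norm z \<le> Min (range \<rho>)" and j: "1 \<le> j" "j \<le> CARD('n)"
    have "norm z \<le> \<rho> (ix j)" using z by auto
    from R(3)[OF this]
    have "norm (F z $ ix j - (jordan_block *v z) $ ix j - (z $ ix 1)\<^sup>2 * a sq $ ix j)
        \<le> C (ix j) * (S z + norm z ^ 3)" .
    also have "\<dots> \<le> (\<Sum>j\<in>UNIV. C j) * (S z + norm z ^ 3)"
      using R(2) S0[of z] by (intro mult_right_mono member_le_sum) auto
    finally show "norm (F z $ ix j - (z $ ix j + (if j < CARD('n) then z $ ix (Suc j) else 0)) -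
        (z $ ix 1)\<^sup>2 * a (\<lambda>i. if pos i = 1 then 2 else 0) $ ix j)
      \<le> (\<Sum>j\<in>UNIV. C j) * (norm z * (\<Sum>i\<in>-{ix 1}. norm (z $ i)) + norm z ^ 3)"
      unfolding S_def sq_def jordan_block_nth[OF j] .
  qed
qed

section \<open>Orbits close to the first axis\<close>

lemma norm_vec_le_sum: "norm z \<le> (\<Sum>i\<in>UNIV. norm (z $ i))" for z :: "('n::finite) cvec"
  unfolding norm_vec_def by (rule L2_set_le_sum) simp

text \<open>
  With \<open>P = \<Sum>\<^bsub>i > 1\<^esub> \<bar>z\<^sub>i / z\<^sub>1\<bar>\<close> one has \<open>\<parallel>z\<parallel> \<le> \<bar>z\<^sub>1\<bar> (1 + P)\<close>, so the error terms divided by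
  \<open>z\<^sub>1\<^sup>2\<close> are at most \<open>(1 + P) P + (1 + P)\<^sup>2 \<parallel>z\<parallel>\<close> up to a constant.
\<close>

lemma nonlinear_part_near_axis:
  fixes F :: "('n::{finite,linorder}) cvec \<Rightarrow> 'n cvec" and z :: "nat \<Rightarrow> 'n cvec"
  assumes F: "jordan_expansion F c" and j: "1 \<le> j" "j \<le> CARD('n)"
    and z: "z \<longlonglongrightarrow> 0" "\<forall>\<^sub>F m in sequentially. z m $ ix 1 \<noteq> 0"
    and ax: "\<And>i. i \<noteq> ix 1 \<Longrightarrow> (\<lambda>m. z m $ i / z m $ ix 1) \<longlonglongrightarrow> 0"
  shows "(\<lambda>m. (F (z m) $ ix j - (z m $ ix j + (if j < CARD('n) then z m $ ix (Suc j) else 0)))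
            / (z m $ ix 1)\<^sup>2) \<longlonglongrightarrow> c j"
proof -
  obtain \<rho> C where \<rho>: "\<rho> > 0" and C: "C \<ge> 0" and est: "\<And>z. norm z \<le> \<rho> \<Longrightarrow>
     norm (F z $ ix j - (z $ ix j + (if j < CARD('n) then z $ ix (Suc j) else 0)) - (z $ ix 1)\<^sup>2 * c j)
        \<le> C * (norm z * (\<Sum>i\<in>-{ix 1}. norm (z $ i)) + norm z ^ 3)"
    using F j unfolding jordan_expansion_def by meson
  define P where "P m = (\<Sum>i\<in>-{ix 1}. norm (z m $ i / z m $ ix 1))" for m
  define L where "L m = F (z m) $ ix j - (z m $ ix j + (if j < CARD('n) then z m $ ix (Suc j) else 0))" for m
  have "(\<lambda>m. \<Sum>i\<in>-{ix 1}. norm (z m $ i / z m $ ix 1)) \<longlonglongrightarrow> (\<Sum>i\<in>-{ix 1 :: 'n}. 0)"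
    by (intro tendsto_sum tendsto_norm_zero ax) auto
  then have P: "P \<longlonglongrightarrow> 0" by (simp add: P_def[abs_def])
  have nz: "(\<lambda>m. norm (z m)) \<longlonglongrightarrow> 0" by (rule tendsto_norm_zero[OF z(1)])
  have "\<forall>\<^sub>F m in sequentially. norm (z m) < \<rho>" using nz \<rho> by (rule order_tendstoD(2))
  with z(2) have "\<forall>\<^sub>F m in sequentially.
      norm (L m / (z m $ ix 1)\<^sup>2 - c j) \<le> C * ((1 + P m) * P m + (1 + P m)\<^sup>2 * norm (z m))"
  proof eventually_elim
    case (elim m)
    define x where "x = norm (z m $ ix 1)"
    have x: "x > 0" using elim by (simp add: x_def)
    have sum: "(\<Sum>i\<in>-{ix 1}. norm (z m $ i)) = x * P m"
      using x by (simp add: P_def sum_distrib_left norm_divide x_def)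
    have "norm (z m) \<le> (\<Sum>i\<in>UNIV. norm (z m $ i))" by (rule norm_vec_le_sum)
    also have "\<dots> = x + (\<Sum>i\<in>-{ix 1}. norm (z m $ i))"
      by (simp add: sum.remove[of UNIV "ix 1"] x_def Compl_eq_Diff_UNIV)
    finally have "norm (z m) \<le> x + x * P m" by (simp only: sum)
    then have q: "norm (z m) \<le> x * (1 + P m)" by (simp add: algebra_simps)
    have P0: "P m \<ge> 0" by (simp add: P_def sum_nonneg)
    have "norm (z m) ^ 3 = (norm (z m))\<^sup>2 * norm (z m)" by (simp add: power2_eq_square power3_eq_cube)
    also have "\<dots> \<le> (x * (1 + P m))\<^sup>2 * norm (z m)" using q by (intro mult_right_mono power_mono) auto
    finally have cube: "norm (z m) ^ 3 \<le> x\<^sup>2 * ((1 + P m)\<^sup>2 * norm (z m))" by (simp add: power_mult_distrib mult.assoc)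
    have "norm (z m) * (x * P m) \<le> x * (1 + P m) * (x * P m)" using q x P0 by (intro mult_right_mono) auto
    then have sq: "norm (z m) * (x * P m) \<le> x\<^sup>2 * ((1 + P m) * P m)" by (simp add: power2_eq_square mult_ac)
    have "norm (L m - (z m $ ix 1)\<^sup>2 * c j) \<le> C * (norm (z m) * (x * P m) + norm (z m) ^ 3)"
    proof -
      have "norm (z m) \<le> \<rho>" using elim by simp
      from est[OF this] show ?thesis unfolding L_def[symmetric] sum .
    qed
    also have "\<dots> \<le> C * (x\<^sup>2 * ((1 + P m) * P m) + x\<^sup>2 * ((1 + P m)\<^sup>2 * norm (z m)))"
      using C cube sq by (intro mult_left_mono add_mono) auto
    finally have "norm (L m - (z m $ ix 1)\<^sup>2 * c j) / x\<^sup>2 \<le> C * ((1 + P m) * P m + (1 + P m)\<^sup>2 * norm (z m))"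
      using x by (simp add: field_simps)
    moreover have "L m / (z m $ ix 1)\<^sup>2 - c j = (L m - (z m $ ix 1)\<^sup>2 * c j) / (z m $ ix 1)\<^sup>2"
      using elim by (simp add: field_simps)
    ultimately show ?case by (simp add: norm_divide norm_power x_def)
  qed
  then have bound: "\<forall>\<^sub>F m in sequentially.
      norm (L m / (z m $ ix 1)\<^sup>2 - c j) \<le> C * ((1 + P m) * P m + (1 + P m)\<^sup>2 * norm (z m))" .
  have "(\<lambda>m. C * ((1 + P m) * P m + (1 + P m)\<^sup>2 * norm (z m))) \<longlonglongrightarrow> C * ((1 + 0) * 0 + (1 + 0)\<^sup>2 * 0)"
    by (intro tendsto_intros P nz)
  then have lim: "(\<lambda>m. C * ((1 + P m) * P m + (1 + P m)\<^sup>2 * norm (z m))) \<longlonglongrightarrow> 0" by simp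
  show ?thesis using LIM_zero_cancel[OF Lim_null_comparison[OF bound lim]] unfolding L_def .
qed

text \<open>
  Here \<open>\<parallel>z\<parallel> = O(z\<^sub>i)\<close>, because the affine coordinates \<open>z\<^sub>l / z\<^sub>i\<close> converge, and the nonlinear part is
  \<open>O(\<parallel>z\<parallel>\<^sup>2)\<close>.
\<close>

lemma linear_part_dominates:
  fixes F :: "('n::{finite,linorder}) cvec \<Rightarrow> 'n cvec" and z :: "nat \<Rightarrow> 'n cvec"
  assumes F: "jordan_expansion F c" and j: "1 \<le> j" "j \<le> CARD('n)"
    and z: "z \<longlonglongrightarrow> 0" "\<forall>\<^sub>F m in sequentially. z m $ i \<noteq> 0"
    and dir: "\<And>l. (\<lambda>m. z m $ l / z m $ i) \<longlonglongrightarrow> u l"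
  shows "(\<lambda>m. (F (z m) $ ix j - (z m $ ix j + (if j < CARD('n) then z m $ ix (Suc j) else 0)))
            / z m $ i) \<longlonglongrightarrow> 0"
proof -
  obtain \<rho> C where \<rho>: "\<rho> > 0" and C: "C \<ge> 0" and est: "\<And>z. norm z \<le> \<rho> \<Longrightarrow>
     norm (F z $ ix j - (z $ ix j + (if j < CARD('n) then z $ ix (Suc j) else 0)) - (z $ ix 1)\<^sup>2 * c j)
        \<le> C * (norm z * (\<Sum>i\<in>-{ix 1}. norm (z $ i)) + norm z ^ 3)"
    using F j unfolding jordan_expansion_def by meson
  define L where "L m = F (z m) $ ix j - (z m $ ix j + (if j < CARD('n) then z m $ ix (Suc j) else 0))" for m
  define Q where "Q m = (\<Sum>l\<in>UNIV. norm (z m $ l / z m $ i))" for m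
  have Q: "Q \<longlonglongrightarrow> (\<Sum>l\<in>UNIV. norm (u l))"
    unfolding Q_def by (intro tendsto_sum tendsto_norm dir)
  have nz: "(\<lambda>m. norm (z m)) \<longlonglongrightarrow> 0" by (rule tendsto_norm_zero[OF z(1)])
  define N where "N = real CARD('n)"
  have "\<forall>\<^sub>F m in sequentially. norm (z m) < min \<rho> 1" using nz \<rho> by (intro order_tendstoD(2)) auto
  with z(2) have "\<forall>\<^sub>F m in sequentially. norm (L m / z m $ i) \<le> (norm (c j) + C * (N + 1)) * (Q m * norm (z m))"
  proof eventually_elim
    case (elim m)
    define r where "r = norm (z m)"
    have r: "r \<ge> 0" "r \<le> 1" using elim by (auto simp: r_def)
    have le: "norm (z m $ l) \<le> r" for l unfolding r_def by (rule Finite_Cartesian_Product.norm_nth_le)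
    have "r \<le> (\<Sum>l\<in>UNIV. norm (z m $ l))" unfolding r_def by (rule norm_vec_le_sum)
    also have "\<dots> = norm (z m $ i) * Q m" using elim by (simp add: Q_def sum_distrib_left norm_divide)
    finally have rq: "r \<le> norm (z m $ i) * Q m" .
    have "(\<Sum>l\<in>-{ix 1}. norm (z m $ l)) \<le> (\<Sum>l\<in>UNIV. norm (z m $ l))" by (intro sum_mono2) auto
    also have "\<dots> \<le> (\<Sum>l\<in>(UNIV :: 'n set). r)" by (intro sum_mono le)
    finally have s: "(\<Sum>l\<in>-{ix 1}. norm (z m $ l)) \<le> N * r" by (simp add: N_def)
    have "r ^ 3 \<le> r\<^sup>2" using r by (intro power_decreasing) auto
    have b: "norm (L m - (z m $ ix 1)\<^sup>2 * c j) \<le> C * (N + 1) * r\<^sup>2"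
    proof -
      have "norm (L m - (z m $ ix 1)\<^sup>2 * c j) \<le> C * (r * (\<Sum>l\<in>-{ix 1}. norm (z m $ l)) + r ^ 3)"
      proof -
        have "norm (z m) \<le> \<rho>" using elim by simp
        from est[OF this] show ?thesis unfolding L_def[symmetric] r_def .
      qed
      also have "\<dots> \<le> C * (r * (N * r) + r\<^sup>2)"
        using C r s \<open>r ^ 3 \<le> r\<^sup>2\<close> by (intro mult_left_mono add_mono) auto
      also have "\<dots> = C * (N + 1) * r\<^sup>2" by (simp add: algebra_simps power2_eq_square)
      finally show ?thesis .
    qed
    have "norm ((z m $ ix 1)\<^sup>2 * c j) \<le> r\<^sup>2 * norm (c j)"
      using le[of "ix 1"] by (simp add: norm_mult norm_power mult_right_mono power_mono)
    moreover have "norm (L m) \<le> norm (L m - (z m $ ix 1)\<^sup>2 * c j) + norm ((z m $ ix 1)\<^sup>2 * c j)"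
      using norm_triangle_ineq[of "L m - (z m $ ix 1)\<^sup>2 * c j" "(z m $ ix 1)\<^sup>2 * c j"] by simp
    ultimately have "norm (L m) \<le> C * (N + 1) * r\<^sup>2 + r\<^sup>2 * norm (c j)"
      using b by linarith
    also have "\<dots> = (norm (c j) + C * (N + 1)) * (r * r)" by (simp add: algebra_simps power2_eq_square)
    also have "\<dots> \<le> (norm (c j) + C * (N + 1)) * ((norm (z m $ i) * Q m) * r)"
      by (rule mult_left_mono[OF mult_right_mono[OF rq r(1)]]) (use C in \<open>simp add: N_def\<close>)
    finally have "norm (L m) / norm (z m $ i) \<le> (norm (c j) + C * (N + 1)) * (Q m * r)"
      using elim by (subst pos_divide_le_eq) (simp_all add: mult_ac)
    then show ?case by (simp only: norm_divide r_def)
  qed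
  then have bound: "\<forall>\<^sub>F m in sequentially. norm (L m / z m $ i) \<le> (norm (c j) + C * (N + 1)) * (Q m * norm (z m))" .
  have "(\<lambda>m. Q m * norm (z m)) \<longlonglongrightarrow> 0"
    using tendsto_mult[OF Q nz] by simp
  from tendsto_mult_right_zero[OF this]
  have lim: "(\<lambda>m. (norm (c j) + C * (N + 1)) * (Q m * norm (z m))) \<longlonglongrightarrow> 0" .
  show ?thesis using Lim_null_comparison[OF bound lim] unfolding L_def .
qed

text \<open>
  The limit of \<open>y\<^sub>m\<^sub>+\<^sub>1\<^sub>,\<^sub>j / y\<^sub>m\<^sub>,\<^sub>i\<close> is computed in two ways: directly, and through the directions of \<open>y\<^sub>m\<^sub>+\<^sub>1\<close>,
  which converge to \<open>u\<close> as well. When the direct limits are the images of \<open>u\<close> under a linear map, this says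
  that \<open>u\<close> is an eigenvector.
\<close>

lemma limit_direction_eigen:
  fixes y :: "nat \<Rightarrow> 'j \<Rightarrow> complex"
  assumes "\<forall>\<^sub>F m in sequentially. y m i \<noteq> 0"
    and u: "(\<lambda>m. y m j / y m i) \<longlonglongrightarrow> u"
    and t: "(\<lambda>m. y (Suc m) j / y m i) \<longlonglongrightarrow> t" "(\<lambda>m. y (Suc m) i / y m i) \<longlonglongrightarrow> \<mu>"
  shows "t = u * \<mu>"
proof -
  have "(\<lambda>m. y (Suc m) j / y (Suc m) i * (y (Suc m) i / y m i)) \<longlonglongrightarrow> u * \<mu>"
    by (intro tendsto_mult LIMSEQ_Suc[OF u] t(2))
  moreover have "\<forall>\<^sub>F m in sequentially. y (Suc m) i \<noteq> 0"
    using assms(1) eventually_sequentially_Suc[of "\<lambda>m. y m i \<noteq> 0"] by simp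
  then have "\<forall>\<^sub>F m in sequentially. y (Suc m) j / y (Suc m) i * (y (Suc m) i / y m i) = y (Suc m) j / y m i"
    by eventually_elim simp
  ultimately have "(\<lambda>m. y (Suc m) j / y m i) \<longlonglongrightarrow> u * \<mu>" by (rule Lim_transform_eventually)
  with t(1) show ?thesis by (rule LIMSEQ_unique)
qed

text \<open>
  If \<open>\<mu> = 1\<close>, each eigenvalue equation gives the vanishing of the next coordinate. Any other \<open>\<mu>\<close>
  forces \<open>u\<^sub>n = 0\<close> and then, going down, \<open>u = 0\<close>.
\<close>

lemma jordan_block_eigenvector:
  fixes u :: "nat \<Rightarrow> complex"
  assumes step: "\<And>j. s < j \<Longrightarrow> j < n \<Longrightarrow> u j + u (Suc j) = u j * \<mu>" and last: "u n = u n * \<mu>"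
    and nz: "s < k" "k \<le> n" "u k \<noteq> 0" and j: "Suc s < j" "j \<le> n"
  shows "u j = 0"
proof (cases "\<mu> = 1")
  case True
  then show ?thesis using step[of "j - 1"] j by auto
next
  case False
  have "u l = 0" if "s < l" "l \<le> n" for l
    using that(2,1)
  proof (induction l rule: inc_induct)
    case base
    then show ?case using last False by simp
  next
    case (step l)
    then show ?case using assms(1)[of l] False by simp
  qed
  then show ?thesis using nz by blast
qed

lemma orbit_direction_eigenvector:
  fixes F :: "('n::{finite,linorder}) cvec \<Rightarrow> 'n cvec" and z :: "nat \<Rightarrow> 'n cvec"
  assumes F: "jordan_expansion F c" and orbit: "\<And>m. z (Suc m) = F (z m)"
    and z: "z \<longlonglongrightarrow> 0" "\<forall>\<^sub>F m in sequentially. z m $ i \<noteq> 0"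
    and dir: "\<And>l. (\<lambda>m. z m $ l / z m $ i) \<longlonglongrightarrow> u l" and l: "l \<noteq> ix 1"
  shows "u l = 0"
proof -
  obtain k where k: "1 \<le> k" "k \<le> CARD('n)" "i = ix k" by (rule ix_cases)
  obtain h where h: "1 \<le> h" "h \<le> CARD('n)" "l = ix h" by (rule ix_cases)
  define t where "t j = u (ix j) + (if j < CARD('n) then u (ix (Suc j)) else 0)" for j
  have t: "(\<lambda>m. z (Suc m) $ ix j / z m $ i) \<longlonglongrightarrow> t j" if j: "1 \<le> j" "j \<le> CARD('n)" for j
  proof -
    have "(\<lambda>m. (F (z m) $ ix j - (z m $ ix j + (if j < CARD('n) then z m $ ix (Suc j) else 0))) / z m $ i
        + (z m $ ix j / z m $ i + (if j < CARD('n) then z m $ ix (Suc j) / z m $ i else 0))) \<longlonglongrightarrow> 0 + t j"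
      unfolding t_def
      by (intro tendsto_add linear_part_dominates[OF F j z dir] dir) (cases "j < CARD('n)"; simp add: dir)
    then show ?thesis by (simp add: orbit diff_divide_distrib add_divide_distrib if_distrib cong: if_cong)
  qed
  have eig: "t j = u (ix j) * t k" if j: "1 \<le> j" "j \<le> CARD('n)" for j
    by (rule limit_direction_eigen[where y = "\<lambda>m j. z m $ ix j" and i = k])
      (use z(2) dir t j k in auto)
  have "(\<lambda>m. z m $ i / z m $ i) \<longlonglongrightarrow> 1"
    using z(2) by (intro tendsto_eventually) (auto elim: eventually_mono)
  with dir[of i] have "u i = 1" by (rule LIMSEQ_unique)
  have "u (ix h) = 0"
  proof (rule jordan_block_eigenvector[where u = "\<lambda>j. u (ix j)" and s = 0 and n = "CARD('n)" and k = k])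
    show "u (ix j) + u (ix (Suc j)) = u (ix j) * t k" if "0 < j" "j < CARD('n)" for j
      using eig[of j] that by (simp add: t_def)
    show "u (ix CARD('n)) = u (ix CARD('n)) * t k"
      using eig[of "CARD('n)"] by (simp add: t_def Suc_le_eq card_gt_0_iff)
    show "Suc 0 < h" using h l by (cases "h = 1") auto
  qed (use k h \<open>u i = 1\<close> in auto)
  then show ?thesis using h by simp
qed

definition normal_coord :: "('n::{finite,linorder}) cvec \<Rightarrow> nat \<Rightarrow> complex" where
  "normal_coord z j = (if j = 1 then (z $ ix 1)\<^sup>2 else z $ ix j)"

text \<open>
  On the normal directions \<open>(z\<^sub>1\<^sup>2, z\<^sub>s\<^sub>+\<^sub>1, \<dots>, z\<^sub>n)\<close> the map acts asymptotically by a single unipotent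
  Jordan block, because \<open>z\<^sub>1\<^sup>2\<close> enters the last coordinate with the coefficient \<open>c n \<noteq> 0\<close>. The only
  eigenvector is the one along \<open>z\<^sub>s\<^sub>+\<^sub>1\<close>.
\<close>

lemma normal_direction_eigenvector:
  fixes F :: "('n::{finite,linorder}) cvec \<Rightarrow> 'n cvec" and z :: "nat \<Rightarrow> 'n cvec"
  assumes F: "jordan_expansion F c" and orbit: "\<And>m. z (Suc m) = F (z m)"
    and s: "1 \<le> s" "s < CARD('n)" and c: "c CARD('n) \<noteq> 0"
    and z: "z \<longlonglongrightarrow> 0" "\<forall>\<^sub>F m in sequentially. z m $ ix 1 \<noteq> 0"
    and ax: "\<And>i. i \<noteq> ix 1 \<Longrightarrow> (\<lambda>m. z m $ i / z m $ ix 1) \<longlonglongrightarrow> 0"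
    and i: "i = 1 \<or> s < i" "i \<le> CARD('n)" "\<forall>\<^sub>F m in sequentially. normal_coord (z m) i \<noteq> 0"
    and dir: "\<And>j. j = 1 \<or> s < j \<Longrightarrow> j \<le> CARD('n) \<Longrightarrow>
      (\<lambda>m. normal_coord (z m) j / normal_coord (z m) i) \<longlonglongrightarrow> u j"
  shows "u 1 = 0" "\<And>j. Suc s < j \<Longrightarrow> j \<le> CARD('n) \<Longrightarrow> u j = 0"
proof -
  define y where "y m j = normal_coord (z m) j" for m j
  define t where "t j = (if j = 1 then u 1 else u j + (if j < CARD('n) then u (Suc j) else 0) + u 1 * c j)" for j
  have n1: "1 < CARD('n)" using s by simp
  have two: "(\<lambda>m. z m $ ix 2 / z m $ ix 1) \<longlonglongrightarrow> 0"
    using n1 by (intro ax) (simp add: ix_eq_iff)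
  have z1: "(\<lambda>m. z m $ ix 1) \<longlonglongrightarrow> 0" using tendsto_vec_nth[OF z(1)] by simp
  have first: "(\<lambda>m. z (Suc m) $ ix 1 / z m $ ix 1) \<longlonglongrightarrow> 1"
  proof -
    have "(\<lambda>m. z m $ ix 1 * ((F (z m) $ ix 1 - (z m $ ix 1 + (if 1 < CARD('n) then z m $ ix (Suc 1) else 0)))
            / (z m $ ix 1)\<^sup>2) + 1 + z m $ ix 2 / z m $ ix 1) \<longlonglongrightarrow> 0 * c 1 + 1 + 0"
      by (intro tendsto_intros z1 two nonlinear_part_near_axis[OF F _ _ z ax]) (use n1 in auto)
    moreover have "\<forall>\<^sub>F m in sequentially. z m $ ix 1 * ((F (z m) $ ix 1 - (z m $ ix 1 + (if 1 < CARD('n) then z m $ ix (Suc 1) else 0)))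
            / (z m $ ix 1)\<^sup>2) + 1 + z m $ ix 2 / z m $ ix 1 = z (Suc m) $ ix 1 / z m $ ix 1"
      using z(2) by eventually_elim (use n1 in \<open>simp add: orbit power2_eq_square field_simps numeral_2_eq_2\<close>)
    from Lim_transform_eventually[OF calculation this] show ?thesis by simp
  qed
  have t: "(\<lambda>m. y (Suc m) j / y m i) \<longlonglongrightarrow> t j" if j: "j = 1 \<or> s < j" "j \<le> CARD('n)" for j
  proof (cases "j = 1")
    case True
    have "(\<lambda>m. (z (Suc m) $ ix 1 / z m $ ix 1)\<^sup>2 * (y m 1 / y m i)) \<longlonglongrightarrow> 1\<^sup>2 * u 1"
      unfolding y_def by (intro tendsto_intros first dir) (use n1 in auto)
    moreover have "\<forall>\<^sub>F m in sequentially. (z (Suc m) $ ix 1 / z m $ ix 1)\<^sup>2 * (y m 1 / y m i) = y (Suc m) 1 / y m i"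
      using z(2) by eventually_elim (simp add: y_def normal_coord_def power_divide)
    from Lim_transform_eventually[OF calculation this] show ?thesis using True by (simp add: t_def )
  next
    case False
    then have j': "s < j" "1 \<le> j" using j s by auto
    have "(\<lambda>m. y m j / y m i + (if j < CARD('n) then y m (Suc j) / y m i else 0)
        + (y m 1 / y m i) * ((F (z m) $ ix j - (z m $ ix j + (if j < CARD('n) then z m $ ix (Suc j) else 0)))
            / (z m $ ix 1)\<^sup>2)) \<longlonglongrightarrow> u j + (if j < CARD('n) then u (Suc j) else 0) + u 1 * c j"
      unfolding y_def
      by (intro tendsto_add tendsto_mult nonlinear_part_near_axis[OF F _ _ z ax] dir)
        (use j j' n1 in \<open>auto intro!: dir\<close>)
    moreover have "\<forall>\<^sub>F m in sequentially. y m j / y m i + (if j < CARD('n) then y m (Suc j) / y m i else 0)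
        + (y m 1 / y m i) * ((F (z m) $ ix j - (z m $ ix j + (if j < CARD('n) then z m $ ix (Suc j) else 0)))
            / (z m $ ix 1)\<^sup>2) = y (Suc m) j / y m i"
      using z(2) i(3)
      by eventually_elim (use j' False in \<open>simp add: y_def normal_coord_def orbit field_simps\<close>)
    from Lim_transform_eventually[OF calculation this] show ?thesis using False by (simp add: t_def )
  qed
  have eig: "t j = u j * t i" if j: "j = 1 \<or> s < j" "j \<le> CARD('n)" for j
    by (rule limit_direction_eigen[where y = y and i = i])
      (use i(3) dir[OF j] t[OF j] t[OF i(1,2)] in \<open>auto simp: y_def\<close>)
  have "(\<lambda>m. normal_coord (z m) i / normal_coord (z m) i) \<longlonglongrightarrow> 1"
    using i(3) by (intro tendsto_eventually) (auto elim: eventually_mono)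
  with dir[OF i(1,2)] have ui: "u i = 1" by (rule LIMSEQ_unique)
  \<comment> \<open>If \<open>u\<^sub>1 \<noteq> 0\<close>, the eigenvalue is one, and the last equation reads \<open>c\<^sub>n u\<^sub>1 = 0\<close>.\<close>
  show u1: "u 1 = 0"
  proof (rule ccontr)
    assume "u 1 \<noteq> 0"
    then have "t i = 1" using eig[of 1] n1 by (simp add: t_def)
    then have "u 1 * c CARD('n) = 0" using eig[of "CARD('n)"] n1 s by (simp add: t_def)
    then show False using c \<open>u 1 \<noteq> 0\<close> by simp
  qed
  show "u j = 0" if "Suc s < j" "j \<le> CARD('n)" for j
  proof (rule jordan_block_eigenvector[where u = u and s = s and n = "CARD('n)" and k = i and \<mu> = "t i"])
    show "u j + u (Suc j) = u j * t i" if "s < j" "j < CARD('n)" for j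
      using eig[of j] that u1 s by (simp add: t_def)
    show "u CARD('n) = u CARD('n) * t i"
      using eig[of "CARD('n)"] s n1 u1 by (simp add: t_def)
    show "s < i" using i(1) u1 ui by auto
  qed (use i ui that in auto)
qed

text \<open>
  The ratio is the product of the factors \<open>w\<^sub>j\<close> with \<open>h < j \<le> k\<close>.
\<close>

lemma chain_ratio_tendsto_0:
  fixes z w :: "nat \<Rightarrow> nat \<Rightarrow> complex"
  assumes rel: "\<And>j. 2 \<le> j \<Longrightarrow> j \<le> s \<Longrightarrow> \<forall>\<^sub>F m in sequentially. z m j = w m j * z m (j - 1)"
    and w: "\<And>j. 2 \<le> j \<Longrightarrow> j \<le> s \<Longrightarrow> (\<lambda>m. w m j) \<longlonglongrightarrow> 0"
    and nz: "\<forall>\<^sub>F m in sequentially. z m h \<noteq> 0" and h: "1 \<le> h" "h < k" "k \<le> s"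
  shows "(\<lambda>m. z m k / z m h) \<longlonglongrightarrow> 0"
proof -
  have "h + Suc d \<le> s \<Longrightarrow> (\<lambda>m. z m (h + Suc d) / z m h) \<longlonglongrightarrow> 0" for d
  proof (induction d)
    case 0
    then have "\<forall>\<^sub>F m in sequentially. z m (Suc h) = w m (Suc h) * z m h" "(\<lambda>m. w m (Suc h)) \<longlonglongrightarrow> 0"
      using rel[of "Suc h"] w[of "Suc h"] h by auto
    from this(1) nz have "\<forall>\<^sub>F m in sequentially. w m (Suc h) = z m (h + Suc 0) / z m h"
      by eventually_elim simp
    with \<open>(\<lambda>m. w m (Suc h)) \<longlonglongrightarrow> 0\<close> show ?case by (rule Lim_transform_eventually)
  next
    case (Suc d)
    let ?k = "h + Suc (Suc d)"
    have "(\<lambda>m. w m ?k * (z m (h + Suc d) / z m h)) \<longlonglongrightarrow> 0 * 0"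
      using Suc w[of ?k] h by (intro tendsto_mult) auto
    moreover have "\<forall>\<^sub>F m in sequentially. z m ?k = w m ?k * z m (h + Suc d)"
      using rel[of ?k] Suc(2) h by simp
    then have "\<forall>\<^sub>F m in sequentially. w m ?k * (z m (h + Suc d) / z m h) = z m ?k / z m h"
      by eventually_elim simp
    from Lim_transform_eventually[OF calculation this] show ?case by simp
  qed
  from this[of "k - h - 1"] h show ?thesis by simp
qed

text \<open>
  The coordinates \<open>w = \<chi>\<^sub>s(\<pi>\<^sub>s\<^sup>-\<^sup>1(z))\<close>, in a form free of divisions.
\<close>

definition chart_relation :: "nat \<Rightarrow> ('n::{finite,linorder}) cvec \<Rightarrow> 'n cvec \<Rightarrow> bool" where
  "chart_relation s w z \<longleftrightarrow>
     (z $ ix 1)\<^sup>2 = w $ ix 1 * z $ ix s \<and>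
     (\<forall>j. 2 \<le> j \<longrightarrow> j \<le> s \<longrightarrow> z $ ix j = w $ ix j * z $ ix (j - 1)) \<and>
     (\<forall>j. s < j \<longrightarrow> j \<le> CARD('n) \<longrightarrow> z $ ix j = w $ ix j * z $ ix s)"

lemma chart_relation_nonzero:
  fixes z :: "('n::{finite,linorder}) cvec"
  assumes rel: "chart_relation s w z" and s: "1 \<le> s" "s \<le> CARD('n)" and z: "z \<noteq> 0"
  shows "1 \<le> j \<Longrightarrow> j \<le> s \<Longrightarrow> z $ ix j \<noteq> 0" "1 \<le> j \<Longrightarrow> j \<le> s \<Longrightarrow> w $ ix j \<noteq> 0"
proof -
  have r1: "(z $ ix 1)\<^sup>2 = w $ ix 1 * z $ ix s"
    and r2: "\<And>j. 2 \<le> j \<Longrightarrow> j \<le> s \<Longrightarrow> z $ ix j = w $ ix j * z $ ix (j - 1)"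
    and r3: "\<And>j. s < j \<Longrightarrow> j \<le> CARD('n) \<Longrightarrow> z $ ix j = w $ ix j * z $ ix s"
    using rel unfolding chart_relation_def by blast+
  have zs: "z $ ix s \<noteq> 0"
  proof
    assume zs: "z $ ix s = 0"
    have low: "j \<le> s \<Longrightarrow> z $ ix j = 0" if "1 \<le> j" for j
      using that
    proof (induction j rule: dec_induct)
      case base
      have "(z $ ix 1)\<^sup>2 = 0" unfolding r1 zs by simp
      then show ?case by simp
    next
      case (step j)
      then show ?case using r2[of "Suc j"] by simp
    qed
    have "z $ i = 0" for i
    proof -
      obtain k where k: "1 \<le> k" "k \<le> CARD('n)" "i = ix k" by (rule ix_cases)
      show ?thesis
      proof (cases "k \<le> s")
        case True
        then show ?thesis using low k by simp
      next
        case False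
        then show ?thesis using r3[of k] zs k by simp
      qed
    qed
    then show False using z by (simp add: vec_eq_iff)
  qed
  have pos: "z $ ix j \<noteq> 0" if "j \<le> s" "1 \<le> j" for j
    using that
  proof (induction j rule: inc_induct)
    case base
    then show ?case using zs by simp
  next
    case (step j)
    have "z $ ix (Suc j) = w $ ix (Suc j) * z $ ix j" using r2[of "Suc j"] step by simp
    then show ?case using step by auto
  qed
  then show "1 \<le> j \<Longrightarrow> j \<le> s \<Longrightarrow> z $ ix j \<noteq> 0" by simp
  show "w $ ix j \<noteq> 0" if j: "1 \<le> j" "j \<le> s"
  proof
    assume w0: "w $ ix j = 0"
    show False
    proof (cases "j = 1")
      case True
      have "(z $ ix 1)\<^sup>2 = 0" using r1 w0 unfolding True by simp
      then show False using pos[of 1] s by simp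
    next
      case False
      then have "z $ ix j = 0" using r2[of j] w0 j by simp
      then show False using pos[of j] j by simp
    qed
  qed
qed

lemma chart_sequence_axis:
  fixes z w :: "nat \<Rightarrow> ('n::{finite,linorder}) cvec"
  assumes rel: "\<forall>\<^sub>F m in sequentially. chart_relation s (w m) (z m)"
    and s: "1 \<le> s" "s \<le> CARD('n)" and w: "w \<longlonglongrightarrow> 0" and z: "\<And>m. z m \<noteq> 0" and i: "i \<noteq> ix 1"
  shows "(\<lambda>m. z m $ i / z m $ ix 1) \<longlonglongrightarrow> 0"
proof -
  have wj: "(\<lambda>m. w m $ j) \<longlonglongrightarrow> 0" for j using tendsto_vec_nth[OF w] by simp
  have nz: "\<forall>\<^sub>F m in sequentially. z m $ ix 1 \<noteq> 0"
    using rel by eventually_elim (use chart_relation_nonzero(1) s z in blast)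
  have low: "(\<lambda>m. z m $ ix k / z m $ ix 1) \<longlonglongrightarrow> 0" if "1 < k" "k \<le> s" for k
  proof (rule chain_ratio_tendsto_0[where z = "\<lambda>m j. z m $ ix j" and w = "\<lambda>m j. w m $ ix j" and s = s])
    show "\<forall>\<^sub>F m in sequentially. z m $ ix j = w m $ ix j * z m $ ix (j - 1)" if "2 \<le> j" "j \<le> s" for j
      using rel by eventually_elim (use that in \<open>simp add: chart_relation_def\<close>)
  qed (use that nz wj in auto)
  obtain k where k: "1 \<le> k" "k \<le> CARD('n)" "i = ix k" by (rule ix_cases)
  have k1: "1 < k" using k i by (cases "k = 1") auto
  show ?thesis
  proof (cases "k \<le> s")
    case True
    then show ?thesis using low k1 k by simp
  next
    case False
    obtain \<kappa> where \<kappa>: "(\<lambda>m. z m $ ix s / z m $ ix 1) \<longlonglongrightarrow> \<kappa>"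
    proof (cases "s = 1")
      case True
      have "(\<lambda>m. z m $ ix s / z m $ ix 1) \<longlonglongrightarrow> 1"
        using nz True by (intro tendsto_eventually) (auto elim: eventually_mono)
      then show ?thesis by (rule that)
    next
      case False
      then show ?thesis using low[of s] s by (intro that) auto
    qed
    have "(\<lambda>m. w m $ ix k * (z m $ ix s / z m $ ix 1)) \<longlonglongrightarrow> 0"
      using tendsto_mult[OF wj \<kappa>] by simp
    moreover have "\<forall>\<^sub>F m in sequentially. w m $ ix k * (z m $ ix s / z m $ ix 1) = z m $ i / z m $ ix 1"
      using rel by eventually_elim (use False k in \<open>simp add: chart_relation_def\<close>)
    ultimately show ?thesis by (rule Lim_transform_eventually)
  qed
qed

section \<open>The multipliers in the last chart\<close>

text \<open>
  For \<open>z = \<pi>\<^sub>n(\<chi>\<^sub>n\<^sup>-\<^sup>1(w))\<close> one has \<open>F\<^sub>j(z) / z\<^sub>j = 1 + step_slope n c\<^sub>n w j\<close> up to terms of higher order: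
  \<open>z\<^sub>j\<^sub>+\<^sub>1 / z\<^sub>j = w\<^sub>j\<^sub>+\<^sub>1\<close> comes from \<open>J\<^sub>n\<close>, and \<open>z\<^sub>1\<^sup>2 / z\<^sub>n = w\<^sub>1\<close> enters the last component through \<open>c\<^sub>n\<close>.
\<close>

definition step_slope :: "nat \<Rightarrow> complex \<Rightarrow> (nat \<Rightarrow> complex) \<Rightarrow> nat \<Rightarrow> complex" where
  "step_slope n \<alpha> v j = (if j < n then v (Suc j) else \<alpha> * v 1)"

text \<open>
  The quadratic term contributes \<open>c\<^sub>j z\<^sub>1\<^sup>2 / z\<^sub>j = c\<^sub>j w\<^sub>1 (z\<^sub>n / z\<^sub>j)\<close>, where \<open>z\<^sub>n / z\<^sub>j\<close> tends to zero
  for \<open>j < n\<close>.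
\<close>

lemma multiplier_slope:
  fixes F :: "('n::{finite,linorder}) cvec \<Rightarrow> 'n cvec" and z w :: "nat \<Rightarrow> 'n cvec"
  assumes F: "jordan_expansion F c" and j: "1 \<le> j" "j \<le> CARD('n)"
    and rel: "\<forall>\<^sub>F m in sequentially. chart_relation CARD('n) (w m) (z m)"
    and z: "z \<longlonglongrightarrow> 0" "\<And>m. z m \<noteq> 0" and w: "w \<longlonglongrightarrow> 0"
    and dir: "\<And>i. 1 \<le> i \<Longrightarrow> i \<le> CARD('n) \<Longrightarrow> (\<lambda>m. w m $ ix i / x m) \<longlonglongrightarrow> v i"
  shows "(\<lambda>m. (F (z m) $ ix j / z m $ ix j - 1) / x m) \<longlonglongrightarrow> step_slope CARD('n) (c CARD('n)) v j"
proof -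
  let ?n = "CARD('n)"
  define R where "R m = (F (z m) $ ix j - (z m $ ix j + (if j < ?n then z m $ ix (Suc j) else 0))) / (z m $ ix 1)\<^sup>2" for m
  have n: "1 \<le> ?n" using j by simp
  have nz: "\<forall>\<^sub>F m in sequentially. \<forall>k\<in>{1..?n}. z m $ ix k \<noteq> 0"
    using rel
  proof eventually_elim
    case (elim m)
    from chart_relation_nonzero(1)[OF elim n order_refl z(2)] show ?case by simp
  qed
  have nz1: "\<forall>\<^sub>F m in sequentially. z m $ ix 1 \<noteq> 0"
    using nz by eventually_elim (use n in auto)
  have R: "R \<longlonglongrightarrow> c j" unfolding R_def
    by (rule nonlinear_part_near_axis[OF F j z(1) nz1 chart_sequence_axis[OF rel n _ w z(2)]]) auto
  have wj: "(\<lambda>m. w m $ j) \<longlonglongrightarrow> 0" for j using tendsto_vec_nth[OF w] by simp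
  define T where "T m = z m $ ix ?n / z m $ ix j" for m
  define \<tau> where "\<tau> = (if j < ?n then 0 else 1 :: complex)"
  have T: "T \<longlonglongrightarrow> \<tau>"
  proof (cases "j < ?n")
    case True
    have "T \<longlonglongrightarrow> 0" unfolding T_def
    proof (rule chain_ratio_tendsto_0[where z = "\<lambda>m j. z m $ ix j" and w = "\<lambda>m j. w m $ ix j" and s = ?n])
      show "\<forall>\<^sub>F m in sequentially. z m $ ix j = w m $ ix j * z m $ ix (j - 1)" if "2 \<le> j" "j \<le> ?n" for j
        using rel by eventually_elim (use that in \<open>simp add: chart_relation_def\<close>)
      show "\<forall>\<^sub>F m in sequentially. z m $ ix j \<noteq> 0" using nz by eventually_elim (use j in auto)
    qed (use True j wj in auto)
    then show ?thesis using True by (simp add: \<tau>_def)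
  next
    case False
    then have "j = ?n" using j by simp
    have "T \<longlonglongrightarrow> 1" unfolding T_def \<open>j = ?n\<close> using nz n
      by (intro tendsto_eventually) (auto elim!: eventually_mono)
    then show ?thesis using False by (simp add: \<tau>_def)
  qed
  have "(\<lambda>m. (if j < ?n then w m $ ix (Suc j) / x m else 0) + w m $ ix 1 / x m * T m * R m)
      \<longlonglongrightarrow> (if j < ?n then v (Suc j) else 0) + v 1 * \<tau> * c j"
    by (intro tendsto_add tendsto_mult T R dir) (use n in \<open>auto intro!: dir\<close>)
  also have "(if j < ?n then v (Suc j) else 0) + v 1 * \<tau> * c j = step_slope ?n (c ?n) v j"
    using j by (auto simp: step_slope_def \<tau>_def)
  finally have lim: "(\<lambda>m. (if j < ?n then w m $ ix (Suc j) / x m else 0) + w m $ ix 1 / x m * T m * R m)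
      \<longlonglongrightarrow> step_slope ?n (c ?n) v j" .
  have "\<forall>\<^sub>F m in sequentially. (if j < ?n then w m $ ix (Suc j) / x m else 0) + w m $ ix 1 / x m * T m * R m
      = (F (z m) $ ix j / z m $ ix j - 1) / x m"
    using rel nz
  proof eventually_elim
    case (elim m)
    have zj: "z m $ ix j \<noteq> 0" "z m $ ix 1 \<noteq> 0" "z m $ ix ?n \<noteq> 0" using elim(2) j n by auto
    have e1: "(z m $ ix 1)\<^sup>2 = w m $ ix 1 * z m $ ix ?n" using elim(1) by (simp add: chart_relation_def)
    have e2: "j < ?n \<Longrightarrow> z m $ ix (Suc j) = w m $ ix (Suc j) * z m $ ix j"
      using elim(1)[unfolded chart_relation_def, THEN conjunct2, THEN conjunct1, rule_format, of "Suc j"] j by simp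
    have "w m $ ix 1 * T m * R m = (z m $ ix 1)\<^sup>2 * R m / z m $ ix j"
      unfolding e1 T_def by simp
    also have "(z m $ ix 1)\<^sup>2 * R m = F (z m) $ ix j - (z m $ ix j + (if j < ?n then z m $ ix (Suc j) else 0))"
      using zj by (simp add: R_def)
    also have "\<dots> / z m $ ix j = F (z m) $ ix j / z m $ ix j - 1 - (if j < ?n then w m $ ix (Suc j) else 0)"
      using zj e2 by (auto simp: diff_divide_distrib add_divide_distrib)
    finally have "(if j < ?n then w m $ ix (Suc j) else 0) + w m $ ix 1 * T m * R m = F (z m) $ ix j / z m $ ix j - 1"
      by simp
    then show ?case by (simp add: add_divide_distrib[symmetric] split: if_splits)
  qed
  with lim show ?thesis by (rule Lim_transform_eventually)
qed

text \<open>
  The linear form \<open>q\<^sub>j\<close> such that the lift multiplies \<open>w\<^sub>j\<close> by \<open>1 + q\<^sub>j(w)\<close> up to higher order. It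
  arises from \<open>step_slope\<close> by \<open>w\<^sub>1 = z\<^sub>1\<^sup>2 / z\<^sub>n\<close> and \<open>w\<^sub>j = z\<^sub>j / z\<^sub>j\<^sub>-\<^sub>1\<close>.
\<close>

definition coord_slope :: "nat \<Rightarrow> complex \<Rightarrow> (nat \<Rightarrow> complex) \<Rightarrow> nat \<Rightarrow> complex" where
  "coord_slope n \<alpha> v j = (if j = 1 then 2 * step_slope n \<alpha> v 1 - step_slope n \<alpha> v n
     else step_slope n \<alpha> v j - step_slope n \<alpha> v (j - 1))"

lemma coord_multiplier_slope:
  fixes F :: "('n::{finite,linorder}) cvec \<Rightarrow> 'n cvec" and z w :: "nat \<Rightarrow> 'n cvec"
  assumes F: "jordan_expansion F c" and j: "1 \<le> j" "j \<le> CARD('n)"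
    and rel: "\<forall>\<^sub>F m in sequentially. chart_relation CARD('n) (w m) (z m)"
    and rel': "\<forall>\<^sub>F m in sequentially. chart_relation CARD('n) (w' m) (F (z m))"
    and z: "z \<longlonglongrightarrow> 0" "\<And>m. z m \<noteq> 0" "\<And>m. F (z m) \<noteq> 0" and w: "w \<longlonglongrightarrow> 0"
    and x: "x \<longlonglongrightarrow> 0" "\<forall>\<^sub>F m in sequentially. x m \<noteq> 0"
    and dir: "\<And>i. 1 \<le> i \<Longrightarrow> i \<le> CARD('n) \<Longrightarrow> (\<lambda>m. w m $ ix i / x m) \<longlonglongrightarrow> v i"
  shows "(\<lambda>m. (w' m $ ix j / w m $ ix j - 1) / x m) \<longlonglongrightarrow> coord_slope CARD('n) (c CARD('n)) v j"
proof -
  let ?n = "CARD('n)"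
  let ?l = "step_slope ?n (c ?n) v"
  define g where "g m j = F (z m) $ ix j / z m $ ix j" for m j
  have n: "1 \<le> ?n" using j by simp
  have sl: "(\<lambda>m. (g m j - 1) / x m) \<longlonglongrightarrow> ?l j" if "1 \<le> j" "j \<le> ?n" for j
    unfolding g_def by (rule multiplier_slope[OF F that rel z(1,2) w dir])
  have g1: "(\<lambda>m. g m j) \<longlonglongrightarrow> 1" if "1 \<le> j" "j \<le> ?n" for j
  proof -
    have "(\<lambda>m. x m * ((g m j - 1) / x m) + 1) \<longlonglongrightarrow> 0 * ?l j + 1"
      by (intro tendsto_intros x sl that)
    moreover have "\<forall>\<^sub>F m in sequentially. x m * ((g m j - 1) / x m) + 1 = g m j"
      using x(2) by eventually_elim simp
    from Lim_transform_eventually[OF calculation this] show ?thesis by simp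
  qed
  have nz: "\<forall>\<^sub>F m in sequentially. \<forall>k\<in>{1..?n}. z m $ ix k \<noteq> 0 \<and> w m $ ix k \<noteq> 0"
    using rel
  proof eventually_elim
    case (elim m)
    from chart_relation_nonzero[OF elim n order_refl z(2)] show ?case by simp
  qed
  have nz': "\<forall>\<^sub>F m in sequentially. \<forall>k\<in>{1..?n}. F (z m) $ ix k \<noteq> 0"
    using rel'
  proof eventually_elim
    case (elim m)
    from chart_relation_nonzero(1)[OF elim n order_refl z(3)] show ?case by simp
  qed
  show ?thesis
  proof (cases "j = 1")
    case True
    have "(\<lambda>m. ((g m 1 - 1) / x m * (g m 1 + 1) - (g m ?n - 1) / x m) / g m ?n)
        \<longlonglongrightarrow> (?l 1 * (1 + 1) - ?l ?n) / 1"
      by (intro tendsto_intros sl g1) (use n in auto)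
    moreover have "\<forall>\<^sub>F m in sequentially. ((g m 1 - 1) / x m * (g m 1 + 1) - (g m ?n - 1) / x m) / g m ?n
        = (w' m $ ix 1 / w m $ ix 1 - 1) / x m"
      using rel rel' nz nz' x(2)
    proof eventually_elim
      case (elim m)
      have zj: "z m $ ix 1 \<noteq> 0" "z m $ ix ?n \<noteq> 0" "F (z m) $ ix 1 \<noteq> 0" "F (z m) $ ix ?n \<noteq> 0"
        using elim(3,4) n by auto
      have "w m $ ix 1 = (z m $ ix 1)\<^sup>2 / z m $ ix ?n" "w' m $ ix 1 = (F (z m) $ ix 1)\<^sup>2 / F (z m) $ ix ?n"
        using elim(1,2) zj by (simp_all add: chart_relation_def)
      then have "w' m $ ix 1 / w m $ ix 1 = (g m 1)\<^sup>2 / g m ?n"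
        using zj by (simp add: g_def power_divide)
      moreover have "g m ?n \<noteq> 0" using zj by (simp add: g_def)
      ultimately show ?case using elim(5) by (simp add: field_simps power2_eq_square)
    qed
    from Lim_transform_eventually[OF calculation this] show ?thesis using True by (simp add: coord_slope_def  mult.commute)
  next
    case False
    then have j': "1 \<le> j - 1" "j - 1 \<le> ?n" "2 \<le> j" using j by auto
    have "(\<lambda>m. ((g m j - 1) / x m - (g m (j - 1) - 1) / x m) / g m (j - 1))
        \<longlonglongrightarrow> (?l j - ?l (j - 1)) / 1"
      by (intro tendsto_intros sl g1 j j') auto
    moreover have "\<forall>\<^sub>F m in sequentially. ((g m j - 1) / x m - (g m (j - 1) - 1) / x m) / g m (j - 1)
        = (w' m $ ix j / w m $ ix j - 1) / x m"
      using rel rel' nz nz' x(2)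
    proof eventually_elim
      case (elim m)
      have zj: "z m $ ix j \<noteq> 0" "z m $ ix (j - 1) \<noteq> 0" "F (z m) $ ix j \<noteq> 0" "F (z m) $ ix (j - 1) \<noteq> 0"
        using elim(3,4) j j' by auto
      have "w m $ ix j = z m $ ix j / z m $ ix (j - 1)" "w' m $ ix j = F (z m) $ ix j / F (z m) $ ix (j - 1)"
        using elim(1,2) zj j j' by (simp_all add: chart_relation_def)
      then have "w' m $ ix j / w m $ ix j = g m j / g m (j - 1)"
        using zj by (simp add: g_def)
      moreover have "g m (j - 1) \<noteq> 0" using zj by (simp add: g_def)
      ultimately show ?case using elim(5) by (simp add: field_simps)
    qed
    from Lim_transform_eventually[OF calculation this] show ?thesis using False by (simp add: coord_slope_def )
  qed
qed

section \<open>Orbits tangent to a direction\<close>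

text \<open>
  Cesaro's theorem, for the sequence of increments.
\<close>

lemma tendsto_average_of_increments:
  fixes s :: "nat \<Rightarrow> complex"
  assumes "(\<lambda>m. s (Suc m) - s m) \<longlonglongrightarrow> d"
  shows "(\<lambda>m. s m / of_nat m) \<longlonglongrightarrow> d"
proof -
  define r where "r m = s m - of_nat m * d" for m
  have inc: "(\<lambda>m. r (Suc m) - r m) \<longlonglongrightarrow> 0"
    using LIM_zero[OF assms] by (simp add: r_def algebra_simps)
  have "(\<lambda>m. r m / of_nat m) \<longlonglongrightarrow> 0"
  proof (rule LIMSEQ_I)
    fix e :: real assume e: "e > 0"
    obtain M where M: "\<And>m. m \<ge> M \<Longrightarrow> norm (r (Suc m) - r m) < e / 2"
      using LIMSEQ_D[OF inc, of "e / 2"] e by auto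
    have lin: "norm (r (M + k)) \<le> norm (r M) + real k * (e / 2)" for k
    proof (induction k)
      case (Suc k)
      have "norm (r (M + Suc k)) \<le> norm (r (M + k)) + norm (r (Suc (M + k)) - r (M + k))"
        using norm_triangle_ineq[of "r (M + k)" "r (Suc (M + k)) - r (M + k)"] by simp
      moreover have "norm (r (M + Suc k) - r (M + k)) \<le> e / 2" using M[of "M + k"] by simp
      ultimately have "norm (r (M + Suc k)) \<le> norm (r M) + real k * (e / 2) + e / 2"
        using Suc by simp
      also have "\<dots> = norm (r M) + real (Suc k) * (e / 2)" by (simp add: algebra_simps add_divide_distrib)
      finally show ?case .
    qed simp
    obtain K where K: "real K > norm (r M) / (e / 2)" using reals_Archimedean2 by blast
    show "\<exists>N. \<forall>m\<ge>N. norm (r m / of_nat m - 0) < e"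
    proof (intro exI allI impI)
      fix m assume m: "m \<ge> max (Suc M) K"
      then have "real m \<ge> real K" by simp
      then have "norm (r M) / (e / 2) < real m" using K by linarith
      then have a: "norm (r M) < real m * (e / 2)" using e by (simp add: field_simps)
      have "norm (r m) \<le> norm (r M) + real (m - M) * (e / 2)" using lin[of "m - M"] m by simp
      also have "\<dots> \<le> norm (r M) + real m * (e / 2)" using e by (intro add_left_mono mult_right_mono) auto
      also have "\<dots> < real m * e" using a by simp
      finally show "norm (r m / of_nat m - 0) < e" using m by (simp add: norm_divide divide_less_eq mult.commute)
    qed
  qed
  then have lim: "(\<lambda>m. r m / of_nat m + d) \<longlonglongrightarrow> 0 + d" by (intro tendsto_intros)
  have "\<forall>\<^sub>F m in sequentially. r m / of_nat m + d = s m / of_nat m"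
    using eventually_gt_at_top[of 0] by eventually_elim (simp add: r_def diff_divide_distrib)
  from Lim_transform_eventually[OF lim this] show ?thesis by simp
qed

text \<open>
  The increments of \<open>1 / x\<close> converge to \<open>- q / v\<close>, hence so does \<open>1 / (m x\<^sub>m)\<close>. Multiplying by
  \<open>x\<^sub>m / y\<^sub>m\<close> expresses the limit by the scale \<open>y\<close> alone.
\<close>

lemma scale_rate_from_component:
  fixes x y :: "nat \<Rightarrow> complex"
  assumes nz: "\<forall>\<^sub>F m in sequentially. x m \<noteq> 0" "\<forall>\<^sub>F m in sequentially. y m \<noteq> 0"
    and y: "y \<longlonglongrightarrow> 0" and v: "(\<lambda>m. x m / y m) \<longlonglongrightarrow> v" "v \<noteq> 0"
    and q: "(\<lambda>m. (x (Suc m) / x m - 1) / y m) \<longlonglongrightarrow> q"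
  shows "(\<lambda>m. 1 / (of_nat m * y m)) \<longlonglongrightarrow> - q"
proof -
  have "(\<lambda>m. y m * ((x (Suc m) / x m - 1) / y m) + 1) \<longlonglongrightarrow> 0 * q + 1"
    by (intro tendsto_intros y q)
  moreover have "\<forall>\<^sub>F m in sequentially. y m * ((x (Suc m) / x m - 1) / y m) + 1 = x (Suc m) / x m"
    using nz(2) by eventually_elim simp
  ultimately have "(\<lambda>m. x (Suc m) / x m) \<longlonglongrightarrow> 0 * q + 1" by (rule Lim_transform_eventually)
  then have ratio: "(\<lambda>m. x (Suc m) / x m) \<longlonglongrightarrow> 1" by simp
  have nz': "\<forall>\<^sub>F m in sequentially. x (Suc m) \<noteq> 0"
    using nz(1) eventually_sequentially_Suc[of "\<lambda>m. x m \<noteq> 0"] by simp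
  have "(\<lambda>m. - ((x (Suc m) / x m - 1) / y m) / ((x m / y m) * (x (Suc m) / x m))) \<longlonglongrightarrow> - q / (v * 1)"
    by (intro tendsto_intros q v ratio) (use v in simp)
  moreover have "\<forall>\<^sub>F m in sequentially. - ((x (Suc m) / x m - 1) / y m) / ((x m / y m) * (x (Suc m) / x m))
      = 1 / x (Suc m) - 1 / x m"
    using nz nz' by eventually_elim (simp add: field_simps)
  ultimately have "(\<lambda>m. 1 / x (Suc m) - 1 / x m) \<longlonglongrightarrow> - q / (v * 1)" by (rule Lim_transform_eventually)
  then have "(\<lambda>m. 1 / x m / of_nat m) \<longlonglongrightarrow> - q / (v * 1)"
    by (rule tendsto_average_of_increments)
  then have "(\<lambda>m. 1 / x m / of_nat m * (x m / y m)) \<longlonglongrightarrow> - q / (v * 1) * v"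
    by (intro tendsto_mult v(1))
  moreover have "\<forall>\<^sub>F m in sequentially. 1 / x m / of_nat m * (x m / y m) = 1 / (of_nat m * y m)"
    using nz by eventually_elim simp
  ultimately have "(\<lambda>m. 1 / (of_nat m * y m)) \<longlonglongrightarrow> - q / (v * 1) * v" by (rule Lim_transform_eventually)
  then show ?thesis using v(2) by simp
qed

text \<open>
  If \<open>m \<cdot> y\<^sub>m \<rightarrow> -1/l\<close>, then \<open>x\<^sub>m\<^sub>+\<^sub>1 / x\<^sub>m = 1 - (q / l + o(1)) / m\<close>, and the moduli of \<open>x\<^sub>m\<close> grow when \<open>q / l\<close>
  has negative real part.
\<close>

lemma decaying_component_slope:
  fixes x y :: "nat \<Rightarrow> complex"
  assumes nz: "\<forall>\<^sub>F m in sequentially. x m \<noteq> 0" "\<forall>\<^sub>F m in sequentially. y m \<noteq> 0"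
    and x: "x \<longlonglongrightarrow> 0" and l: "(\<lambda>m. 1 / (of_nat m * y m)) \<longlonglongrightarrow> - l" "l \<noteq> 0"
    and q: "(\<lambda>m. (x (Suc m) / x m - 1) / y m) \<longlonglongrightarrow> q"
  shows "\<not> Re (q / (- l)) > 0"
proof
  assume pos: "Re (q / (- l)) > 0"
  have "(\<lambda>m. (x (Suc m) / x m - 1) / y m / (1 / (of_nat m * y m))) \<longlonglongrightarrow> q / (- l)"
    by (intro tendsto_divide q l) (use l in simp)
  moreover have "\<forall>\<^sub>F m in sequentially. (x (Suc m) / x m - 1) / y m / (1 / (of_nat m * y m))
      = of_nat m * (x (Suc m) / x m - 1)"
    using nz(2) by eventually_elim simp
  ultimately have "(\<lambda>m. of_nat m * (x (Suc m) / x m - 1)) \<longlonglongrightarrow> q / (- l)"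
    by (rule Lim_transform_eventually)
  then have "(\<lambda>m. Re (of_nat m * (x (Suc m) / x m - 1))) \<longlonglongrightarrow> Re (q / (- l))" by (rule tendsto_Re)
  from order_tendstoD(1)[OF this pos]
  have "\<forall>\<^sub>F m in sequentially. 0 < Re (of_nat m * (x (Suc m) / x m - 1))" .
  then have "\<forall>\<^sub>F m in sequentially. x m \<noteq> 0 \<and> norm (x m) \<le> norm (x (Suc m))"
    using nz(1)
  proof eventually_elim
    case (elim m)
    have "0 < real m * Re (x (Suc m) / x m - 1)" using elim(1) by simp
    then have "Re (x (Suc m) / x m) > 1" by (simp add: zero_less_mult_iff)
    then have "norm (x (Suc m) / x m) > 1" using complex_Re_le_cmod[of "x (Suc m) / x m"] by linarith
    then show ?case using elim(2) by (simp add: norm_divide field_simps)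
  qed
  then obtain M where M: "\<And>m. m \<ge> M \<Longrightarrow> x m \<noteq> 0 \<and> norm (x m) \<le> norm (x (Suc m))"
    by (auto simp: eventually_sequentially)
  have "norm (x M) \<le> norm (x m)" if "m \<ge> M" for m
    using that
  proof (induction m rule: dec_induct)
    case (step m)
    then show ?case using M[of m] by linarith
  qed simp
  then have "norm (x M) \<le> 0"
    by (intro LIMSEQ_le_const[OF tendsto_norm_zero[OF x]]) auto
  then show False using M[of M] by simp
qed

lemma cyclic_induct:
  assumes step: "\<And>j. 1 \<le> j \<Longrightarrow> j \<le> n \<Longrightarrow> P j \<Longrightarrow> P (if j < n then Suc j else 1)"
    and start: "1 \<le> i" "i \<le> n" "P i" and j: "1 \<le> j" "j \<le> n"
  shows "P (j :: nat)"
proof -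
  have up: "P l" if "k \<le> l" "1 \<le> k" "l \<le> n" "P k" for k l
    using that
  proof (induction l rule: dec_induct)
    case (step l)
    then show ?case using assms(1)[of l] by auto
  qed simp
  have "P n" using up[of i n] start by simp
  then have "P 1" using step[of n] start by auto
  then show ?thesis using up[of 1 j] j by simp
qed

lemma cyclic_induct_down:
  assumes step: "\<And>j. 1 \<le> j \<Longrightarrow> j \<le> n \<Longrightarrow> P (if j < n then Suc j else 1) \<Longrightarrow> P j"
    and start: "1 \<le> i" "i \<le> n" "P i" and j: "1 \<le> j" "j \<le> n"
  shows "P (j :: nat)"
proof (rule ccontr)
  assume "\<not> P j"
  have "\<not> P i"
  proof (rule cyclic_induct[of n "\<lambda>j. \<not> P j" j i])
    show "\<not> P (if k < n then Suc k else 1)" if "1 \<le> k" "k \<le> n" "\<not> P k" for k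
      using step[of k] that by blast
  qed (fact start(1,2) j \<open>\<not> P j\<close>)+
  then show False using start by simp
qed

text \<open>
  With \<open>u\<^sub>1 = \<alpha> v\<^sub>1\<close> and \<open>u\<^sub>j = v\<^sub>j\<close> for \<open>j \<ge> 2\<close> the slopes are cyclic: the \<open>j\<close>-th one is a positive multiple of
  the next \<open>u\<close> minus \<open>u\<^sub>j\<close>. On a direction with some but not all coordinates zero, the top of a run of
  nonzero coordinates determines the common slope \<open>l = - u\<^sub>t \<noteq> 0\<close>. Going down from there, all ratios
  \<open>- u\<^sub>j / l\<close> have nonnegative real part, and real part at least one on the runs. At a zero coordinate just
  below a run the slope is a positive multiple of the next \<open>u\<close>, so its quotient by \<open>- l\<close>
  has positive real part.
\<close>

lemma cyclic_slopes_sign: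
  fixes v :: "nat \<Rightarrow> complex"
  assumes n: "2 \<le> n" and \<alpha>: "\<alpha> \<noteq> 0"
    and eq: "\<And>j. 1 \<le> j \<Longrightarrow> j \<le> n \<Longrightarrow> v j \<noteq> 0 \<Longrightarrow> coord_slope n \<alpha> v j = l"
    and nz: "1 \<le> p" "p \<le> n" "v p \<noteq> 0" and z: "1 \<le> k" "k \<le> n" "v k = 0"
  shows "l \<noteq> 0" "\<exists>i. 1 \<le> i \<and> i \<le> n \<and> v i = 0 \<and> Re (coord_slope n \<alpha> v i / (- l)) > 0"
proof -
  define nx where "nx j = (if j < n then Suc j else 1)" for j
  define u where "u j = (if j = 1 then \<alpha> * v 1 else v j)" for j
  define \<mu> where "\<mu> j = (if j = 1 then 2 else 1 :: real)" for j :: nat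
  have \<mu>: "\<mu> j > 0" for j by (simp add: \<mu>_def)
  have u0: "u j = 0 \<longleftrightarrow> v j = 0" for j using \<alpha> by (simp add: u_def)
  have slope: "coord_slope n \<alpha> v j = of_real (\<mu> j) * u (nx j) - u j" if "1 \<le> j" "j \<le> n" for j
    using that n by (auto simp: coord_slope_def step_slope_def \<mu>_def u_def nx_def)
  have nx: "1 \<le> nx j" "nx j \<le> n" if "1 \<le> j" "j \<le> n" for j using that n by (auto simp: nx_def)
  have "\<exists>t. 1 \<le> t \<and> t \<le> n \<and> v t \<noteq> 0 \<and> v (nx t) = 0"
  proof (rule ccontr)
    assume "\<nexists>t. 1 \<le> t \<and> t \<le> n \<and> v t \<noteq> 0 \<and> v (nx t) = 0"
    then have "v k \<noteq> 0"
      using nz z by (intro cyclic_induct[of n "\<lambda>j. v j \<noteq> 0" p k]) (auto simp: nx_def)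
    then show False using z by simp
  qed
  then obtain t where t: "1 \<le> t" "t \<le> n" "v t \<noteq> 0" "v (nx t) = 0" by blast
  have l: "l = - u t" using eq[OF t(1-3)] slope[OF t(1,2)] u0[of "nx t"] t(4) by simp
  then show l0: "l \<noteq> 0" using u0[of t] t by simp
  define x where "x j = u j / (- l)" for j
  have run: "x j = 1 + of_real (\<mu> j) * x (nx j)" if "1 \<le> j" "j \<le> n" "v j \<noteq> 0" for j
  proof -
    have "of_real (\<mu> j) * u (nx j) - u j = l" using eq[OF that] slope[OF that(1,2)] by simp
    then have "u j = - l + of_real (\<mu> j) * u (nx j)" by (simp add: algebra_simps)
    then have "u j / (- l) = (- l + of_real (\<mu> j) * u (nx j)) / (- l)" by simp
    also have "\<dots> = 1 + of_real (\<mu> j) * (u (nx j) / (- l))" using l0 by (simp add: field_simps)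
    finally show ?thesis by (simp add: x_def)
  qed
  have nonneg: "Re (x j) \<ge> 0" if "1 \<le> j" "j \<le> n" for j
  proof (rule cyclic_induct_down[of n "\<lambda>j. Re (x j) \<ge> 0" t j])
    show "Re (x t) \<ge> 0" using l l0 by (simp add: x_def)
    fix j assume j: "1 \<le> j" "j \<le> n" and next': "Re (x (if j < n then Suc j else 1)) \<ge> 0"
    then have nxt: "Re (x (nx j)) \<ge> 0" by (simp add: nx_def)
    show "Re (x j) \<ge> 0"
    proof (cases "v j = 0")
      case True
      then show ?thesis using u0[of j] by (simp add: x_def)
    next
      case False
      then show ?thesis using run[OF j] nxt \<mu>[of j] by simp
    qed
  qed (use t that in auto)
  have "\<exists>i. 1 \<le> i \<and> i \<le> n \<and> v i = 0 \<and> v (nx i) \<noteq> 0"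
  proof (rule ccontr)
    assume "\<nexists>i. 1 \<le> i \<and> i \<le> n \<and> v i = 0 \<and> v (nx i) \<noteq> 0"
    then have "v p = 0"
      using nz z by (intro cyclic_induct[of n "\<lambda>j. v j = 0" k p]) (auto simp: nx_def)
    then show False using nz by simp
  qed
  then obtain i where i: "1 \<le> i" "i \<le> n" "v i = 0" "v (nx i) \<noteq> 0" by blast
  have "Re (x (nx i)) \<ge> 1"
    using run[OF nx[OF i(1,2)] i(4)] nonneg[OF nx[OF nx[OF i(1,2)]]] \<mu>[of "nx i"] by simp
  moreover have "coord_slope n \<alpha> v i / (- l) = of_real (\<mu> i) * x (nx i)"
    using slope[OF i(1,2)] u0[of i] i(3) by (simp add: x_def)
  ultimately have "Re (coord_slope n \<alpha> v i / (- l)) > 0" using \<mu>[of i] by simp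
  then show "\<exists>i. 1 \<le> i \<and> i \<le> n \<and> v i = 0 \<and> Re (coord_slope n \<alpha> v i / (- l)) > 0"
    using i by blast
qed

text \<open>
  The rate of the scale \<open>x\<^sub>m = w\<^sub>p\<close> can be read off from every coordinate with \<open>v\<^sub>j \<noteq> 0\<close>, so
  these have one common slope; a vanishing coordinate with the opposite slope could not decay.
\<close>

lemma tangent_direction_allowable:
  fixes w :: "nat \<Rightarrow> nat \<Rightarrow> complex"
  assumes n: "2 \<le> n" and \<alpha>: "\<alpha> \<noteq> 0"
    and nz: "\<And>j. 1 \<le> j \<Longrightarrow> j \<le> n \<Longrightarrow> \<forall>\<^sub>F m in sequentially. w m j \<noteq> 0"
    and w: "\<And>j. 1 \<le> j \<Longrightarrow> j \<le> n \<Longrightarrow> (\<lambda>m. w m j) \<longlonglongrightarrow> 0"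
    and p: "1 \<le> p" "p \<le> n"
    and v: "\<And>j. 1 \<le> j \<Longrightarrow> j \<le> n \<Longrightarrow> (\<lambda>m. w m j / w m p) \<longlonglongrightarrow> v j"
    and q: "\<And>j. 1 \<le> j \<Longrightarrow> j \<le> n \<Longrightarrow>
      (\<lambda>m. (w (Suc m) j / w m j - 1) / w m p) \<longlonglongrightarrow> coord_slope n \<alpha> v j"
  shows "\<And>j. 1 \<le> j \<Longrightarrow> j \<le> n \<Longrightarrow> v j \<noteq> 0"
    "\<And>j. 1 \<le> j \<Longrightarrow> j \<le> n \<Longrightarrow> coord_slope n \<alpha> v j = coord_slope n \<alpha> v p"
proof -
  let ?q = "coord_slope n \<alpha> v"
  have "(\<lambda>m. w m p / w m p) \<longlonglongrightarrow> 1"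
    using nz[OF p] by (intro tendsto_eventually) (auto elim: eventually_mono)
  with v[OF p] have vp: "v p = 1" by (rule LIMSEQ_unique)
  have rate: "(\<lambda>m. 1 / (of_nat m * w m p)) \<longlonglongrightarrow> - ?q j" if "1 \<le> j" "j \<le> n" "v j \<noteq> 0" for j
    by (rule scale_rate_from_component[OF nz[OF that(1,2)] nz[OF p] w[OF p] v[OF that(1,2)] that(3) q[OF that(1,2)]])
  have eq: "?q j = ?q p" if "1 \<le> j" "j \<le> n" "v j \<noteq> 0" for j
    using LIMSEQ_unique[OF rate[OF that] rate[OF p]] vp by simp
  show allow: "v j \<noteq> 0" if j: "1 \<le> j" "j \<le> n" for j
  proof
    assume "v j = 0"
    have vp0: "v p \<noteq> 0" using vp by simp
    note sign = cyclic_slopes_sign[OF n \<alpha> eq p vp0 j \<open>v j = 0\<close>]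
    obtain i where i: "1 \<le> i" "i \<le> n" "Re (?q i / (- ?q p)) > 0"
      using sign(2) by blast
    then show False
      using decaying_component_slope[OF nz[OF i(1,2)] nz[OF p] w[OF i(1,2)] rate[OF p vp0] sign(1) q[OF i(1,2)]]
      by simp
  qed
  show "?q j = ?q p" if "1 \<le> j" "j \<le> n" for j
    using eq[OF that allow[OF that]] .
qed

section \<open>The lift to the last chart\<close>

text \<open>\<open>\<pi>\<^sub>n\<close> in the chart \<open>\<chi>\<^sub>n\<close>, a monomial map: \<open>w\<^sub>l\<close> occurs in the \<open>i\<close>-th component with exponent
  \<open>tower_exponent i l\<close>.\<close>

definition tower_exponent :: "'n::{finite,linorder} \<Rightarrow> 'n \<Rightarrow> nat" where
  "tower_exponent i l = (if 2 \<le> pos l \<and> pos l \<le> pos i then 2 else 1)"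

definition tower_monomials :: "('n::{finite,linorder}) cvec \<Rightarrow> 'n cvec" where
  "tower_monomials w = (\<chi> i. mpow w (tower_exponent i))"

lemma tower_monomials_first:
  "tower_monomials w $ ix 1 = (\<Prod>l\<in>UNIV. w $ l)" for w :: "('n::{finite,linorder}) cvec"
proof -
  have "pos (ix 1 :: 'n) = 1" by (rule pos_ix) (simp_all add: Suc_le_eq card_gt_0_iff)
  then have "tower_exponent (ix 1 :: 'n) = (\<lambda>_. 1)" by (auto simp: tower_exponent_def fun_eq_iff)
  then show ?thesis by (simp add: tower_monomials_def mpow_def)
qed

lemma tower_monomials_step:
  fixes w :: "('n::{finite,linorder}) cvec"
  assumes j: "2 \<le> j" "j \<le> CARD('n)"
  shows "tower_monomials w $ ix j = w $ ix j * tower_monomials w $ ix (j - 1)"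
proof -
  have "tower_exponent (ix j :: 'n) = (\<lambda>l. (if l = ix j then 1 else 0) + tower_exponent (ix (j - 1)) l)"
  proof
    fix l :: 'n
    obtain k where k: "1 \<le> k" "k \<le> CARD('n)" "l = ix k" by (rule ix_cases)
    show "tower_exponent (ix j) l = (if l = ix j then 1 else 0) + tower_exponent (ix (j - 1)) l"
      using k j by (auto simp: tower_exponent_def pos_ix ix_eq_iff)
  qed
  then show ?thesis by (simp add: tower_monomials_def mpow_add mpow_single)
qed

lemma bij_betw_ix: "bij_betw (ix :: nat \<Rightarrow> 'n::{finite,linorder}) {1..CARD('n)} UNIV"
proof (rule bij_betwI[where g = pos])
  show "pos \<in> (UNIV :: 'n set) \<rightarrow> {1..CARD('n)}"
    using bij_betw_pos[where 'n = 'n] by (auto simp: bij_betw_def)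
qed (auto simp: pos_ix)

lemma chart_relation_tower_monomials:
  "chart_relation CARD('n) w (tower_monomials w)" for w :: "('n::{finite,linorder}) cvec"
proof -
  let ?n = "CARD('n)"
  have n: "1 \<le> ?n" by (simp add: Suc_le_eq card_gt_0_iff)
  have "tower_monomials w $ ix 1 ^ 2 = w $ ix 1 * tower_monomials w $ ix ?n"
  proof -
    have "mpow w (\<lambda>l. tower_exponent (ix 1) l + tower_exponent (ix 1) l) =
        mpow w (\<lambda>l. (if l = ix 1 then 1 else 0) + tower_exponent (ix ?n :: 'n) l)"
    proof (rule arg_cong[where f = "mpow w"], rule ext)
      fix l :: 'n
      obtain k where k: "1 \<le> k" "k \<le> ?n" "l = ix k" by (rule ix_cases)
      show "tower_exponent (ix 1) l + tower_exponent (ix 1) l = (if l = ix 1 then 1 else 0) + tower_exponent (ix ?n) l"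
        using k n by (auto simp: tower_exponent_def pos_ix ix_eq_iff)
    qed
    then show ?thesis by (simp add: tower_monomials_def mpow_add mpow_single power2_eq_square)
  qed
  moreover have "tower_monomials w $ ix j = w $ ix j * tower_monomials w $ ix (j - 1)" if "2 \<le> j" "j \<le> ?n" for j
    by (rule tower_monomials_step[OF that])
  ultimately show ?thesis unfolding chart_relation_def by (meson not_le)
qed

text \<open>
  For every \<open>w\<close> the relation is also satisfied by \<open>z = 0\<close>; the value of \<open>z\<^sub>1\<close> selects the solution, and
  the other coordinates follow recursively.
\<close>

lemma chart_relation_unique:
  fixes z :: "('n::{finite,linorder}) cvec"
  assumes rel: "chart_relation CARD('n) w z" and first: "z $ ix 1 = (\<Prod>l\<in>UNIV. w $ l)"
  shows "z = tower_monomials w"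
proof -
  have eq: "j \<le> CARD('n) \<Longrightarrow> z $ ix j = tower_monomials w $ ix j" if "1 \<le> j" for j
    using that
  proof (induction j rule: dec_induct)
    case base
    then show ?case using first tower_monomials_first[of w] by simp
  next
    case (step j)
    have "z $ ix (Suc j) = w $ ix (Suc j) * z $ ix (Suc j - 1)"
      using rel[unfolded chart_relation_def, THEN conjunct2, THEN conjunct1, rule_format, of "Suc j"] step by simp
    moreover have "tower_monomials w $ ix (Suc j) = w $ ix (Suc j) * tower_monomials w $ ix (Suc j - 1)"
      by (rule tower_monomials_step) (use step in auto)
    ultimately show ?case using step by simp
  qed
  show ?thesis unfolding vec_eq_iff
  proof
    fix i :: 'n
    obtain k where "1 \<le> k" "k \<le> CARD('n)" "i = ix k" by (rule ix_cases)
    then show "z $ i = tower_monomials w $ i" using eq by simp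
  qed
qed

lemma mpow_tower_monomials:
  "mpow (tower_monomials w) \<alpha> = mpow w (\<lambda>l. \<Sum>i\<in>UNIV. \<alpha> i * tower_exponent i l)"
proof -
  have "mpow (tower_monomials w) \<alpha> = (\<Prod>i\<in>UNIV. \<Prod>l\<in>UNIV. (w $ l) ^ (\<alpha> i * tower_exponent i l))"
    by (simp add: mpow_def tower_monomials_def prod_power_distrib flip: power_mult) (simp add: mult.commute)
  also have "\<dots> = (\<Prod>l\<in>UNIV. \<Prod>i\<in>UNIV. (w $ l) ^ (\<alpha> i * tower_exponent i l))" by (rule prod.swap)
  finally show ?thesis by (simp add: mpow_def power_sum)
qed

lemma norm_tower_monomials_le:
  fixes w :: "('n::{finite,linorder}) cvec"
  assumes "\<And>l. norm (w $ l) \<le> t" "0 \<le> t" "t \<le> 1"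
  shows "norm (tower_monomials w) \<le> real CARD('n) * t"
proof -
  have "norm (tower_monomials w $ i) \<le> t" for i :: 'n
  proof -
    have "norm (tower_monomials w $ i) \<le> t ^ (\<Sum>l\<in>UNIV. tower_exponent i l)"
      using norm_mpow_le[of w t "tower_exponent i"] assms by (simp add: tower_monomials_def)
    also have "\<dots> \<le> t ^ 1"
    proof (rule power_decreasing)
      have "1 \<le> tower_exponent i i" by (simp add: tower_exponent_def)
      also have "\<dots> \<le> (\<Sum>l\<in>UNIV. tower_exponent i l)" by (rule member_le_sum) auto
      finally show "1 \<le> (\<Sum>l\<in>UNIV. tower_exponent i l)" .
    qed (use assms in auto)
    finally show ?thesis by simp
  qed
  then have "(\<Sum>i\<in>UNIV. norm (tower_monomials w $ i)) \<le> (\<Sum>i\<in>(UNIV :: 'n set). t)" by (intro sum_mono)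
  then show ?thesis using norm_vec_le_sum[of "tower_monomials w"] by simp
qed

text \<open>
  On the \<open>k\<close>-th axis only the monomial \<open>z\<^sub>k\<close> of degree one is nonzero.
\<close>

lemma homog_1_axis: "homog c 1 (axis k 1) = c (\<lambda>l. if l = k then 1 else 0)"
proof -
  define E :: "'a \<Rightarrow> 'a \<Rightarrow> nat" where "E k = (\<lambda>l. if l = k then 1 else 0)" for k
  have deg: "{\<alpha> :: 'a \<Rightarrow> nat. (\<Sum>i\<in>UNIV. \<alpha> i) = 1} = range E"
  proof (rule set_eqI, rule iffI)
    fix \<alpha> :: "'a \<Rightarrow> nat" assume "\<alpha> \<in> {\<alpha>. (\<Sum>i\<in>UNIV. \<alpha> i) = 1}"
    then have "(\<Sum>i\<in>UNIV. \<alpha> i) = 1" by simp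
    then obtain k where "\<alpha> = (\<lambda>l. if l = k then 1 else 0)" by (rule degree_one_exponent)
    then show "\<alpha> \<in> range E" unfolding E_def by blast
  qed (auto simp: E_def)
  have inj: "inj E"
    by (rule injI) (metis E_def zero_neq_one)
  have "homog c 1 (axis k 1) = (\<Sum>\<alpha>\<in>range E. mpow (axis k 1) \<alpha> * c \<alpha>)" by (simp only: homog_def deg)
  also have "\<dots> = (\<Sum>i\<in>UNIV. mpow (axis k 1) (E i) * c (E i))" using inj by (simp add: sum.reindex)
  also have "\<dots> = (\<Sum>i\<in>UNIV. if i = k then c (E k) else 0)"
    by (rule sum.cong) (auto simp: E_def mpow_single axis_def)
  finally show ?thesis by (simp add: E_def)
qed

text \<open>
  Each monomial of \<open>F\<^sub>j\<close> with a nonzero coefficient becomes divisible by the \<open>j\<close>-th component of the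
  monomial map: the quadratic ones because every variable has exponent at least one in each
  component and at most two in the \<open>j\<close>-th, the linear ones because \<open>J\<^sub>n\<close> is upper triangular.
\<close>

lemma lift_multiplier:
  fixes F :: "('n::{finite,linorder}) cvec \<Rightarrow> 'n cvec"
  assumes F: "has_power_series F 0 a" "F 0 = 0" "(F has_derivative (\<lambda>v. jordan_block *v v)) (at 0)"
  obtains U r where "germ_analytic U" "r > 0"
    "\<And>w. w \<in> ball 0 r \<Longrightarrow> F (tower_monomials w) $ j = tower_monomials w $ j * U w"
proof -
  define c where "c = (\<lambda>\<alpha>. a \<alpha> $ j)"
  have ser: "germ_series (\<lambda>w. F w $ j) c" unfolding c_def by (rule has_power_series_nth[OF F(1)])
  then obtain R where R: "R > 0"
    and f: "\<And>w. w \<in> ball 0 R \<Longrightarrow> ((\<lambda>\<alpha>. mpow w \<alpha> * c \<alpha>) has_sum F w $ j) UNIV"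
    unfolding germ_series_def by blast
  define D :: "('n \<Rightarrow> nat) \<Rightarrow> 'n \<Rightarrow> nat" where "D \<alpha> l = (\<Sum>i\<in>UNIV. \<alpha> i * tower_exponent i l)" for \<alpha> l
  have div: "tower_exponent j l \<le> D \<alpha> l" if "c \<alpha> \<noteq> 0" for \<alpha> l
  proof -
    consider "(\<Sum>i\<in>UNIV. \<alpha> i) = 0" | "(\<Sum>i\<in>UNIV. \<alpha> i) = 1" | "(\<Sum>i\<in>UNIV. \<alpha> i) \<ge> 2" by linarith
    then show ?thesis
    proof cases
      case 1
      have "c (\<lambda>_. 0) = 0" using germ_series_constant[OF ser] F(2) by simp
      moreover have "\<alpha> = (\<lambda>_. 0)" using 1 degree_zero_iff by blast
      ultimately show ?thesis using that by simp
    next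
      case 2
      then obtain k where \<alpha>: "\<alpha> = (\<lambda>l. if l = k then 1 else 0)" by (rule degree_one_exponent)
      have "c \<alpha> = (jordan_block *v axis k 1) $ j"
        using homog_1_derivative[OF F, of j "axis k 1"] unfolding homog_1_axis c_def[symmetric] \<alpha> by simp
      also have "\<dots> = (jordan_block :: ((complex, 'n) vec, 'n) vec) $ j $ k"
        by (simp add: matrix_vector_mult_def axis_def if_distrib cong: if_cong)
      finally have "k = j \<or> pos k = Suc (pos j)" using that by (simp add: jordan_block_def split: if_splits)
      then have "tower_exponent j l \<le> tower_exponent k l" by (auto simp: tower_exponent_def)
      also have "\<dots> = \<alpha> k * tower_exponent k l" by (simp add: \<alpha>)
      also have "\<dots> \<le> D \<alpha> l" unfolding D_def by (rule member_le_sum) auto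
      finally show ?thesis .
    next
      case 3
      have "tower_exponent j l \<le> 2" by (simp add: tower_exponent_def)
      also have "\<dots> \<le> (\<Sum>i\<in>UNIV. \<alpha> i)" using 3 .
      also have "\<dots> \<le> D \<alpha> l" unfolding D_def
        by (rule sum_mono) (simp add: tower_exponent_def)
      finally show ?thesis .
    qed
  qed
  define E :: "('n \<Rightarrow> nat) \<Rightarrow> 'n \<Rightarrow> nat" where "E \<alpha> l = D \<alpha> l - tower_exponent j l" for \<alpha> l
  have fac: "mpow (tower_monomials w) \<alpha> * c \<alpha> = tower_monomials w $ j * (mpow w (E \<alpha>) * c \<alpha>)" for w \<alpha>
  proof (cases "c \<alpha> = 0")
    case False
    have "D \<alpha> = (\<lambda>l. tower_exponent j l + E \<alpha> l)" using div[OF False] by (simp add: E_def fun_eq_iff)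
    then have "mpow (tower_monomials w) \<alpha> = mpow w (tower_exponent j) * mpow w (E \<alpha>)"
      unfolding mpow_tower_monomials D_def[symmetric] by (simp add: mpow_add)
    then show ?thesis by (simp add: tower_monomials_def)
  qed simp
  have npos: "real CARD('n) > 0" by (simp add: card_gt_0_iff)
  \<comment> \<open>The monomial map sends the polydisc of radius \<open>t \<le> 1\<close> into the ball of radius \<open>n t < R\<close>.\<close>
  define t where "t = min 1 (R / (2 * real CARD('n)))"
  have t: "t > 0" "t \<le> 1" "real CARD('n) * t < R"
  proof -
    show "t > 0" "t \<le> 1" using R npos by (auto simp: t_def)
    have "real CARD('n) * t \<le> real CARD('n) * (R / (2 * real CARD('n)))"
      using npos by (intro mult_left_mono) (auto simp: t_def)
    also have "\<dots> = R / 2" using npos by simp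
    finally show "real CARD('n) * t < R" using R by simp
  qed
  have inball: "tower_monomials w \<in> ball 0 R" if "\<And>l. norm (w $ l) \<le> t" for w :: "'n cvec"
    using norm_tower_monomials_le[OF that] t by simp
  define v :: "'n cvec" where "v = const_vec (of_real t)"
  have vl: "norm (v $ l) = t" for l using t by (simp add: v_def)
  have "tower_monomials v $ j \<noteq> 0" using t by (simp add: tower_monomials_def mpow_eq_0_iff v_def)
  have "(\<lambda>\<alpha>. mpow (tower_monomials v) \<alpha> * c \<alpha>) summable_on UNIV"
    by (rule has_sum_imp_summable[OF f[OF inball]]) (simp add: vl)
  then have "(\<lambda>\<alpha>. mpow v (E \<alpha>) * c \<alpha>) summable_on UNIV"
    unfolding fac using summable_on_cmult_right'[OF \<open>tower_monomials v $ j \<noteq> 0\<close>] by blast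
  then have abs: "(\<lambda>\<alpha>. norm (mpow v (E \<alpha>) * c \<alpha>)) summable_on UNIV"
    using summable_on_iff_abs_summable_on_complex[of "\<lambda>\<alpha>. mpow v (E \<alpha>) * c \<alpha>" UNIV] by simp
  define U where "U w = infsum (\<lambda>\<alpha>. mpow w (E \<alpha>) * c \<alpha>) UNIV" for w
  have U: "((\<lambda>\<alpha>. mpow w (E \<alpha>) * c \<alpha>) has_sum U w) UNIV" if w: "w \<in> ball 0 t" for w
  proof -
    have "norm (w $ l) \<le> norm (v $ l)" for l
      using w Finite_Cartesian_Product.norm_nth_le[of w l] by (simp add: vl)
    then have "norm (mpow w (E \<alpha>) * c \<alpha>) \<le> norm (mpow v (E \<alpha>) * c \<alpha>)" for \<alpha>
      unfolding norm_mult by (intro mult_right_mono norm_mpow_mono) auto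
    then have "(\<lambda>\<alpha>. norm (mpow w (E \<alpha>) * c \<alpha>)) summable_on UNIV"
      by (intro summable_on_comparison_test[OF abs]) auto
    then have "(\<lambda>\<alpha>. mpow w (E \<alpha>) * c \<alpha>) summable_on UNIV" by (rule abs_summable_summable)
    then show ?thesis unfolding U_def by (rule has_sum_infsum)
  qed
  show ?thesis
  proof (rule that[of U t])
    show "germ_analytic U"
      by (rule germ_analytic_monomial_sum[OF t(1) U])
    fix w :: "'n cvec" assume w: "w \<in> ball 0 t"
    have wl: "norm (w $ l) \<le> t" for l
      using w Finite_Cartesian_Product.norm_nth_le[of w l] by simp
    have "((\<lambda>\<alpha>. mpow (tower_monomials w) \<alpha> * c \<alpha>) has_sum tower_monomials w $ j * U w) UNIV"
      unfolding fac by (rule has_sum_cmult_right[OF U[OF w]])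
    with f[OF inball[OF wl]] show "F (tower_monomials w) $ j = tower_monomials w $ j * U w"
      by (rule has_sum_unique)
  qed (use t in auto)
qed

lemma tower_monomials_tendsto_0:
  fixes w :: "nat \<Rightarrow> ('n::{finite,linorder}) cvec"
  assumes "w \<longlonglongrightarrow> 0"
  shows "(\<lambda>m. tower_monomials (w m)) \<longlonglongrightarrow> 0"
proof -
  have nw: "(\<lambda>m. norm (w m)) \<longlonglongrightarrow> 0" using assms by (rule tendsto_norm_zero)
  then have "\<forall>\<^sub>F m in sequentially. norm (w m) < 1" by (rule order_tendstoD) simp
  then have "\<forall>\<^sub>F m in sequentially. norm (tower_monomials (w m)) \<le> real CARD('n) * norm (w m)"
    by eventually_elim (intro norm_tower_monomials_le Finite_Cartesian_Product.norm_nth_le; simp)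
  moreover have "(\<lambda>m. real CARD('n) * norm (w m)) \<longlonglongrightarrow> 0" using nw by (rule tendsto_mult_right_zero)
  ultimately show ?thesis by (rule Lim_null_comparison)
qed

lemma prod_over_ix: "(\<Prod>l\<in>(UNIV :: 'n::{finite,linorder} set). f l) = (\<Prod>k\<in>{1..CARD('n)}. f (ix k))"
  using prod.reindex_bij_betw[OF bij_betw_ix, of f] by simp

text \<open>
  The factors by which the lift multiplies the coordinates \<open>w\<^sub>k\<close>; their product is the multiplier of
  \<open>z\<^sub>1 = w\<^sub>1 \<dots> w\<^sub>n\<close>.
\<close>

lemma telescoping_prod:
  fixes u :: "nat \<Rightarrow> complex"
  assumes "1 \<le> n" "\<And>k. 1 \<le> k \<Longrightarrow> k \<le> n \<Longrightarrow> u k \<noteq> 0"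
  shows "(\<Prod>k\<in>{1..n}. if k = 1 then (u 1)\<^sup>2 / u n else u k / u (k - 1)) = u 1"
proof -
  have "(\<Prod>k\<in>{2..m}. u k / u (k - 1)) = u m / u 1" if "1 \<le> m" "m \<le> n" for m
    using that
  proof (induction m rule: dec_induct)
    case base
    then show ?case using assms by simp
  next
    case (step m)
    have "(\<Prod>k\<in>{2..Suc m}. u k / u (k - 1)) = (\<Prod>k\<in>{2..m}. u k / u (k - 1)) * (u (Suc m) / u m)"
      using step by (simp add: prod.atLeastAtMost_shift_bounds atLeastAtMostSuc_conv)
    then show ?case using step assms(2)[of m] by simp
  qed
  from this[of n] have tel: "(\<Prod>k\<in>{2..n}. u k / u (k - 1)) = u n / u 1" using assms by simp
  have "{1..n} = insert 1 {2..n}" using assms by auto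
  then have "(\<Prod>k\<in>{1..n}. if k = 1 then (u 1)\<^sup>2 / u n else u k / u (k - 1))
      = (u 1)\<^sup>2 / u n * (\<Prod>k\<in>{2..n}. if k = 1 then (u 1)\<^sup>2 / u n else u k / u (k - 1))" by simp
  also have "(\<Prod>k\<in>{2..n}. if k = 1 then (u 1)\<^sup>2 / u n else u k / u (k - 1)) = u n / u 1"
    unfolding tel[symmetric] by (rule prod.cong) auto
  finally show ?thesis using assms(2)[of n] assms(2)[of 1] assms(1) by (simp add: power2_eq_square)
qed

text \<open>
  Along the diagonal \<open>U\<^sub>j(w) = F\<^sub>j(z) / z\<^sub>j\<close> is \<open>1 + O(\<parallel>w\<parallel>)\<close>.
\<close>

lemma lift_multiplier_at_0:
  fixes F :: "('n::{finite,linorder}) cvec \<Rightarrow> 'n cvec"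
  assumes F: "jordan_expansion F c" and j: "1 \<le> j" "j \<le> CARD('n)"
    and U: "germ_series U d" and r: "r > 0"
      "\<And>w. w \<in> ball 0 r \<Longrightarrow> F (tower_monomials w) $ ix j = tower_monomials w $ ix j * U w"
  shows "d (\<lambda>_. 0) = 1"
proof -
  obtain t0 :: real where t0: "t0 > 0" "const_vec (of_real t0) \<in> ball (0 :: 'n cvec) r"
    using exists_const_vec_in_ball[OF r(1)] .
  define t where "t m = (of_real (t0 / real (Suc m)) :: complex)" for m :: nat
  define w where "w m = (const_vec (t m) :: 'n cvec)" for m
  have t: "t \<longlonglongrightarrow> 0" unfolding t_def by (rule null_sequence_complex)
  have tn: "t m \<noteq> 0" for m unfolding t_def using t0 by (simp del: of_nat_Suc)
  have w: "w \<longlonglongrightarrow> 0"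
    by (rule vec_tendstoI) (use t in \<open>simp add: w_def\<close>)
  have nz: "tower_monomials (w m) $ i \<noteq> 0" for m i
    using tn by (simp add: tower_monomials_def mpow_eq_0_iff w_def)
  then have nz': "tower_monomials (w m) \<noteq> 0" for m by (metis zero_index)
  have slope: "(\<lambda>m. (F (tower_monomials (w m)) $ ix j / tower_monomials (w m) $ ix j - 1) / t m)
      \<longlonglongrightarrow> step_slope CARD('n) (c CARD('n)) (\<lambda>_. 1) j"
    by (rule multiplier_slope[OF F j _ tower_monomials_tendsto_0[OF w] nz' w])
      (use tn in \<open>simp_all add: chart_relation_tower_monomials w_def\<close>)
  have "\<forall>\<^sub>F m in sequentially. norm (w m) < r"
    using order_tendstoD(2)[OF tendsto_norm_zero[OF w] r(1)] .
  then have ev: "\<forall>\<^sub>F m in sequentially.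
      t m * ((F (tower_monomials (w m)) $ ix j / tower_monomials (w m) $ ix j - 1) / t m) + 1 = U (w m)"
    by eventually_elim (use r(2) nz tn in simp)
  have "(\<lambda>m. t m * ((F (tower_monomials (w m)) $ ix j / tower_monomials (w m) $ ix j - 1) / t m) + 1)
      \<longlonglongrightarrow> 0 * step_slope CARD('n) (c CARD('n)) (\<lambda>_. 1) j + 1"
    by (intro tendsto_intros t slope)
  from Lim_transform_eventually[OF this ev] have "(\<lambda>m. U (w m)) \<longlonglongrightarrow> 1" by simp
  with germ_series_tendsto[OF U w] show ?thesis by (rule LIMSEQ_unique)
qed

lemma germ_series_nonzero_near_0:
  fixes U :: "('n::finite) cvec \<Rightarrow> complex"
  assumes "germ_series U d" "d (\<lambda>_. 0) = 1"
  obtains r where "r > 0" "\<And>w. w \<in> ball 0 r \<Longrightarrow> U w \<noteq> 0"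
proof -
  obtain \<rho> C where \<rho>: "\<rho> > 0" and C: "C \<ge> 0"
    "\<And>w. norm w \<le> \<rho> \<Longrightarrow> norm (U w - (\<Sum>k<1. homog d k w)) \<le> C * norm w ^ 1"
    using germ_series_expansion[OF assms(1), of 1] by blast
  show ?thesis
  proof (rule that[of "min \<rho> (1 / (C + 1))"])
    show "min \<rho> (1 / (C + 1)) > 0" using \<rho> C(1) by simp
    fix w :: "'n cvec" assume "w \<in> ball 0 (min \<rho> (1 / (C + 1)))"
    then have w: "norm w \<le> \<rho>" "norm w * (C + 1) < 1" using C(1) by (simp_all add: field_simps)
    have "norm (U w - 1) \<le> C * norm w" using C(2)[OF w(1)] by (simp add: homog_0 assms(2))
    also have "\<dots> \<le> norm w * (C + 1)" by (simp add: algebra_simps)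
    finally have "norm (U w - 1) < 1" using w(2) by simp
    then show "U w \<noteq> 0" by auto
  qed
qed

text \<open>
  With \<open>F\<^sub>j \<circ> \<pi>\<^sub>n = (\<pi>\<^sub>n)\<^sub>j \<cdot> U\<^sub>j\<close> the lift is \<open>w\<^sub>1 \<mapsto> w\<^sub>1 U\<^sub>1\<^sup>2 / U\<^sub>n\<close>, \<open>w\<^sub>j \<mapsto> w\<^sub>j U\<^sub>j / U\<^sub>j\<^sub>-\<^sub>1\<close>, because
  \<open>w\<^sub>1 = z\<^sub>1\<^sup>2 / z\<^sub>n\<close> and \<open>w\<^sub>j = z\<^sub>j / z\<^sub>j\<^sub>-\<^sub>1\<close>.
\<close>

lemma lift_in_coordinates:
  fixes F :: "('n::{finite,linorder}) cvec \<Rightarrow> 'n cvec"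
  assumes F: "has_power_series F 0 a" "F 0 = 0" "(F has_derivative (\<lambda>v. jordan_block *v v)) (at 0)"
  defines "c \<equiv> \<lambda>j. a (\<lambda>i. if pos i = 1 then 2 else 0) $ ix j"
  obtains G b r where "has_power_series G 0 b" "G 0 = 0" "r > 0"
    "\<And>w. w \<in> ball 0 r \<Longrightarrow> tower_monomials (G w) = F (tower_monomials w)"
    "\<And>v j. (\<And>i. v $ i \<noteq> 0) \<Longrightarrow> 1 \<le> j \<Longrightarrow> j \<le> CARD('n) \<Longrightarrow>
      quadratic_part b v $ ix j = v $ ix j * coord_slope CARD('n) (c CARD('n)) (\<lambda>i. v $ ix i) j"
proof -
  let ?n = "CARD('n)"
  have n1: "1 \<le> ?n" by (simp add: Suc_le_eq card_gt_0_iff)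
  have je: "jordan_expansion F c" unfolding c_def by (rule jordan_map_expansion[OF F])
  have "\<forall>j\<in>{1..?n}. \<exists>U d r. germ_series U d \<and> d (\<lambda>_. 0) = 1 \<and> r > 0 \<and>
      (\<forall>w\<in>ball 0 r. F (tower_monomials w) $ ix j = tower_monomials w $ ix j * U w \<and> U w \<noteq> 0)"
  proof
    fix j assume "j \<in> {1..?n}"
    then have j: "1 \<le> j" "j \<le> ?n" by auto
    obtain U r where U: "germ_analytic U" "r > 0"
      "\<And>w. w \<in> ball 0 r \<Longrightarrow> F (tower_monomials w) $ ix j = tower_monomials w $ ix j * U w"
      using lift_multiplier[OF F, of "ix j"] by blast
    obtain d where d: "germ_series U d" using U(1) by (auto simp: germ_analytic_def)
    have d1: "d (\<lambda>_. 0) = 1" by (rule lift_multiplier_at_0[OF je j d U(2,3)])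
    obtain s where s: "s > 0" "\<And>w. w \<in> ball 0 s \<Longrightarrow> U w \<noteq> 0"
      using germ_series_nonzero_near_0[OF d d1] by blast
    have "min r s > 0" using U(2) s(1) by simp
    moreover have "\<forall>w\<in>ball 0 (min r s). F (tower_monomials w) $ ix j = tower_monomials w $ ix j * U w \<and> U w \<noteq> 0"
      using U(3) s(2) by simp
    ultimately show "\<exists>U d r. germ_series U d \<and> d (\<lambda>_. 0) = 1 \<and> r > 0 \<and>
      (\<forall>w\<in>ball 0 r. F (tower_monomials w) $ ix j = tower_monomials w $ ix j * U w \<and> U w \<noteq> 0)"
      using d d1 by blast
  qed
  then obtain U d R where U: "\<And>j. j \<in> {1..?n} \<Longrightarrow> germ_series (U j) (d j) \<and> d j (\<lambda>_. 0) = 1 \<and> R j > (0::real) \<and>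
      (\<forall>w\<in>ball 0 (R j). F (tower_monomials w) $ ix j = tower_monomials w $ ix j * U j w \<and> U j w \<noteq> 0)"
    by metis
  define r where "r = Min (R ` {1..?n})"
  have r: "r > 0" unfolding r_def using U n1 by (subst Min_gr_iff) auto
  have rR: "w \<in> ball 0 (R j)" if "w \<in> ball 0 r" "1 \<le> j" "j \<le> ?n" for w :: "'n cvec" and j
  proof -
    have "r \<le> R j" unfolding r_def using that by (intro Min_le) auto
    then show ?thesis using that(1) by simp
  qed
  have FU: "F (tower_monomials w) $ ix j = tower_monomials w $ ix j * U j w" "U j w \<noteq> 0"
    if "w \<in> ball 0 r" "1 \<le> j" "j \<le> ?n" for w j
    using U[of j] rR[OF that] that by auto
  define H where "H w k = (if k = 1 then (U 1 w)\<^sup>2 / U ?n w else U k w / U (k - 1) w)" for w k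
  define G where "G w = (\<chi> i. w $ i * H w (pos i))" for w :: "'n cvec"
  have G: "G w $ ix j = w $ ix j * H w j" if "1 \<le> j" "j \<le> ?n" for w j
    using that by (simp add: G_def pos_ix)
  have anU: "germ_analytic (U j)" "germ_analytic (\<lambda>w. 1 / U j w)" if "1 \<le> j" "j \<le> ?n" for j
    using U[of j] that germ_analytic_inverse[of "U j" "d j"] by (auto simp: germ_analytic_def)
  have "germ_analytic (\<lambda>w. G w $ i)" for i
  proof -
    obtain j where j: "1 \<le> j" "j \<le> ?n" "i = ix j" by (rule ix_cases)
    show ?thesis
    proof (cases "j = 1")
      case True
      have "germ_analytic (\<lambda>w. w $ i * (U 1 w * U 1 w * (1 / U ?n w)))"
        by (intro germ_analytic_mult germ_analytic_coord anU) (use n1 in auto)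
      then show ?thesis using G[OF j(1,2)] j True by (simp add: H_def power2_eq_square)
    next
      case False
      have "germ_analytic (\<lambda>w. w $ i * (U j w * (1 / U (j - 1) w)))"
        by (intro germ_analytic_mult germ_analytic_coord anU) (use j False in auto)
      then show ?thesis using G[OF j(1,2)] j False by (simp add: H_def)
    qed
  qed
  then obtain b where b: "has_power_series G 0 b" using germ_analytic_components_power_series by blast
  have rel: "chart_relation ?n (G w) (F (tower_monomials w))" if w: "w \<in> ball 0 r" for w
  proof -
    note tm = chart_relation_tower_monomials[of w, unfolded chart_relation_def]
    have "(F (tower_monomials w) $ ix 1)\<^sup>2 = (tower_monomials w $ ix 1)\<^sup>2 * (U 1 w)\<^sup>2"
      using FU(1)[OF w, of 1] n1 by (simp add: power_mult_distrib)
    also have "\<dots> = w $ ix 1 * tower_monomials w $ ix ?n * (U 1 w)\<^sup>2" using tm by simp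
    also have "\<dots> = G w $ ix 1 * F (tower_monomials w) $ ix ?n"
      using FU[OF w, of ?n] G[of 1 w] n1 by (simp add: H_def)
    finally have "(F (tower_monomials w) $ ix 1)\<^sup>2 = G w $ ix 1 * F (tower_monomials w) $ ix ?n" .
    moreover have "F (tower_monomials w) $ ix j = G w $ ix j * F (tower_monomials w) $ ix (j - 1)"
      if j: "2 \<le> j" "j \<le> ?n" for j
    proof -
      have "F (tower_monomials w) $ ix j = w $ ix j * tower_monomials w $ ix (j - 1) * U j w"
        using FU(1)[OF w, of j] tower_monomials_step[OF j, of w] j by simp
      also have "\<dots> = G w $ ix j * (tower_monomials w $ ix (j - 1) * U (j - 1) w)"
        using FU(2)[OF w, of "j - 1"] G[of j w] j by (simp add: H_def)
      finally show ?thesis using FU(1)[OF w, of "j - 1"] j by simp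
    qed
    ultimately show ?thesis unfolding chart_relation_def by (meson not_le)
  qed
  have lift: "tower_monomials (G w) = F (tower_monomials w)" if w: "w \<in> ball 0 r" for w
  proof (rule chart_relation_unique[OF rel[OF w], symmetric])
    have "(\<Prod>l\<in>UNIV. G w $ l) = (\<Prod>k\<in>{1..?n}. w $ ix k * H w k)"
      unfolding prod_over_ix using G by (intro prod.cong) auto
    also have "\<dots> = (\<Prod>l\<in>UNIV. w $ l) * (\<Prod>k\<in>{1..?n}. H w k)"
      by (simp add: prod.distrib prod_over_ix)
    also have "(\<Prod>k\<in>{1..?n}. H w k) = U 1 w"
      unfolding H_def by (rule telescoping_prod[OF n1]) (use FU(2)[OF w] in auto)
    finally show "F (tower_monomials w) $ ix 1 = (\<Prod>l\<in>UNIV. G w $ l)"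
      using FU(1)[OF w, of 1] n1 tower_monomials_first[of w] by simp
  qed
  show ?thesis
  proof (rule that[OF b _ r lift])
    show "G 0 = 0" by (simp add: G_def vec_eq_iff)
    fix v :: "'n cvec" and j assume v: "\<And>i. v $ i \<noteq> 0" and j: "1 \<le> j" "j \<le> ?n"
    have vn: "norm v > 0" using v by (metis zero_index zero_less_norm_iff)
    define \<delta> where "\<delta> = r / (2 * norm v)"
    have \<delta>: "\<delta> > 0" using r vn by (simp add: \<delta>_def)
    define t where "t m = (of_real (\<delta> / real (Suc m)) :: complex)" for m :: nat
    have t: "t \<longlonglongrightarrow> 0" unfolding t_def by (rule null_sequence_complex)
    have tn: "t m \<noteq> 0" for m unfolding t_def using \<delta> by (simp del: of_nat_Suc)
    define w where "w m = t m *s v" for m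
    have wi: "w m $ i = t m * v $ i" for m i by (simp add: w_def)
    have w: "w \<longlonglongrightarrow> 0"
      by (rule vec_tendstoI) (use tendsto_mult_left_zero[OF t] in \<open>simp add: wi\<close>)
    have wb: "w m \<in> ball 0 r" for m
    proof -
      have "w m = (\<delta> / real (Suc m)) *\<^sub>R v" unfolding w_def t_def by (rule scaleR_eq_vector_scale[symmetric])
      then have "norm (w m) = \<delta> / real (Suc m) * norm v" using \<delta> by simp
      also have "\<dots> \<le> \<delta> * norm v" using \<delta> by (intro mult_right_mono) (auto simp: field_simps)
      also have "\<dots> < r" using vn r by (simp add: \<delta>_def)
      finally show ?thesis by simp
    qed
    have nz: "tower_monomials (w m) $ i \<noteq> 0" for m i
      using tn v by (simp add: tower_monomials_def mpow_eq_0_iff wi)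
    have nz1: "tower_monomials (w m) \<noteq> 0" for m using nz by (metis zero_index)
    have nz2: "F (tower_monomials (w m)) \<noteq> 0" for m
    proof -
      have "F (tower_monomials (w m)) $ ix 1 \<noteq> 0" using FU[OF wb, of 1] nz n1 by simp
      then show ?thesis by auto
    qed
    have slope: "(\<lambda>m. (G (w m) $ ix j / w m $ ix j - 1) / t m) \<longlonglongrightarrow> coord_slope ?n (c ?n) (\<lambda>i. v $ ix i) j"
      by (rule coord_multiplier_slope[OF je j _ _ tower_monomials_tendsto_0[OF w] nz1 nz2 w t])
        (use tn rel[OF wb] in \<open>simp_all add: wi chart_relation_tower_monomials\<close>)
    have "(\<lambda>m. v $ ix j * ((G (w m) $ ix j / w m $ ix j - 1) / t m))
        \<longlonglongrightarrow> v $ ix j * coord_slope ?n (c ?n) (\<lambda>i. v $ ix i) j"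
      by (rule tendsto_mult_left[OF slope])
    also have "(\<lambda>m. v $ ix j * ((G (w m) $ ix j / w m $ ix j - 1) / t m)) =
        (\<lambda>m. (G (t m *s v) $ ix j - t m * v $ ix j) / (t m)\<^sup>2)"
      using tn v by (simp add: fun_eq_iff wi w_def[symmetric] field_simps power2_eq_square)
    finally have "homog (\<lambda>\<alpha>. b \<alpha> $ ix j) 2 v = v $ ix j * coord_slope ?n (c ?n) (\<lambda>i. v $ ix i) j"
      by (rule germ_series_ray(3)[OF has_power_series_nth[OF b] t tn])
    then show "quadratic_part b v $ ix j = v $ ix j * coord_slope ?n (c ?n) (\<lambda>i. v $ ix i) j"
      by (simp add: quadratic_part_def homog_def)
  qed
qed

section \<open>Charts\<close>

lemma is_chartD:
  assumes "is_chart M c"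
  shows "openin (mtop M) (fst c)" "open (snd c ` fst c)"
    "homeomorphic_map (subtopology (mtop M) (fst c)) (top_of_set (snd c ` fst c)) (snd c)"
    "d \<in> atlas M \<Longrightarrow> compatible c d" "d \<in> atlas M \<Longrightarrow> compatible d c"
  using assms by (simp_all add: is_chart_def)

lemma chart_subset: "is_chart M c \<Longrightarrow> fst c \<subseteq> points M"
  by (rule openin_subset[OF is_chartD(1)])

lemma chart_inj:
  assumes "is_chart M c"
  shows "inj_on (snd c) (fst c)"
proof -
  have "inj_on (snd c) (topspace (subtopology (mtop M) (fst c)))"
    using is_chartD(3)[OF assms] by (simp add: homeomorphic_map_def)
  moreover have "topspace (subtopology (mtop M) (fst c)) = fst c"
    by (rule topspace_subtopology_subset[OF chart_subset[OF assms]])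
  ultimately show ?thesis by simp
qed

lemma chart_inv_left: "is_chart M c \<Longrightarrow> x \<in> fst c \<Longrightarrow> chart_inv c (snd c x) = x"
  unfolding chart_inv_def by (rule inv_into_f_f[OF chart_inj])

lemma chart_inv_right: "y \<in> snd c ` fst c \<Longrightarrow> snd c (chart_inv c y) = y"
  unfolding chart_inv_def by (rule f_inv_into_f)

lemma chart_inv_mem: "y \<in> snd c ` fst c \<Longrightarrow> chart_inv c y \<in> fst c"
  unfolding chart_inv_def by (rule inv_into_into)

lemma chart_continuous:
  assumes "is_chart M c"
  shows "continuous_map (subtopology (mtop M) (fst c)) euclidean (snd c)"
proof -
  have "continuous_map (subtopology (mtop M) (fst c)) (top_of_set (snd c ` fst c)) (snd c)"
    by (rule homeomorphic_imp_continuous_map[OF is_chartD(3)[OF assms]])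
  then show ?thesis by (rule continuous_map_into_fulltopology)
qed

lemma chart_inv_continuous:
  assumes "is_chart M c"
  shows "continuous_map (top_of_set (snd c ` fst c)) (subtopology (mtop M) (fst c)) (chart_inv c)"
proof -
  obtain g where g: "homeomorphic_maps (subtopology (mtop M) (fst c)) (top_of_set (snd c ` fst c)) (snd c) g"
    using is_chartD(3)[OF assms] unfolding homeomorphic_map_maps ..
  then have cont: "continuous_map (top_of_set (snd c ` fst c)) (subtopology (mtop M) (fst c)) g"
    by (simp add: homeomorphic_maps_def)
  have "g y = chart_inv c y" if y: "y \<in> snd c ` fst c" for y
  proof -
    obtain x where x: "x \<in> fst c" "y = snd c x"
      using y by blast
    have "x \<in> topspace (subtopology (mtop M) (fst c))"
      using x(1) chart_subset[OF assms] by auto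
    then have "g y = x" using g x(2) unfolding homeomorphic_maps_def by blast
    then show ?thesis using chart_inv_left[OF assms x(1)] x(2) by simp
  qed
  then show ?thesis by (intro continuous_map_eq[OF cont]) simp
qed

lemma limitin_chart:
  assumes c: "is_chart M c" and lim: "limitin (mtop M) s p sequentially" and p: "p \<in> fst c"
  shows "\<forall>\<^sub>F m in sequentially. s m \<in> fst c" "(\<lambda>m. snd c (s m)) \<longlonglongrightarrow> snd c p"
proof -
  show ev: "\<forall>\<^sub>F m in sequentially. s m \<in> fst c"
  proof -
    have "openin (mtop M) (fst c)" using c by (simp add: is_chart_def)
    then show ?thesis using lim p by (simp add: limitin_def)
  qed
  have "limitin (subtopology (mtop M) (fst c)) s p sequentially"
    unfolding limitin_subtopology using ev lim p by blast
  from continuous_map_limit[OF chart_continuous[OF c] this]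
  show "(\<lambda>m. snd c (s m)) \<longlonglongrightarrow> snd c p" unfolding limitin_canonical_iff o_def .
qed

lemma limitin_chartI:
  assumes c: "is_chart M c" and ev: "\<forall>\<^sub>F m in sequentially. s m \<in> fst c"
    and lim: "(\<lambda>m. snd c (s m)) \<longlonglongrightarrow> snd c p" and p: "p \<in> fst c"
  shows "limitin (mtop M) s p sequentially"
proof -
  have img: "\<forall>\<^sub>F m in sequentially. snd c (s m) \<in> snd c ` fst c"
    using ev by eventually_elim (rule imageI)
  have "limitin (top_of_set (snd c ` fst c)) (\<lambda>m. snd c (s m)) (snd c p) sequentially"
    unfolding limitin_subtopology limitin_canonical_iff using lim img p by blast
  from continuous_map_limit[OF chart_inv_continuous[OF c] this]
  have "limitin (mtop M) (\<lambda>m. chart_inv c (snd c (s m))) p sequentially"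
    unfolding limitin_subtopology o_def chart_inv_left[OF c p] by blast
  moreover have "\<forall>\<^sub>F m in sequentially. chart_inv c (snd c (s m)) = s m"
    using ev by eventually_elim (rule chart_inv_left[OF c])
  ultimately show ?thesis by (rule limitin_transform_eventually[rotated])
qed

lemma has_power_series_transform:
  assumes f: "has_power_series f p a" and S: "open S" "p \<in> S" and eq: "\<And>x. x \<in> S \<Longrightarrow> f x = g x"
  shows "has_power_series g p a"
proof -
  obtain r where r: "r > 0" "\<forall>z\<in>ball p r. ((\<lambda>\<alpha>. mpow (z - p) \<alpha> *s a \<alpha>) has_sum f z) UNIV"
    using f unfolding has_power_series_def by blast
  obtain e where e: "e > 0" "ball p e \<subseteq> S" using S open_contains_ball by blast
  show ?thesis unfolding has_power_series_def
  proof (intro exI conjI ballI)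
    show "min r e > 0" using r e by simp
    fix z assume "z \<in> ball p (min r e)"
    then have z: "z \<in> ball p r" "z \<in> S" using e(2) by auto
    have "((\<lambda>\<alpha>. mpow (z - p) \<alpha> *s a \<alpha>) has_sum f z) UNIV" using r(2) z(1) by blast
    then show "((\<lambda>\<alpha>. mpow (z - p) \<alpha> *s a \<alpha>) has_sum g z) UNIV" unfolding eq[OF z(2)] .
  qed
qed

lemma holo_on_cong:
  assumes "holo_on f S" "open T" "T \<subseteq> S" "\<And>x. x \<in> T \<Longrightarrow> f x = g x"
  shows "holo_on g T"
  unfolding holo_on_def
proof
  fix p assume p: "p \<in> T"
  then obtain a where "has_power_series f p a" using assms(1,3) unfolding holo_on_def by blast
  from has_power_series_transform[OF this assms(2) p assms(4)]
  show "\<exists>a. has_power_series g p a" by blast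
qed

lemma openin_chart_image:
  assumes c: "is_chart M c" and U: "openin (mtop M) U"
  shows "open (snd c ` (fst c \<inter> U))"
proof -
  have "openin (subtopology (mtop M) (fst c)) (fst c \<inter> U)"
    using U by (metis Int_commute openin_subtopology)
  moreover have "open_map (subtopology (mtop M) (fst c)) (top_of_set (snd c ` fst c)) (snd c)"
    by (rule homeomorphic_imp_open_map[OF is_chartD(3)[OF c]])
  ultimately have "openin (top_of_set (snd c ` fst c)) (snd c ` (fst c \<inter> U))"
    unfolding open_map_def by blast
  then show ?thesis by (rule openin_open_trans[OF _ is_chartD(2)[OF c]])
qed

text \<open>
  Atlas charts may meet the centre of a blow-up. Away from the centre, the blow-down map is
  controlled only over charts disjoint from it, and these are obtained by restriction.
\<close>

lemma is_chart_restrict: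
  assumes M: "\<And>d. d \<in> atlas M \<Longrightarrow> is_chart M d" and c: "is_chart M c" and U: "openin (mtop M) U"
  shows "is_chart M (fst c \<inter> U, snd c)"
proof -
  let ?c = "(fst c \<inter> U, snd c)"
  have sub: "fst c \<subseteq> points M" by (rule chart_subset[OF c])
  have oc: "openin (mtop M) (fst c)" using c by (simp add: is_chart_def)
  have inv: "chart_inv ?c y = chart_inv c y" if y: "y \<in> snd c ` (fst c \<inter> U)" for y
  proof -
    have "chart_inv ?c y \<in> fst c \<inter> U" "snd c (chart_inv ?c y) = y"
      using chart_inv_mem[of y ?c] chart_inv_right[of y ?c] y by simp_all
    then show ?thesis using chart_inv_left[OF c, of "chart_inv ?c y"] by simp
  qed
  have "homeomorphic_map (subtopology (subtopology (mtop M) (fst c)) U)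
      (subtopology (top_of_set (snd c ` fst c)) (snd c ` (fst c \<inter> U))) (snd c)"
  proof (rule homeomorphic_map_subtopologies)
    show "homeomorphic_map (subtopology (mtop M) (fst c)) (top_of_set (snd c ` fst c)) (snd c)"
      using c by (simp add: is_chart_def)
    show "snd c ` (topspace (subtopology (mtop M) (fst c)) \<inter> U) =
        topspace (top_of_set (snd c ` fst c)) \<inter> snd c ` (fst c \<inter> U)"
      using sub by auto
  qed
  then have homeo: "homeomorphic_map (subtopology (mtop M) (fst c \<inter> U)) (top_of_set (snd c ` (fst c \<inter> U))) (snd c)"
    by (simp add: subtopology_subtopology Int_absorb1 image_mono)
  have "compatible ?c d \<and> compatible d ?c" if d: "d \<in> atlas M" for d
  proof
    have cd: "compatible c d" "compatible d c" using c d by (auto simp: is_chart_def)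
    have od: "openin (mtop M) (fst d)" using M[OF d] by (simp add: is_chart_def)
    have "open (snd c ` (fst c \<inter> (U \<inter> fst d)))" by (rule openin_chart_image[OF c openin_Int[OF U od]])
    then have "open (snd c ` (fst c \<inter> U \<inter> fst d))" by (simp add: Int_assoc)
    then show "compatible ?c d" unfolding compatible_def fst_conv snd_conv
      by (rule holo_on_cong[OF cd(1)[unfolded compatible_def]]) (auto simp: inv)
    have "open (snd d ` (fst d \<inter> (fst c \<inter> U)))"
      by (rule openin_chart_image[OF M[OF d] openin_Int[OF oc U]])
    then show "compatible d ?c" unfolding compatible_def fst_conv snd_conv
      by (rule holo_on_cong[OF cd(2)[unfolded compatible_def]]) auto
  qed
  then show ?thesis
    using openin_Int[OF oc U] openin_chart_image[OF c U] homeo by (simp add: is_chart_def)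
qed

section \<open>The local blow-up\<close>

lemma mem_line_iff: "x \<in> line v \<longleftrightarrow> (\<exists>k. x = k *s v)"
  unfolding line_def vec.span_singleton by blast

lemma line_scale:
  assumes "k \<noteq> 0"
  shows "line (k *s v) = line v"
proof (rule set_eqI)
  fix x
  have "l *s v = (l / k) *s (k *s v)" for l using assms by (simp add: vector_smult_assoc)
  then show "x \<in> line (k *s v) \<longleftrightarrow> x \<in> line v"
    unfolding mem_line_iff by (metis vector_smult_assoc)
qed

lemma line_eqI: "u \<in> line v \<Longrightarrow> u \<noteq> 0 \<Longrightarrow> line v = line u"
  unfolding mem_line_iff using line_scale by (metis vector_smult_lzero)

lemma self_mem_line: "v \<in> line v"
  unfolding mem_line_iff by (metis vector_smult_lid)

lemma line_normalized:
  assumes "u \<in> line v" "u $ i = 1" "v $ i = 1"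
  shows "u = v"
proof -
  obtain k where k: "u = k *s v" using assms(1) by (auto simp: mem_line_iff)
  then have "k = 1" using assms by simp
  then show ?thesis using k by simp
qed

text \<open>
  The blow-down map in the \<open>i\<close>-th standard chart of the local blow-up along \<open>{w\<^sub>j = 0 for j \<in> I}\<close>.
\<close>

definition blowup_coords :: "'n set \<Rightarrow> 'n \<Rightarrow> ('n::finite) cvec \<Rightarrow> 'n cvec" where
  "blowup_coords I i y = (\<chi> j. if j \<in> I - {i} then y $ i * y $ j else y $ j)"

text \<open>
  A vector spanning the line of the point with coordinates \<open>y\<close> in that chart.
\<close>

definition blowup_dir :: "'n set \<Rightarrow> 'n \<Rightarrow> ('n::finite) cvec \<Rightarrow> 'n cvec" where
  "blowup_dir I i y = (\<chi> j. if j = i then 1 else if j \<in> I then y $ j else 0)"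

lemma local_coords_line:
  assumes "u $ i = 1"
  shows "local_coords I i (w, line u) = (\<chi> j. if j \<in> I - {i} then u $ j else w $ j)"
proof -
  have the: "(THE x. x \<in> line u \<and> x $ i = 1) = u"
    by (rule the_equality) (use assms self_mem_line line_normalized in blast)+
  show ?thesis unfolding local_coords_def split Let_def the ..
qed

lemma local_blowup_line:
  assumes wL: "(w, L) \<in> local_blowup I W" and i: "local_dom i L"
  obtains u where "u $ i = 1" "L = line u" "i \<in> I" "\<And>j. j \<notin> I \<Longrightarrow> u $ j = 0"
    "\<And>j. j \<in> I \<Longrightarrow> w $ j = w $ i * u $ j"
proof -
  obtain v where v: "L = line v" using wL by (auto simp: local_blowup_def proj_space_def)
  obtain x where x: "x \<in> L" "x $ i \<noteq> 0" using i by (auto simp: local_dom_def)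
  define u where "u = (1 / x $ i) *s x"
  have x0: "x \<noteq> 0" using x(2) by auto
  have Lx: "L = line x" unfolding v by (rule line_eqI) (use x x0 v in auto)
  have Lu: "L = line u" unfolding u_def Lx by (rule line_scale[symmetric]) (use x(2) in simp)
  have ui: "u $ i = 1" using x(2) by (simp add: u_def)
  have uI: "u $ j = 0" if "j \<notin> I" for j
  proof -
    have "u \<in> coord_subspace I" using wL self_mem_line Lu by (auto simp: local_blowup_def)
    then show ?thesis using that by (simp add: coord_subspace_def)
  qed
  have iI: "i \<in> I" using uI ui by force
  obtain k where k: "coord_proj I w = k *s u"
    using wL Lu by (auto simp: local_blowup_def mem_line_iff)
  have wk: "w $ j = k * u $ j" if "j \<in> I" for j
  proof -
    have "coord_proj I w $ j = (k *s u) $ j" by (simp only: k)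
    then show ?thesis using that by (simp add: coord_proj_def)
  qed
  have "w $ i = k" using wk[OF iI] ui by simp
  then show ?thesis using that[OF ui Lu iI uI] wk by simp
qed

text \<open>
  The line is spanned by its vector with \<open>i\<close>-th coordinate one, whose other coordinates the chart records;
  the multiple of this vector that gives the \<open>I\<close>-part of \<open>w\<close> has the factor \<open>w\<^sub>i\<close>.
\<close>

lemma local_blowup_coords:
  assumes wL: "(w, L) \<in> local_blowup I W" and i: "local_dom i L"
  shows "L = line (blowup_dir I i (local_coords I i (w, L)))"
    "w = blowup_coords I i (local_coords I i (w, L))"
proof -
  obtain u where u: "u $ i = 1" "L = line u" "i \<in> I" "\<And>j. j \<notin> I \<Longrightarrow> u $ j = 0"
    "\<And>j. j \<in> I \<Longrightarrow> w $ j = w $ i * u $ j"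
    using local_blowup_line[OF wL i] by blast
  note lc = local_coords_line[OF u(1), of I w]
  have "blowup_dir I i (local_coords I i (w, line u)) = u"
    unfolding lc using u(1,4) by (auto simp: blowup_dir_def vec_eq_iff)
  then show "L = line (blowup_dir I i (local_coords I i (w, L)))" using u(2) by simp
  have "blowup_coords I i (local_coords I i (w, line u)) = w"
    unfolding lc using u(5) by (auto simp: blowup_coords_def vec_eq_iff)
  then show "w = blowup_coords I i (local_coords I i (w, L))" using u(2) by simp
qed

lemma local_blowup_dom:
  assumes "(w, L) \<in> local_blowup I W"
  obtains i where "i \<in> I" "local_dom i L"
proof -
  obtain v where v: "L = line v" "v \<noteq> 0" using assms by (auto simp: local_blowup_def proj_space_def)
  then obtain i where i: "v $ i \<noteq> 0" by (auto simp: vec_eq_iff)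
  have "v \<in> coord_subspace I" using assms self_mem_line v by (auto simp: local_blowup_def)
  then have "i \<in> I" using i by (auto simp: coord_subspace_def)
  moreover have "local_dom i L" using i v self_mem_line by (auto simp: local_dom_def)
  ultimately show ?thesis by (rule that)
qed

definition blowup_dom ::
  "('a, 'n::finite) manifold \<Rightarrow> ('a \<Rightarrow> 'b) \<Rightarrow> ('b, 'n) chart \<Rightarrow> ('a \<Rightarrow> 'n cvec \<times> 'n cvec set) \<Rightarrow> 'n \<Rightarrow> 'a set" where
  "blowup_dom M' \<sigma> c h i = {p \<in> points M'. \<sigma> p \<in> fst c \<and> local_dom i (snd (h p))}"

lemma trivializes_chart:
  assumes "trivializes M' \<sigma> c I h" "i \<in> I"
  shows "is_chart M' (blowup_dom M' \<sigma> c h i, local_coords I i \<circ> h)"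
  using assms unfolding trivializes_def blowup_dom_def by blast

lemma trivializes_mem:
  assumes "trivializes M' \<sigma> c I h" "p \<in> points M'" "\<sigma> p \<in> fst c"
  shows "(snd c (\<sigma> p), snd (h p)) \<in> local_blowup I (snd c ` fst c)" "h p = (snd c (\<sigma> p), snd (h p))"
proof -
  have "h p \<in> local_blowup I (snd c ` fst c)"
    using assms unfolding trivializes_def by (blast dest: bij_betwE)
  moreover show "h p = (snd c (\<sigma> p), snd (h p))"
    using assms unfolding trivializes_def by (metis prod.collapse)
  ultimately show "(snd c (\<sigma> p), snd (h p)) \<in> local_blowup I (snd c ` fst c)" by simp
qed

lemma trivializes_coords:
  assumes t: "trivializes M' \<sigma> c I h" and p: "p \<in> blowup_dom M' \<sigma> c h i"
  shows "snd (h p) = line (blowup_dir I i (local_coords I i (h p)))"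
    "snd c (\<sigma> p) = blowup_coords I i (local_coords I i (h p))"
proof -
  have p': "p \<in> points M'" "\<sigma> p \<in> fst c" "local_dom i (snd (h p))" using p by (auto simp: blowup_dom_def)
  note m = trivializes_mem[OF t p'(1,2)]
  show "snd (h p) = line (blowup_dir I i (local_coords I i (h p)))"
    "snd c (\<sigma> p) = blowup_coords I i (local_coords I i (h p))"
    using local_blowup_coords[OF m(1) p'(3)] m(2) by simp_all
qed

lemma trivializes_cover:
  assumes t: "trivializes M' \<sigma> c I h" and p: "p \<in> points M'" "\<sigma> p \<in> fst c"
  obtains i where "i \<in> I" "p \<in> blowup_dom M' \<sigma> c h i"
  using local_blowup_dom[OF trivializes_mem(1)[OF t p]] p by (auto simp: blowup_dom_def)

lemma trivializes_inj:
  assumes "trivializes M' \<sigma> c I h" "p \<in> points M'" "\<sigma> p \<in> fst c" "q \<in> points M'" "\<sigma> q \<in> fst c" "h p = h q"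
  shows "p = q"
  using assms unfolding trivializes_def bij_betw_def inj_on_def by blast

lemma continuous_blowup_coords: "continuous_on UNIV (blowup_coords I i)"
proof -
  have "continuous_on UNIV (\<lambda>y :: 'a cvec. if j \<in> I - {i} then y $ i * y $ j else y $ j)" for j
    by (cases "j \<in> I - {i}") (auto intro!: continuous_intros)
  then show ?thesis unfolding blowup_coords_def by (rule continuous_on_vec_lambda)
qed

lemma continuous_map_via_charts:
  assumes d: "is_chart M' d" and c: "is_chart M c"
    and \<sigma>: "\<And>p. p \<in> fst d \<Longrightarrow> \<sigma> p \<in> fst c \<and> snd c (\<sigma> p) = g (snd d p)"
    and g: "continuous_on UNIV g"
  shows "continuous_map (subtopology (mtop M') (fst d)) (mtop M) \<sigma>"
proof -
  have dom: "topspace (subtopology (mtop M') (fst d)) = fst d"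
    by (rule topspace_subtopology_subset[OF chart_subset[OF d]])
  have "continuous_map (subtopology (mtop M') (fst d)) euclidean (g \<circ> snd d)"
    by (rule continuous_map_compose[OF chart_continuous[OF d]]) (use g in simp)
  then have "continuous_map (subtopology (mtop M') (fst d)) (top_of_set (snd c ` fst c)) (g \<circ> snd d)"
    by (rule continuous_map_into_subtopology) (use \<sigma> dom in force)
  from continuous_map_compose[OF this chart_inv_continuous[OF c]]
  have "continuous_map (subtopology (mtop M') (fst d)) (mtop M) (chart_inv c \<circ> (g \<circ> snd d))"
    by (rule continuous_map_into_fulltopology)
  then show ?thesis
  proof (rule continuous_map_eq)
    fix p assume "p \<in> topspace (subtopology (mtop M') (fst d))"
    then show "(chart_inv c \<circ> (g \<circ> snd d)) p = \<sigma> p"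
      using \<sigma> dom chart_inv_left[OF c] by (metis comp_apply)
  qed
qed

text \<open>
  Continuity is local: over the centre the blow-down map is polynomial in the standard charts,
  elsewhere it is the identity in charts disjoint from the centre.
\<close>

lemma blowup_continuous:
  assumes b: "is_blowup M X M' \<sigma>"
  shows "continuous_map (mtop M') (mtop M) \<sigma>"
proof -
  have M: "\<And>d. d \<in> atlas M \<Longrightarrow> is_chart M d" "points M = (\<Union>c\<in>atlas M. fst c)"
    using b by (auto simp: is_blowup_def complex_manifold_def)
  have X: "closedin (mtop M) X" "\<And>p. p \<in> X \<Longrightarrow> \<exists>c I. is_chart M c \<and> p \<in> fst c \<and> adapted X c I"
    using b by (auto simp: is_blowup_def closed_submanifold_def)
  have "\<exists>D. openin (mtop M') D \<and> p \<in> D \<and> continuous_map (subtopology (mtop M') D) (mtop M) \<sigma>"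
    if p: "p \<in> points M'" for p
  proof (cases "\<sigma> p \<in> X")
    case True
    then obtain c I where c: "is_chart M c" "\<sigma> p \<in> fst c" "adapted X c I" using X(2) by blast
    then obtain h where h: "trivializes M' \<sigma> c I h" using b unfolding is_blowup_def by blast
    obtain i where i: "i \<in> I" "p \<in> blowup_dom M' \<sigma> c h i" by (rule trivializes_cover[OF h p c(2)])
    note d = trivializes_chart[OF h i(1)]
    have "continuous_map (subtopology (mtop M') (fst (blowup_dom M' \<sigma> c h i, local_coords I i \<circ> h))) (mtop M) \<sigma>"
      by (rule continuous_map_via_charts[OF d c(1) _ continuous_blowup_coords[of I i]])
        (use trivializes_coords(2)[OF h] in \<open>auto simp: blowup_dom_def\<close>)
    moreover have "openin (mtop M') (blowup_dom M' \<sigma> c h i)" using d by (simp add: is_chart_def)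
    ultimately show ?thesis using i(2) by auto
  next
    case False
    have "\<sigma> p \<in> points M" using b p by (auto simp: is_blowup_def)
    then obtain c0 where c0: "c0 \<in> atlas M" "\<sigma> p \<in> fst c0" using M(2) by blast
    define c where "c = (fst c0 \<inter> (points M - X), snd c0)"
    have "openin (mtop M) (points M - X)" using X(1) by (simp add: closedin_def)
    then have c: "is_chart M c" unfolding c_def by (intro is_chart_restrict M(1) c0(1))
    have "fst c \<inter> X = {}" by (auto simp: c_def)
    then have d: "is_chart M' ({p \<in> points M'. \<sigma> p \<in> fst c}, snd c \<circ> \<sigma>)"
      using b c unfolding is_blowup_def by blast
    have "continuous_map (subtopology (mtop M') (fst ({p \<in> points M'. \<sigma> p \<in> fst c}, snd c \<circ> \<sigma>))) (mtop M) \<sigma>"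
      by (rule continuous_map_via_charts[OF d c, where g = id]) auto
    moreover have "openin (mtop M') {p \<in> points M'. \<sigma> p \<in> fst c}" using d by (simp add: is_chart_def)
    moreover have "\<sigma> p \<in> fst c" using c0 False \<open>\<sigma> p \<in> points M\<close> by (simp add: c_def)
    ultimately show ?thesis using p by auto
  qed
  then obtain D where D: "\<And>p. p \<in> points M' \<Longrightarrow> openin (mtop M') (D p) \<and> p \<in> D p \<and>
      continuous_map (subtopology (mtop M') (D p)) (mtop M) \<sigma>"
    by metis
  show ?thesis
    by (rule pasting_lemma[where I = "points M'" and T = D and f = "\<lambda>_. \<sigma>"]) (use D in auto)
qed

text \<open>
  A chart in which \<open>\<sigma>\<close> has the standard form is the \<open>i\<close>-th chart of the trivialization. Outside the
  exceptional divisor this is read off from \<open>\<sigma>\<close>; a point with \<open>w\<^sub>i = 0\<close> is approached along the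
  \<open>i\<close>-th axis, where the line \<open>[u]\<close> does not change.
\<close>

lemma standard_chart_direction:
  assumes t: "trivializes M' \<sigma> c I h" and x: "is_chart M' x" "snd x ` fst x = UNIV" and i: "i \<in> I"
    and \<sigma>: "\<And>p. p \<in> fst x \<Longrightarrow> \<sigma> p \<in> fst c \<and> snd c (\<sigma> p) = blowup_coords I i (snd x p)"
    and p: "p \<in> fst x"
  shows "snd (h p) = line (blowup_dir I i (snd x p))"
proof -
  have pts: "q \<in> points M'" if "q \<in> fst x" for q using chart_subset[OF x(1)] that by blast
  have generic: "snd (h q) = line (blowup_dir I i (snd x q))" if q: "q \<in> fst x" "snd x q $ i \<noteq> 0" for q
  proof -
    let ?y = "snd x q"
    note m = trivializes_mem(1)[OF t pts[OF q(1)] \<sigma>[OF q(1), THEN conjunct1]]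
    obtain v where v: "snd (h q) = line v" using m by (auto simp: local_blowup_def proj_space_def)
    have "coord_proj I (snd c (\<sigma> q)) \<in> snd (h q)" using m by (simp add: local_blowup_def)
    moreover have "coord_proj I (snd c (\<sigma> q)) = ?y $ i *s blowup_dir I i ?y"
      using \<sigma>[OF q(1)] i by (simp add: coord_proj_def blowup_coords_def blowup_dir_def vec_eq_iff)
    moreover have "?y $ i *s blowup_dir I i ?y \<noteq> 0"
    proof
      assume "?y $ i *s blowup_dir I i ?y = 0"
      then have "(?y $ i *s blowup_dir I i ?y) $ i = 0" by (simp only: zero_index)
      then show False using q(2) by (simp add: blowup_dir_def)
    qed
    ultimately have "line v = line (?y $ i *s blowup_dir I i ?y)" unfolding v by (intro line_eqI) simp_all
    then show ?thesis using v line_scale[OF q(2)] by simp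
  qed
  show ?thesis
  proof (cases "snd x p $ i = 0")
    case False
    then show ?thesis by (rule generic[OF p])
  next
    case True
    define u where "u = blowup_dir I i (snd x p)"
    obtain k where k: "k \<in> I" "p \<in> blowup_dom M' \<sigma> c h k"
      by (rule trivializes_cover[OF t pts[OF p] \<sigma>[OF p, THEN conjunct1]])
    define y where "y m = snd x p + axis i (of_real (inverse (real (Suc m))))" for m
    define q where "q m = chart_inv x (y m)" for m
    have qx: "q m \<in> fst x" "snd x (q m) = y m" for m
      unfolding q_def using x(2) by (simp_all add: chart_inv_mem chart_inv_right)
    have yi: "y m $ i \<noteq> 0" for m using True by (simp add: y_def axis_def del: of_nat_Suc)
    have dir: "blowup_dir I i (y m) = u" for m
      by (auto simp: u_def y_def blowup_dir_def axis_def vec_eq_iff)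
    have "(\<lambda>m. axis i (of_real (inverse (real (Suc m)))) :: 'b cvec) \<longlonglongrightarrow> 0"
    proof (rule vec_tendstoI)
      fix j
      have "(\<lambda>m. of_real (inverse (real (Suc m))) :: complex) \<longlonglongrightarrow> of_real 0"
        by (intro tendsto_of_real LIMSEQ_inverse_real_of_nat)
      then show "(\<lambda>m. (axis i (of_real (inverse (real (Suc m)))) :: 'b cvec) $ j) \<longlonglongrightarrow> 0 $ j"
        by (cases "j = i") (auto simp: axis_def)
    qed
    from tendsto_add[OF tendsto_const this, of "snd x p"]
    have "y \<longlonglongrightarrow> snd x p" by (simp add: y_def[abs_def])
    then have lim: "limitin (mtop M') q p sequentially"
      by (intro limitin_chartI[OF x(1) _ _ p]) (simp_all add: qx)
    note kc = trivializes_chart[OF t k(1)]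
    have qk: "\<forall>\<^sub>F m in sequentially. q m \<in> blowup_dom M' \<sigma> c h k"
      "(\<lambda>m. local_coords I k (h (q m))) \<longlonglongrightarrow> local_coords I k (h p)"
      using limitin_chart[OF kc lim] k(2) by (simp_all add: o_def)
    have hq: "snd (h (q m)) = line u" for m
      using generic[OF qx(1), of m] yi by (simp add: qx dir)
    obtain m where "q m \<in> blowup_dom M' \<sigma> c h k"
      using eventually_happens'[OF sequentially_bot qk(1)] by blast
    then have "local_dom k (line u)" unfolding blowup_dom_def mem_Collect_eq hq by blast
    then obtain l where "l \<in> line u" "l $ k \<noteq> 0" unfolding local_dom_def by blast
    then have uk: "u $ k \<noteq> 0" by (auto simp: mem_line_iff)
    define u' where "u' = (1 / u $ k) *s u"
    have u': "line u' = line u" "u' $ k = 1" using uk by (simp_all add: u'_def line_scale)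
    have lc: "local_coords I k (h p) $ j = u' $ j" if j: "j \<in> I - {k}" for j
    proof -
      have "\<forall>\<^sub>F m in sequentially. local_coords I k (h (q m)) $ j = u' $ j"
        using qk(1)
      proof eventually_elim
        case (elim m)
        then have "q m \<in> points M'" "\<sigma> (q m) \<in> fst c" by (auto simp: blowup_dom_def)
        from trivializes_mem(2)[OF t this] have "h (q m) = (snd c (\<sigma> (q m)), line u')"
          by (simp only: hq u')
        then show ?case using j local_coords_line[OF u'(2), of I "snd c (\<sigma> (q m))"] by simp
      qed
      then have "(\<lambda>m. local_coords I k (h (q m)) $ j) \<longlonglongrightarrow> u' $ j" by (rule tendsto_eventually)
      with tendsto_vec_nth[OF qk(2)] show ?thesis by (rule LIMSEQ_unique)
    qed
    have "blowup_dir I k (local_coords I k (h p)) $ j = u' $ j" for j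
    proof -
      consider "j = k" | "j \<in> I - {k}" | "j \<notin> I" by blast
      then show ?thesis
      proof cases
        case 3
        then have "u $ j = 0" "j \<noteq> k" using i k(1) by (auto simp: u_def blowup_dir_def)
        then show ?thesis using 3 by (simp add: blowup_dir_def u'_def)
      qed (simp_all add: blowup_dir_def u'(2) lc)
    qed
    then have "blowup_dir I k (local_coords I k (h p)) = u'" by (simp add: vec_eq_iff)
    then show ?thesis using trivializes_coords(1)[OF t k(2)] u'(1) by (simp add: u_def)
  qed
qed

text \<open>
  In the standard chart around the limit the normal coordinates of the images are \<open>w\<^sub>j = w\<^sub>i U\<^sub>j\<close>, where
  the \<open>U\<^sub>j\<close> with \<open>j \<noteq> i\<close> are coordinates of that chart. This form also covers points of the exceptional
  divisor.
\<close>

lemma lifted_sequence_direction: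
  assumes t: "trivializes M' \<sigma> c I h" and lim: "limitin (mtop M') q p sequentially" and p: "\<sigma> p \<in> fst c"
  obtains i u U where "i \<in> I" "u $ i = 1" "snd (h p) = line u" "\<And>j. j \<notin> I \<Longrightarrow> u $ j = 0"
    "\<And>j. j \<in> I \<Longrightarrow> (\<lambda>m. U m $ j) \<longlonglongrightarrow> u $ j"
    "\<forall>\<^sub>F m in sequentially. \<forall>j\<in>I. snd c (\<sigma> (q m)) $ j = snd c (\<sigma> (q m)) $ i * U m $ j"
proof -
  have pp: "p \<in> points M'" using lim by (rule limitin_topspace)
  obtain i where i: "i \<in> I" "p \<in> blowup_dom M' \<sigma> c h i"
    by (rule trivializes_cover[OF t pp p])
  note ic = trivializes_chart[OF t i(1)]
  have qi: "\<forall>\<^sub>F m in sequentially. q m \<in> blowup_dom M' \<sigma> c h i"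
    "(\<lambda>m. local_coords I i (h (q m))) \<longlonglongrightarrow> local_coords I i (h p)"
    using limitin_chart[OF ic lim] i(2) by (simp_all add: o_def)
  define U where "U m = blowup_dir I i (local_coords I i (h (q m)))" for m
  define u where "u = blowup_dir I i (local_coords I i (h p))"
  show ?thesis
  proof (rule that[of i u U])
    show "u $ i = 1" by (simp add: u_def blowup_dir_def)
    show "snd (h p) = line u" unfolding u_def by (rule trivializes_coords(1)[OF t i(2)])
    show "u $ j = 0" if "j \<notin> I" for j using that i by (auto simp: u_def blowup_dir_def)
    show "(\<lambda>m. U m $ j) \<longlonglongrightarrow> u $ j" if "j \<in> I" for j
      using tendsto_vec_nth[OF qi(2), of j] that by (cases "j = i") (simp_all add: U_def u_def blowup_dir_def)
    show "\<forall>\<^sub>F m in sequentially. \<forall>j\<in>I. snd c (\<sigma> (q m)) $ j = snd c (\<sigma> (q m)) $ i * U m $ j"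
      using qi(1)
    proof eventually_elim
      case (elim m)
      show ?case unfolding trivializes_coords(2)[OF t elim] U_def
        by (auto simp: blowup_coords_def blowup_dir_def)
    qed
  qed (rule i(1))
qed

section \<open>The tower\<close>

text \<open>
  The coordinates of \<open>\<chi>\<^sub>k\<^sub>-\<^sub>1\<close> that vanish on the centre of the \<open>k\<close>-th blow-up.
\<close>

definition blowup_indices :: "nat \<Rightarrow> 'n::{finite,linorder} set" where
  "blowup_indices k = (if k = 1 then UNIV else {i. pos i = 1 \<or> k \<le> pos i})"

lemma sigma_coords_eq:
  fixes w :: "('n::{finite,linorder}) cvec"
  assumes k: "1 \<le> k" "k \<le> CARD('n)"
  shows "sigma_coords k w = blowup_coords (blowup_indices k) (ix k) w"
proof -
  have "sigma_coords k w $ i = blowup_coords (blowup_indices k) (ix k) w $ i" for i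
  proof -
    obtain j where j: "1 \<le> j" "j \<le> CARD('n)" "i = ix j" by (rule ix_cases)
    have "pos i = j" using j by (simp add: pos_ix)
    moreover have "i = ix k \<longleftrightarrow> j = k" using j k by (simp add: ix_eq_iff)
    ultimately show ?thesis using k by (auto simp: sigma_coords_def blowup_coords_def blowup_indices_def)
  qed
  then show ?thesis by (simp add: vec_eq_iff)
qed

lemma towerD:
  fixes B :: "('a, 'n::{finite,linorder}) tower"
  assumes "blowup_tower B"
  shows "is_blowup affine_space {0} (Mfd B 1) (sigma1 B)"
    "trivializes (Mfd B 1) (sigma1 B) (UNIV, id) UNIV (triv1 B)"
    "1 \<le> k \<Longrightarrow> k < CARD('n) \<Longrightarrow> is_blowup (Mfd B k) (centre B k) (Mfd B (Suc k)) (sigma B (Suc k))"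
    "1 \<le> k \<Longrightarrow> k \<le> CARD('n) \<Longrightarrow> is_chart (Mfd B k) (chi B k)"
    "1 \<le> k \<Longrightarrow> k \<le> CARD('n) \<Longrightarrow> snd (chi B k) ` fst (chi B k) = UNIV"
    "p \<in> fst (chi B 1) \<Longrightarrow> sigma1 B p = sigma_coords 1 (snd (chi B 1) p)"
    "1 \<le> k \<Longrightarrow> k < CARD('n) \<Longrightarrow> p \<in> fst (chi B (Suc k)) \<Longrightarrow> sigma B (Suc k) p \<in> fst (chi B k) \<and>
        snd (chi B k) (sigma B (Suc k) p) = sigma_coords (Suc k) (snd (chi B (Suc k)) p)"
proof -
  note T = assms[unfolded blowup_tower_def]
  show "is_blowup affine_space {0} (Mfd B 1) (sigma1 B)" using T by blast
  show "trivializes (Mfd B 1) (sigma1 B) (UNIV, id) UNIV (triv1 B)" using T by blast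
  show "is_blowup (Mfd B k) (centre B k) (Mfd B (Suc k)) (sigma B (Suc k))" if "1 \<le> k" "k < CARD('n)"
    using T[THEN conjunct2, THEN conjunct2, THEN conjunct1, rule_format, of "Suc k"] that by simp
  show "is_chart (Mfd B k) (chi B k)" "snd (chi B k) ` fst (chi B k) = UNIV" if "1 \<le> k" "k \<le> CARD('n)"
    using T[THEN conjunct2, THEN conjunct2, THEN conjunct2, THEN conjunct1, rule_format, of k] that by simp_all
  show "sigma1 B p = sigma_coords 1 (snd (chi B 1) p)" if "p \<in> fst (chi B 1)"
    using T that by blast
  show "sigma B (Suc k) p \<in> fst (chi B k) \<and>
        snd (chi B k) (sigma B (Suc k) p) = sigma_coords (Suc k) (snd (chi B (Suc k)) p)"
    if "1 \<le> k" "k < CARD('n)" "p \<in> fst (chi B (Suc k))"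
    using T[THEN conjunct2, THEN conjunct2, THEN conjunct2, THEN conjunct2, THEN conjunct2, rule_format, of "Suc k" p] that
    by simp
qed

lemma Hausdorff_Mfd:
  fixes B :: "('a, 'n::{finite,linorder}) tower"
  assumes B: "blowup_tower B" and k: "1 \<le> k" "k \<le> CARD('n)"
  shows "Hausdorff_space (mtop (Mfd B k))"
proof -
  have "complex_manifold (Mfd B k)"
  proof (cases "k = 1")
    case True
    then show ?thesis using towerD(1)[OF B] by (simp add: is_blowup_def)
  next
    case False
    then show ?thesis using towerD(3)[OF B, of "k - 1"] k by (simp add: is_blowup_def)
  qed
  then show ?thesis by (simp add: complex_manifold_def)
qed

lemma base_pt_chart:
  fixes B :: "('a, 'n::{finite,linorder}) tower"
  assumes B: "blowup_tower B" and k: "1 \<le> k" "k \<le> CARD('n)"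
  shows "base_pt B k \<in> fst (chi B k)" "snd (chi B k) (base_pt B k) = 0"
  unfolding base_pt_def using towerD(5)[OF B k] by (simp_all add: chart_inv_mem chart_inv_right)

lemma proj_Suc: "1 \<le> k \<Longrightarrow> proj B (Suc k) p = proj B k (sigma B (Suc k) p)"
  by (cases k) simp_all

lemma affine_space_simps: "mtop affine_space = euclidean" "points affine_space = UNIV"
  by (simp_all add: affine_space_def)

lemma proj_continuous:
  fixes B :: "('a, 'n::{finite,linorder}) tower"
  assumes B: "blowup_tower B" and k: "1 \<le> k" "k \<le> CARD('n)"
  shows "continuous_map (mtop (Mfd B k)) euclidean (proj B k)"
  using k
proof (induction k rule: dec_induct)
  case base
  then show ?case using blowup_continuous[OF towerD(1)[OF B]] by (simp add: affine_space_simps)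
next
  case (step k)
  have "continuous_map (mtop (Mfd B (Suc k))) (mtop (Mfd B k)) (sigma B (Suc k))"
    by (rule blowup_continuous[OF towerD(3)[OF B]]) (use step in auto)
  from continuous_map_compose[OF this step.IH]
  have "continuous_map (mtop (Mfd B (Suc k))) euclidean (proj B k \<circ> sigma B (Suc k))" using step by simp
  moreover have "proj B (Suc k) = proj B k \<circ> sigma B (Suc k)" using proj_Suc step by fastforce
  ultimately show ?case by (simp only:)
qed

text \<open>
  The relation passes from \<open>\<chi>\<^sub>k\<close> to \<open>\<chi>\<^sub>k\<^sub>+\<^sub>1\<close> because only the coordinates \<open>1\<close> and \<open>j > k + 1\<close> pick up the
  factor \<open>w\<^sub>k\<^sub>+\<^sub>1\<close>, which is also the new factor of \<open>z\<^sub>k\<^sub>+\<^sub>1\<close>.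
\<close>

lemma proj_chart:
  fixes B :: "('a, 'n::{finite,linorder}) tower"
  assumes B: "blowup_tower B" and k: "1 \<le> k" "k \<le> CARD('n)" and p: "p \<in> fst (chi B k)"
  shows "chart_relation k (snd (chi B k) p) (proj B k p)"
    "proj B k p $ ix 1 = (\<Prod>j\<in>{1..k}. snd (chi B k) p $ ix j)"
proof -
  have "\<forall>p. p \<in> fst (chi B k) \<longrightarrow> chart_relation k (snd (chi B k) p) (proj B k p) \<and>
    proj B k p $ ix 1 = (\<Prod>j\<in>{1..k}. snd (chi B k) p $ ix j)"
    using k
  proof (induction k rule: dec_induct)
    case base
    show ?case
    proof (intro allI impI)
      fix p assume p: "p \<in> fst (chi B 1)"
      define w where "w = snd (chi B 1) p"
      have z: "proj B 1 p = sigma_coords 1 w" using towerD(6)[OF B p] by (simp add: w_def)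
      have z1: "sigma_coords 1 w $ ix 1 = w $ ix 1"
        using base by (simp add: sigma_coords_def pos_ix)
      have zj: "sigma_coords 1 w $ ix j = w $ ix 1 * w $ ix j" if "1 < j" "j \<le> CARD('n)" for j
        using that by (simp add: sigma_coords_def pos_ix)
      show "chart_relation 1 (snd (chi B 1) p) (proj B 1 p) \<and>
          proj B 1 p $ ix 1 = (\<Prod>j\<in>{1..1}. snd (chi B 1) p $ ix j)"
        unfolding z w_def[symmetric] chart_relation_def using z1 zj by (auto simp: power2_eq_square)
    qed
  next
    case (step k)
    show ?case
    proof (intro allI impI)
      fix p assume p: "p \<in> fst (chi B (Suc k))"
      let ?K = "Suc k"
      define w where "w = snd (chi B ?K) p"
      define q where "q = sigma B ?K p"
      define v where "v = snd (chi B k) q"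
      define z where "z = proj B ?K p"
      have k: "1 \<le> k" "k < CARD('n)" using step by auto
      have q: "q \<in> fst (chi B k)" and v: "v = sigma_coords ?K w"
        using towerD(7)[OF B k p] by (simp_all add: q_def v_def w_def)
      have z: "z = proj B k q" using proj_Suc[OF k(1)] by (simp add: z_def q_def)
      have IH: "chart_relation k v z" "z $ ix 1 = (\<Prod>j\<in>{1..k}. v $ ix j)"
        using step q k by (simp_all add: z v_def)
      have vj: "v $ ix j = (if j = 1 \<or> ?K < j then w $ ix ?K * w $ ix j else w $ ix j)"
        if "1 \<le> j" "j \<le> CARD('n)" for j
        using that k by (simp add: v sigma_coords_def pos_ix)
      have r1: "(z $ ix 1)\<^sup>2 = v $ ix 1 * z $ ix k"
        and r2: "\<And>j. 2 \<le> j \<Longrightarrow> j \<le> k \<Longrightarrow> z $ ix j = v $ ix j * z $ ix (j - 1)"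
        and r3: "\<And>j. k < j \<Longrightarrow> j \<le> CARD('n) \<Longrightarrow> z $ ix j = v $ ix j * z $ ix k"
        using IH(1) unfolding chart_relation_def by blast+
      have zK: "z $ ix ?K = w $ ix ?K * z $ ix k" using r3[of ?K] vj[of ?K] k by simp
      have "(z $ ix 1)\<^sup>2 = w $ ix 1 * z $ ix ?K" using r1 vj[of 1] k zK by simp
      moreover have "z $ ix j = w $ ix j * z $ ix (j - 1)" if "2 \<le> j" "j \<le> ?K" for j
      proof (cases "j = ?K")
        case True
        then show ?thesis using zK by simp
      next
        case False
        then show ?thesis using r2[of j] vj[of j] that k by simp
      qed
      moreover have "z $ ix j = w $ ix j * z $ ix ?K" if "?K < j" "j \<le> CARD('n)" for j
        using r3[of j] vj[of j] that zK by simp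
      ultimately have rel: "chart_relation ?K w z" unfolding chart_relation_def by blast
      have "(\<Prod>j\<in>{1..k}. v $ ix j) = v $ ix 1 * (\<Prod>j\<in>{2..k}. v $ ix j)"
        using k by (simp add: prod.atLeast_Suc_atMost numeral_2_eq_2)
      also have "(\<Prod>j\<in>{2..k}. v $ ix j) = (\<Prod>j\<in>{2..k}. w $ ix j)"
        using vj k by (intro prod.cong) auto
      also have "v $ ix 1 * \<dots> = w $ ix ?K * (w $ ix 1 * (\<Prod>j\<in>{2..k}. w $ ix j))"
        using vj[of 1] k by simp
      also have "w $ ix 1 * (\<Prod>j\<in>{2..k}. w $ ix j) = (\<Prod>j\<in>{1..k}. w $ ix j)"
        using k by (simp add: prod.atLeast_Suc_atMost numeral_2_eq_2)
      also have "w $ ix ?K * \<dots> = (\<Prod>j\<in>{1..?K}. w $ ix j)" by (simp add: mult.commute)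
      finally have "z $ ix 1 = (\<Prod>j\<in>{1..?K}. w $ ix j)" using IH(2) by simp
      with rel show "chart_relation ?K (snd (chi B ?K) p) (proj B ?K p) \<and>
          proj B ?K p $ ix 1 = (\<Prod>j\<in>{1..?K}. snd (chi B ?K) p $ ix j)"
        by (simp add: w_def z_def)
    qed
  qed
  then show "chart_relation k (snd (chi B k) p) (proj B k p)"
    "proj B k p $ ix 1 = (\<Prod>j\<in>{1..k}. snd (chi B k) p $ ix j)"
    using p by blast+
qed

lemma proper_transform_Suc:
  "1 \<le> k \<Longrightarrow> proper_transform B (Suc k) j =
     mtop (Mfd B (Suc k)) closure_of
       {p \<in> points (Mfd B (Suc k)). sigma B (Suc k) p \<in> proper_transform B k j - centre B k}"
  by (cases k) (simp_all add: centre_def)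

text \<open>
  A closure cannot leave the closed set \<open>\<pi>\<^sub>k\<^sup>-\<^sup>1(O)\<close>.
\<close>

lemma proper_transform_over_origin:
  fixes B :: "('a, 'n::{finite,linorder}) tower"
  assumes B: "blowup_tower B" and k: "1 \<le> k" "k \<le> CARD('n)"
  shows "proper_transform B k j \<subseteq> {p \<in> points (Mfd B k). proj B k p = 0}"
  using k
proof (induction k rule: dec_induct)
  case base
  then show ?case by (auto simp: lin_subspace_def)
next
  case (step k)
  have closed: "closedin (mtop (Mfd B (Suc k))) {p \<in> points (Mfd B (Suc k)). proj B (Suc k) p \<in> {0}}"
    using proj_continuous[OF B, of "Suc k"] step by (intro closedin_continuous_map_preimage) auto
  have sub: "{p \<in> points (Mfd B (Suc k)). sigma B (Suc k) p \<in> proper_transform B k j - centre B k}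
      \<subseteq> {p \<in> points (Mfd B (Suc k)). proj B (Suc k) p \<in> {0}}"
    using step proj_Suc[of k B] by auto
  show ?case unfolding proper_transform_Suc[OF step(1)]
    using closure_of_minimal[OF sub closed] by simp
qed

text \<open>
  Each blow-down map is bijective outside its centre, and all centres lie over the origin.
\<close>

lemma proj_bij:
  fixes B :: "('a, 'n::{finite,linorder}) tower"
  assumes B: "blowup_tower B" and k: "1 \<le> k" "k \<le> CARD('n)"
  shows "bij_betw (proj B k) {p \<in> points (Mfd B k). proj B k p \<noteq> 0} (- {0})"
  using k
proof (induction k rule: dec_induct)
  case base
  have "bij_betw (sigma1 B) {p \<in> points (Mfd B 1). sigma1 B p \<notin> {0}} (points affine_space - {0})"
    using towerD(1)[OF B] by (simp add: is_blowup_def)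
  then show ?case by (simp add: affine_space_simps Compl_eq_Diff_UNIV)
next
  case (step k)
  let ?K = "Suc k"
  have k: "1 \<le> k" "k < CARD('n)" using step by auto
  have b: "is_blowup (Mfd B k) (centre B k) (Mfd B ?K) (sigma B ?K)" by (rule towerD(3)[OF B k])
  have bij: "bij_betw (sigma B ?K) {p \<in> points (Mfd B ?K). sigma B ?K p \<notin> centre B k} (points (Mfd B k) - centre B k)"
    and img: "sigma B ?K ` points (Mfd B ?K) \<subseteq> points (Mfd B k)"
    using b by (simp_all add: is_blowup_def)
  have cen: "centre B k \<subseteq> {p \<in> points (Mfd B k). proj B k p = 0}"
    unfolding centre_def using proper_transform_over_origin[OF B] k by auto
  have "bij_betw (sigma B ?K) {p \<in> points (Mfd B ?K). proj B ?K p \<noteq> 0} {q \<in> points (Mfd B k). proj B k q \<noteq> 0}"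
  proof (rule bij_betw_subset[OF bij])
    show "{p \<in> points (Mfd B ?K). proj B ?K p \<noteq> 0} \<subseteq> {p \<in> points (Mfd B ?K). sigma B ?K p \<notin> centre B k}"
      using cen by (auto simp: proj_Suc[OF k(1)])
    show "sigma B ?K ` {p \<in> points (Mfd B ?K). proj B ?K p \<noteq> 0} = {q \<in> points (Mfd B k). proj B k q \<noteq> 0}"
    proof
      show "sigma B ?K ` {p \<in> points (Mfd B ?K). proj B ?K p \<noteq> 0} \<subseteq> {q \<in> points (Mfd B k). proj B k q \<noteq> 0}"
        using img by (auto simp: proj_Suc[OF k(1)])
      show "{q \<in> points (Mfd B k). proj B k q \<noteq> 0} \<subseteq> sigma B ?K ` {p \<in> points (Mfd B ?K). proj B ?K p \<noteq> 0}"
      proof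
        fix q assume q: "q \<in> {q \<in> points (Mfd B k). proj B k q \<noteq> 0}"
        then have "q \<in> points (Mfd B k) - centre B k" using cen by auto
        then obtain p where "p \<in> points (Mfd B ?K)" "q = sigma B ?K p"
          using bij unfolding bij_betw_def by blast
        then show "q \<in> sigma B ?K ` {p \<in> points (Mfd B ?K). proj B ?K p \<noteq> 0}"
          using q by (auto simp: proj_Suc[OF k(1)])
      qed
    qed
  qed
  from bij_betw_trans[OF this step.IH]
  have "bij_betw (proj B k \<circ> sigma B ?K) {p \<in> points (Mfd B ?K). proj B ?K p \<noteq> 0} (- {0})" using k by simp
  moreover have "proj B ?K = proj B k \<circ> sigma B ?K" using proj_Suc[OF k(1)] by fastforce
  ultimately show ?case by (simp only:)
qed

lemma proj_inv_props:
  fixes B :: "('a, 'n::{finite,linorder}) tower"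
  assumes B: "blowup_tower B" and k: "1 \<le> k" "k \<le> CARD('n)" and z: "z \<noteq> 0"
  shows "proj_inv B k z \<in> points (Mfd B k)" "proj B k (proj_inv B k z) = z"
proof -
  have img: "z \<in> proj B k ` {p \<in> points (Mfd B k). proj B k p \<noteq> 0}"
    using proj_bij[OF B k] z by (simp add: bij_betw_def)
  show "proj_inv B k z \<in> points (Mfd B k)" "proj B k (proj_inv B k z) = z"
    using inv_into_into[OF img] f_inv_into_f[OF img] by (simp_all add: proj_inv_def)
qed

lemma sigma_proj_inv:
  fixes B :: "('a, 'n::{finite,linorder}) tower"
  assumes B: "blowup_tower B" and k: "1 \<le> k" "k < CARD('n)" and z: "z \<noteq> 0"
  shows "sigma B (Suc k) (proj_inv B (Suc k) z) = proj_inv B k z"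
proof -
  have inj: "inj_on (proj B k) {p \<in> points (Mfd B k). proj B k p \<noteq> 0}"
    using proj_bij[OF B k(1)] k by (simp add: bij_betw_def)
  have img: "sigma B (Suc k) ` points (Mfd B (Suc k)) \<subseteq> points (Mfd B k)"
    using towerD(3)[OF B k] by (simp add: is_blowup_def)
  have a: "proj_inv B (Suc k) z \<in> points (Mfd B (Suc k))" "proj B (Suc k) (proj_inv B (Suc k) z) = z"
    using proj_inv_props[OF B _ _ z, of "Suc k"] k by simp_all
  have b: "proj_inv B k z \<in> points (Mfd B k)" "proj B k (proj_inv B k z) = z"
    using proj_inv_props[OF B _ _ z, of k] k by simp_all
  show ?thesis
    by (rule inj_onD[OF inj]) (use a b img z proj_Suc[OF k(1), of B] in auto)
qed

lemma line_subset_span_iff: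
  fixes u :: "('n::{finite,linorder}) cvec"
  shows "line u \<subseteq> vec.span {axis (ix l) 1 | l. 1 \<le> l \<and> l \<le> j} \<longleftrightarrow> (\<forall>i. j < pos i \<longrightarrow> u $ i = 0)"
proof
  assume sub: "line u \<subseteq> vec.span {axis (ix l) 1 | l. 1 \<le> l \<and> l \<le> j}"
  have "vec.span {axis (ix l) 1 | l. 1 \<le> l \<and> l \<le> j} \<subseteq> {x :: 'n cvec. \<forall>i. j < pos i \<longrightarrow> x $ i = 0}"
  proof (rule vec.span_minimal)
    show "{axis (ix l) 1 | l. 1 \<le> l \<and> l \<le> j} \<subseteq> {x :: 'n cvec. \<forall>i. j < pos i \<longrightarrow> x $ i = 0}"
    proof safe
      fix l and i :: 'n assume l: "1 \<le> l" "l \<le> j" and i: "j < pos i"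
      obtain k where k: "1 \<le> k" "k \<le> CARD('n)" "i = ix k" by (rule ix_cases)
      then have "i \<noteq> ix l" using l i by (auto simp: pos_ix ix_eq_iff)
      then show "(axis (ix l) 1 :: 'n cvec) $ i = 0" by (simp add: axis_def)
    qed
    show "vec.subspace {x :: 'n cvec. \<forall>i. j < pos i \<longrightarrow> x $ i = 0}"
      by (simp add: vec.subspace_def)
  qed
  then show "\<forall>i. j < pos i \<longrightarrow> u $ i = 0" using sub self_mem_line by blast
next
  assume z: "\<forall>i. j < pos i \<longrightarrow> u $ i = 0"
  have "u = (\<Sum>i\<in>UNIV. u $ i *s axis i 1)" by (simp add: basis_expansion)
  also have "\<dots> = (\<Sum>i\<in>{i. pos i \<le> j}. u $ i *s axis i 1)"
    by (rule sum.mono_neutral_right) (use z in auto)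
  also have "\<dots> \<in> vec.span {axis (ix l) 1 | l. 1 \<le> l \<and> l \<le> j}"
  proof (intro vec.span_sum vec.span_scale vec.span_base)
    fix i :: 'n assume i: "i \<in> {i. pos i \<le> j}"
    obtain k where k: "1 \<le> k" "k \<le> CARD('n)" "i = ix k" by (rule ix_cases)
    then show "(axis i 1 :: 'n cvec) \<in> {axis (ix l) 1 | l. 1 \<le> l \<and> l \<le> j}" using i by (auto simp: pos_ix)
  qed
  finally show "line u \<subseteq> vec.span {axis (ix l) 1 | l. 1 \<le> l \<and> l \<le> j}"
    unfolding line_def by (intro vec.span_minimal) (auto simp: vec.subspace_span)
qed

lemma first_chart_direction:
  fixes B :: "('a, 'n::{finite,linorder}) tower"
  assumes B: "blowup_tower B" and p: "p \<in> fst (chi B 1)"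
  shows "snd (triv1 B p) = line (blowup_dir UNIV (ix 1) (snd (chi B 1) p))"
proof (rule standard_chart_direction[OF towerD(2)[OF B] _ _ _ _ p])
  have n: "1 \<le> CARD('n)" by (simp add: Suc_le_eq card_gt_0_iff)
  show "is_chart (Mfd B 1) (chi B 1)" "snd (chi B 1) ` fst (chi B 1) = UNIV"
    using towerD(4,5)[OF B _ n] by simp_all
  show "sigma1 B q \<in> fst (UNIV, id) \<and> snd (UNIV, id) (sigma1 B q) = blowup_coords UNIV (ix 1) (snd (chi B 1) q)"
    if "q \<in> fst (chi B 1)" for q
    using towerD(6)[OF B that] sigma_coords_eq[of 1 "snd (chi B 1) q"] n by (simp add: blowup_indices_def)
qed simp

text \<open>
  In the chart \<open>\<chi>\<^sub>k\<^sub>+\<^sub>1\<close> the preimage of \<open>Y\<^sup>j - X\<^sup>k\<close> is the part \<open>w\<^sub>k\<^sub>+\<^sub>1 \<noteq> 0\<close> of the subspace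
  \<open>w\<^sub>1 = 0\<close>, \<open>w\<^sub>i = 0\<close> for \<open>i > j\<close>, and this part is dense in the subspace.
\<close>

lemma proper_transform_chart:
  fixes B :: "('a, 'n::{finite,linorder}) tower"
  assumes B: "blowup_tower B" and k: "1 \<le> k" "k \<le> j" "j \<le> CARD('n)" and p: "p \<in> fst (chi B k)"
  shows "p \<in> proper_transform B k j \<longleftrightarrow> snd (chi B k) p $ ix 1 = 0 \<and> (\<forall>i. j < pos i \<longrightarrow> snd (chi B k) p $ i = 0)"
proof -
  have "k \<le> CARD('n) \<Longrightarrow> \<forall>j p. k \<le> j \<longrightarrow> j \<le> CARD('n) \<longrightarrow> p \<in> fst (chi B k) \<longrightarrow> (p \<in> proper_transform B k j \<longleftrightarrow>
      snd (chi B k) p $ ix 1 = 0 \<and> (\<forall>i. j < pos i \<longrightarrow> snd (chi B k) p $ i = 0))"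
    using k(1)
  proof (induction k rule: dec_induct)
    case base
    show ?case
    proof (intro allI impI)
      fix j p assume j: "1 \<le> j" "j \<le> CARD('n)" and p: "p \<in> fst (chi B 1)"
      let ?w = "snd (chi B 1) p"
      have n: "1 \<le> CARD('n)" using j by simp
      have pp: "p \<in> points (Mfd B 1)" using chart_subset[OF towerD(4)[OF B _ n]] p by auto
      have s: "sigma1 B p = blowup_coords UNIV (ix 1) ?w"
        using towerD(6)[OF B p] sigma_coords_eq[of 1 ?w] n by (simp add: blowup_indices_def)
      have s0: "sigma1 B p = 0 \<longleftrightarrow> ?w $ ix 1 = 0"
        unfolding s by (auto simp: blowup_coords_def vec_eq_iff)
      have dir: "(\<forall>i. j < pos i \<longrightarrow> blowup_dir UNIV (ix 1) ?w $ i = 0) \<longleftrightarrow> (\<forall>i. j < pos i \<longrightarrow> ?w $ i = 0)"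
      proof -
        have "blowup_dir UNIV (ix 1) ?w $ i = ?w $ i" if "j < pos i" for i
        proof -
          have "i \<noteq> ix 1" using that j n pos_ix[of 1, where 'n = 'n] by auto
          then show ?thesis by (simp add: blowup_dir_def)
        qed
        then show ?thesis by auto
      qed
      have "p \<in> proper_transform B 1 j \<longleftrightarrow> p \<in> lin_subspace B j" by simp
      also have "\<dots> \<longleftrightarrow> sigma1 B p = 0 \<and> (\<forall>i. j < pos i \<longrightarrow> blowup_dir UNIV (ix 1) ?w $ i = 0)"
        unfolding lin_subspace_def mem_Collect_eq first_chart_direction[OF B p] line_subset_span_iff
        using pp by blast
      finally show "p \<in> proper_transform B 1 j \<longleftrightarrow> ?w $ ix 1 = 0 \<and> (\<forall>i. j < pos i \<longrightarrow> ?w $ i = 0)"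
        using s0 dir by simp
    qed
  next
    case (step k)
    let ?K = "Suc k"
    let ?c = "chi B ?K"
    have k: "1 \<le> k" "k < CARD('n)" using step.hyps(1) step.prems by auto
    then have kn: "k \<le> CARD('n)" by simp
    have K: "1 \<le> ?K" "?K \<le> CARD('n)" using k by auto
    have c: "is_chart (Mfd B ?K) ?c" "snd ?c ` fst ?c = UNIV" using towerD(4,5)[OF B K] by simp_all
    show ?case
    proof (intro allI impI)
      fix j p assume j: "?K \<le> j" "j \<le> CARD('n)" and p: "p \<in> fst ?c"
      define S where "S = {p \<in> points (Mfd B ?K). sigma B ?K p \<in> proper_transform B k j - centre B k}"
      define Z where "Z = {w :: 'n cvec. w $ ix 1 = 0 \<and> (\<forall>i. j < pos i \<longrightarrow> w $ i = 0)}"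
      have mem: "q \<in> S \<longleftrightarrow> snd ?c q $ ix ?K \<noteq> 0 \<and> snd ?c q \<in> Z" if q: "q \<in> fst ?c" for q
      proof -
        let ?w = "snd ?c q"
        have sq: "sigma B ?K q \<in> fst (chi B k)" "snd (chi B k) (sigma B ?K q) = sigma_coords ?K ?w"
          using towerD(7)[OF B k q] by simp_all
        have pt: "sigma B ?K q \<in> proper_transform B k h \<longleftrightarrow>
            sigma_coords ?K ?w $ ix 1 = 0 \<and> (\<forall>i. h < pos i \<longrightarrow> sigma_coords ?K ?w $ i = 0)"
          if "k \<le> h" "h \<le> CARD('n)" for h
          using step.IH[rule_format, OF kn that sq(1)] unfolding sq(2) .
        have sc: "sigma_coords ?K ?w $ i = (if pos i = 1 \<or> ?K < pos i then ?w $ ix ?K * ?w $ i else ?w $ i)" for i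
          using k by (simp add: sigma_coords_def)
        have p1: "pos (ix 1 :: 'n) = 1" "pos (ix ?K :: 'n) = ?K" using k by (simp_all add: pos_ix)
        have A: "sigma B ?K q \<in> proper_transform B k j \<longleftrightarrow> ?w $ ix ?K = 0 \<or> ?w \<in> Z"
        proof -
          have kj: "k \<le> j" using j by simp
          have "sigma_coords ?K ?w $ i = ?w $ ix ?K * ?w $ i" if "j < pos i" for i
            using that j by (simp add: sc)
          then have "(\<forall>i. j < pos i \<longrightarrow> sigma_coords ?K ?w $ i = 0) \<longleftrightarrow>
              (\<forall>i. j < pos i \<longrightarrow> ?w $ ix ?K = 0 \<or> ?w $ i = 0)" by simp
          moreover have "sigma_coords ?K ?w $ ix 1 = 0 \<longleftrightarrow> ?w $ ix ?K = 0 \<or> ?w $ ix 1 = 0"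
            using p1 by (simp add: sc)
          ultimately show ?thesis unfolding pt[OF kj j(2)] Z_def by blast
        qed
        have C: "sigma B ?K q \<in> centre B k \<longleftrightarrow> ?w $ ix ?K = 0"
        proof
          assume "sigma B ?K q \<in> centre B k"
          then have "sigma_coords ?K ?w $ ix ?K = 0" using pt[of k] k p1 by (simp add: centre_def)
          then show "?w $ ix ?K = 0" using p1 k by (simp add: sc)
        next
          assume w0: "?w $ ix ?K = 0"
          have "sigma_coords ?K ?w $ i = 0" if "k < pos i" for i
          proof (cases "pos i = ?K")
            case True
            then have "i = ix ?K" by (metis ix_pos)
            then show ?thesis using w0 p1 k by (simp add: sc)
          next
            case False
            then show ?thesis using w0 that by (simp add: sc)
          qed
          then show "sigma B ?K q \<in> centre B k" using pt[of k] k p1 w0 by (simp add: centre_def sc)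
        qed
        have "q \<in> points (Mfd B ?K)" using chart_subset[OF c(1)] q by blast
        then show ?thesis using A C by (auto simp: S_def)
      qed
      have "p \<in> mtop (Mfd B ?K) closure_of S \<longleftrightarrow> snd ?c p \<in> Z"
      proof
        assume cl: "p \<in> mtop (Mfd B ?K) closure_of S"
        show "snd ?c p \<in> Z"
        proof (rule ccontr)
          assume nZ: "snd ?c p \<notin> Z"
          have "closed Z"
          proof -
            have eq: "Z = {w. w $ ix 1 = 0} \<inter> (\<Inter>i\<in>{i. j < pos i}. {w. w $ i = 0})" by (auto simp: Z_def)
            show ?thesis unfolding eq
              by (intro closed_Int closed_INT ballI closed_Collect_eq continuous_intros)
          qed
          then have "openin (subtopology (mtop (Mfd B ?K)) (fst ?c))
              {q \<in> topspace (subtopology (mtop (Mfd B ?K)) (fst ?c)). snd ?c q \<in> - Z}"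
            by (intro openin_continuous_map_preimage[OF chart_continuous[OF c(1)]]) auto
          then have "openin (mtop (Mfd B ?K))
              {q \<in> topspace (subtopology (mtop (Mfd B ?K)) (fst ?c)). snd ?c q \<in> - Z}"
            using is_chartD(1)[OF c(1)] by (rule openin_trans_full)
          moreover have "topspace (subtopology (mtop (Mfd B ?K)) (fst ?c)) = fst ?c"
            by (rule topspace_subtopology_subset[OF chart_subset[OF c(1)]])
          ultimately have "openin (mtop (Mfd B ?K)) {q \<in> fst ?c. snd ?c q \<in> - Z}" by (simp only:)
          moreover have "p \<in> {q \<in> fst ?c. snd ?c q \<in> - Z}" using p nZ by simp
          ultimately obtain q where q: "q \<in> S" "q \<in> {q \<in> fst ?c. snd ?c q \<in> - Z}"
            using cl[unfolded in_closure_of, THEN conjunct2, rule_format] by meson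
          then have "q \<in> fst ?c" "snd ?c q \<notin> Z" by simp_all
          then show False using mem[of q] q(1) by simp
        qed
      next
        assume pZ: "snd ?c p \<in> Z"
        define \<epsilon> where "\<epsilon> m = (of_real (inverse (real (Suc m))) :: complex)" for m
        have \<epsilon>: "\<epsilon> \<longlonglongrightarrow> 0" unfolding \<epsilon>_def
          using tendsto_of_real[OF LIMSEQ_inverse_real_of_nat, where 'a = complex] by simp
        have \<epsilon>0: "\<epsilon> m \<noteq> 0" for m by (simp add: \<epsilon>_def del: of_nat_Suc)
        \<comment> \<open>A point with \<open>w\<^sub>k\<^sub>+\<^sub>1 = 0\<close> is approached from inside \<open>S\<close> along the \<open>(k+1)\<close>-st axis.\<close>
        define y where "y m = (if snd ?c p $ ix ?K = 0 then snd ?c p + axis (ix ?K) (\<epsilon> m) else snd ?c p)" for m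
        have y: "y \<longlonglongrightarrow> snd ?c p"
        proof (rule vec_tendstoI)
          fix i
          have "(\<lambda>m. snd ?c p $ i + (if snd ?c p $ ix ?K = 0 \<and> i = ix ?K then \<epsilon> m else 0)) \<longlonglongrightarrow> snd ?c p $ i + 0"
            by (intro tendsto_intros) (use \<epsilon> in \<open>cases "snd ?c p $ ix ?K = 0 \<and> i = ix ?K"; auto\<close>)
          moreover have "y m $ i = snd ?c p $ i + (if snd ?c p $ ix ?K = 0 \<and> i = ix ?K then \<epsilon> m else 0)" for m
            by (simp add: y_def axis_def)
          ultimately show "(\<lambda>m. y m $ i) \<longlonglongrightarrow> snd ?c p $ i" by simp
        qed
        define q where "q m = chart_inv ?c (y m)" for m
        have q: "q m \<in> fst ?c" "snd ?c (q m) = y m" for m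
          unfolding q_def using c(2) by (simp_all add: chart_inv_mem chart_inv_right)
        have lim: "limitin (mtop (Mfd B ?K)) q p sequentially"
          by (rule limitin_chartI[OF c(1) _ _ p]) (use q y in simp_all)
        have "y m \<in> Z" for m
        proof -
          have "ix ?K \<noteq> (ix 1 :: 'n)" using k by (simp add: ix_eq_iff)
          moreover have "i \<noteq> ix ?K" if "j < pos i" for i :: 'n
            using that j K pos_ix[of ?K, where 'n = 'n] by auto
          ultimately show ?thesis using pZ by (auto simp: Z_def y_def axis_def)
        qed
        moreover have "y m $ ix ?K \<noteq> 0" for m using \<epsilon>0 by (simp add: y_def axis_def)
        ultimately have "q m \<in> S" for m using mem[OF q(1)] q(2) by simp
        then have "\<forall>\<^sub>F m in sequentially. q m \<in> mtop (Mfd B ?K) closure_of S"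
          by (intro always_eventually allI subsetD[OF closure_of_subset]) (auto simp: S_def)
        then show "p \<in> mtop (Mfd B ?K) closure_of S"
          by (rule limitin_closedin[OF lim closedin_closure_of _ sequentially_bot])
      qed
      then show "p \<in> proper_transform B ?K j \<longleftrightarrow> snd ?c p $ ix 1 = 0 \<and> (\<forall>i. j < pos i \<longrightarrow> snd ?c p $ i = 0)"
        unfolding proper_transform_Suc[OF k(1)] S_def Z_def by simp
    qed
  qed
  from this[rule_format, OF order_trans[OF k(2,3)] k(2,3) p] show ?thesis .
qed

lemma adapted_centre:
  fixes B :: "('a, 'n::{finite,linorder}) tower"
  assumes B: "blowup_tower B" and k: "1 \<le> k" "k < CARD('n)"
  shows "adapted (centre B k) (chi B k) (blowup_indices (Suc k))"
proof -
  let ?c = "chi B k"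
  have img: "snd ?c ` fst ?c = UNIV" using towerD(5)[OF B k(1)] k by simp
  have one: "pos i = Suc 0 \<longleftrightarrow> i = ix (Suc 0)" for i :: 'n
  proof
    assume "pos i = Suc 0"
    then show "i = ix (Suc 0)" using ix_pos[of i] by metis
  next
    assume "i = ix (Suc 0)"
    then show "pos i = Suc 0" using pos_ix[of 1, where 'n = 'n] k by simp
  qed
  have I: "i \<in> blowup_indices (Suc k) \<longleftrightarrow> i = ix 1 \<or> k < pos i" for i :: 'n
    using k one[of i] unfolding blowup_indices_def by (simp add: Suc_le_eq)
  have eq: "(\<forall>i\<in>blowup_indices (Suc k). w $ i = 0) \<longleftrightarrow> w $ ix 1 = 0 \<and> (\<forall>i. k < pos i \<longrightarrow> w $ i = 0)"
    for w :: "'n cvec"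
    unfolding Ball_def I by blast
  have kn: "k \<le> CARD('n)" using k by simp
  have mem: "p \<in> centre B k \<longleftrightarrow> (\<forall>i\<in>blowup_indices (Suc k). snd ?c p $ i = 0)" if "p \<in> fst ?c" for p
    unfolding eq centre_def by (rule proper_transform_chart[OF B k(1) order_refl kn that])
  have "snd ?c ` (fst ?c \<inter> centre B k) = {w. \<forall>i\<in>blowup_indices (Suc k). w $ i = 0}"
  proof
    show "snd ?c ` (fst ?c \<inter> centre B k) \<subseteq> {w. \<forall>i\<in>blowup_indices (Suc k). w $ i = 0}"
      using mem by blast
    show "{w. \<forall>i\<in>blowup_indices (Suc k). w $ i = 0} \<subseteq> snd ?c ` (fst ?c \<inter> centre B k)"
    proof
      fix w :: "'n cvec" assume w: "w \<in> {w. \<forall>i\<in>blowup_indices (Suc k). w $ i = 0}"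
      obtain p where p: "p \<in> fst ?c" "w = snd ?c p" using img by blast
      then have "p \<in> centre B k" using mem w by blast
      then show "w \<in> snd ?c ` (fst ?c \<inter> centre B k)" using p by blast
    qed
  qed
  moreover have "ix 1 \<in> (blowup_indices (Suc k) :: 'n set)" using I by blast
  ultimately show ?thesis unfolding adapted_def img by blast
qed

section \<open>Regular sequences\<close>

text \<open>Convergence in projective space is convergence of the affine coordinates.\<close>

lemma projective_limit_ratio:
  fixes s :: "nat \<Rightarrow> ('n::finite) cvec"
  assumes lim: "limitin proj_topology (\<lambda>m. line (s m)) (line v) sequentially"
    and nz: "\<forall>\<^sub>F m in sequentially. s m \<noteq> 0" and v: "v $ i \<noteq> 0"
  shows "\<forall>\<^sub>F m in sequentially. s m $ i \<noteq> 0" "(\<lambda>m. s m $ j / s m $ i) \<longlonglongrightarrow> v $ j / v $ i"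
proof -
  define D where "D e = {x :: 'n cvec. x $ i \<noteq> 0 \<and> norm (x $ j / x $ i - v $ j / v $ i) < e}" for e
  have ev: "\<forall>\<^sub>F m in sequentially. s m \<in> D e" if e: "e > 0" for e
  proof -
    define W where "W = line ` D e"
    have inD: "line x \<in> W \<longleftrightarrow> x \<in> D e" if "x \<noteq> 0" for x
    proof
      assume "line x \<in> W"
      then obtain y where y: "y \<in> D e" "line x = line y" by (auto simp: W_def)
      then obtain k where k: "x = k *s y" using self_mem_line[of x] by (auto simp: mem_line_iff)
      have "k \<noteq> 0" using k that by auto
      then show "x \<in> D e" using y(1) by (simp add: D_def k)
    qed (simp add: W_def)
    have D0: "x \<noteq> 0" if "x \<in> D e" for x using that by (auto simp: D_def)
    have oi: "open {x :: 'n cvec. x $ i \<noteq> 0}"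
      by (intro open_Collect_neq continuous_intros)
    have "continuous_on {x :: 'n cvec. x $ i \<noteq> 0} (\<lambda>x. norm (x $ j / x $ i - v $ j / v $ i))"
      by (intro continuous_intros) simp
    from continuous_open_preimage[OF this oi open_lessThan[of e]]
    have "open ({x :: 'n cvec. x $ i \<noteq> 0} \<inter> (\<lambda>x. norm (x $ j / x $ i - v $ j / v $ i)) -` {..<e})" .
    also have "{x :: 'n cvec. x $ i \<noteq> 0} \<inter> (\<lambda>x. norm (x $ j / x $ i - v $ j / v $ i)) -` {..<e} = D e"
      by (auto simp: D_def)
    finally have "open (D e)" .
    moreover have "{x. x \<noteq> 0 \<and> line x \<in> W} = D e" using inD D0 by blast
    moreover have "W \<subseteq> proj_space" using D0 by (auto simp: W_def proj_space_def)
    ultimately have "openin proj_topology W" by (simp add: openin_proj_topology)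
    moreover have "line v \<in> W" using v e by (auto simp: W_def D_def)
    ultimately have "\<forall>\<^sub>F m in sequentially. line (s m) \<in> W" using lim by (simp add: limitin_def)
    with nz show ?thesis by eventually_elim (use inD in blast)
  qed
  show "\<forall>\<^sub>F m in sequentially. s m $ i \<noteq> 0"
    using ev[OF zero_less_one] by eventually_elim (simp add: D_def)
  show "(\<lambda>m. s m $ j / s m $ i) \<longlonglongrightarrow> v $ j / v $ i"
  proof (rule tendstoI)
    fix e :: real assume "e > 0"
    from ev[OF this] show "\<forall>\<^sub>F m in sequentially. dist (s m $ j / s m $ i) (v $ j / v $ i) < e"
      by eventually_elim (simp add: D_def dist_norm)
  qed
qed

lemma projective_limit_line:
  fixes L :: "('n::finite) cvec set"
  assumes "limitin proj_topology f L F"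
  obtains v where "L = line v" "v \<noteq> 0"
proof -
  have "L \<in> topspace proj_topology" using assms by (rule limitin_topspace)
  then show ?thesis using that by (auto simp: topspace_proj_topology proj_space_def)
qed

lemma one_le_CARD: "1 \<le> CARD('n::finite)"
  by (simp add: Suc_le_eq card_gt_0_iff)

text \<open>
  At the first level the convergence of the lifts follows from that of the directions, by reading
  off the coordinates \<open>z\<^sub>1, z\<^sub>2/z\<^sub>1, \<dots>, z\<^sub>n/z\<^sub>1\<close>; at the later levels it is part of the definition.
\<close>

lemma second_kind_lift_tendsto:
  fixes B :: "('a, 'n::{finite,linorder}) tower"
  assumes B: "blowup_tower B" and k: "1 \<le> k" "k \<le> CARD('n)"
    and reg: "regular_second_kind B k z" and z: "\<And>m. z m \<noteq> 0" "z \<longlonglongrightarrow> 0"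
  shows "lift_tendsto B k z (base_pt B k)"
proof (cases "k = 1")
  case False
  then have "k = Suc (Suc (k - 2))" using k by simp
  then obtain r where r: "k = Suc (Suc r)" by blast
  show ?thesis using reg unfolding r by simp
next
  case True
  let ?e = "axis (ix 1) 1 :: 'n cvec"
  let ?t = "triv1 B"
  have reg1: "zero_regular_to z (line ?e)" using reg True by simp
  then have lim: "limitin proj_topology (\<lambda>m. line (z m)) (line ?e) sequentially"
    and nz: "\<forall>\<^sub>F m in sequentially. z m \<noteq> 0" by (simp_all add: zero_regular_to_def)
  note ratio = projective_limit_ratio[OF lim nz, of "ix 1"]
  have n1: "1 \<le> CARD('n)" by (rule one_le_CARD)
  note t = towerD(2)[OF B]
  \<comment> \<open>The global chart of \<open>\<complex>\<^sup>n\<close>, over which \<open>M\<^sup>1\<close> is the standard blow-up of the origin.\<close>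
  define c where "c = (UNIV :: 'n cvec set, id :: 'n cvec \<Rightarrow> 'n cvec)"
  have tc: "trivializes (Mfd B 1) (sigma1 B) c UNIV ?t" using t by (simp add: c_def)
  let ?D = "blowup_dom (Mfd B 1) (sigma1 B) c ?t (ix 1)"
  have chart: "is_chart (Mfd B 1) (?D, local_coords UNIV (ix 1) \<circ> ?t)"
    by (rule trivializes_chart[OF tc]) simp
  have q: "proj_inv B 1 (z m) \<in> points (Mfd B 1)" "sigma1 B (proj_inv B 1 (z m)) = z m" for m
    using proj_inv_props[OF B _ n1 z(1), of m] by simp_all
  have coords: "proj_inv B 1 (z m) \<in> ?D \<and> local_coords UNIV (ix 1) (?t (proj_inv B 1 (z m))) =
      (\<chi> j. if j = ix 1 then z m $ j else z m $ j / z m $ ix 1)" if "z m $ ix 1 \<noteq> 0" for m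
  proof -
    have m: "(z m, snd (?t (proj_inv B 1 (z m)))) \<in> local_blowup UNIV UNIV"
      "?t (proj_inv B 1 (z m)) = (z m, snd (?t (proj_inv B 1 (z m))))"
    proof -
      have "sigma1 B (proj_inv B 1 (z m)) \<in> fst c" by (simp add: c_def)
      note m = trivializes_mem[OF tc q(1) this, unfolded q(2)]
      show "(z m, snd (?t (proj_inv B 1 (z m)))) \<in> local_blowup UNIV UNIV"
        "?t (proj_inv B 1 (z m)) = (z m, snd (?t (proj_inv B 1 (z m))))"
        using m by (simp_all only: c_def fst_conv snd_conv id_apply image_id)
    qed
    define L where "L = snd (?t (proj_inv B 1 (z m)))"
    have zL: "z m \<in> L" using m(1) by (simp add: local_blowup_def L_def coord_proj_def)
    obtain v where v: "L = line v" using m(1) by (auto simp: local_blowup_def L_def proj_space_def)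
    have "L = line (z m)" unfolding v by (rule line_eqI) (use zL v z(1) in auto)
    also have "\<dots> = line ((1 / z m $ ix 1) *s z m)" using that by (intro line_scale[symmetric]) simp
    finally have L: "L = line ((1 / z m $ ix 1) *s z m)" .
    have "local_dom (ix 1) L" using zL that by (auto simp: local_dom_def)
    then have "proj_inv B 1 (z m) \<in> ?D" using q by (simp add: blowup_dom_def c_def L_def)
    moreover have "local_coords UNIV (ix 1) (z m, L) = (\<chi> j. if j = ix 1 then z m $ j else z m $ j / z m $ ix 1)"
      unfolding L using that by (subst local_coords_line) (simp_all add: vec_eq_iff)
    ultimately show ?thesis using m(2) by (simp add: L_def)
  qed
  have ev: "\<forall>\<^sub>F m in sequentially. z m $ ix 1 \<noteq> 0" by (rule ratio(1)) (simp add: axis_def)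
  have base: "base_pt B 1 \<in> fst (chi B 1)" "snd (chi B 1) (base_pt B 1) = 0"
    using base_pt_chart[OF B _ n1] by simp_all
  have bp: "base_pt B 1 \<in> points (Mfd B 1)"
    using chart_subset[OF towerD(4)[OF B _ n1]] base(1) by auto
  have bdir: "snd (?t (base_pt B 1)) = line ?e"
  proof -
    have "blowup_dir UNIV (ix 1) 0 = ?e" by (simp add: blowup_dir_def axis_def vec_eq_iff)
    then show ?thesis using first_chart_direction[OF B base(1)] base(2) by simp
  qed
  have b0: "sigma1 B (base_pt B 1) = 0"
    using towerD(6)[OF B base(1)] base(2) by (simp add: sigma_coords_def vec_eq_iff)
  have bD: "base_pt B 1 \<in> ?D"
  proof -
    have "local_dom (ix 1) (line ?e)"
      unfolding local_dom_def by (rule bexI[OF _ self_mem_line]) (simp add: axis_def)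
    then show ?thesis using bp unfolding blowup_dom_def c_def bdir[symmetric] by simp
  qed
  have bc: "local_coords UNIV (ix 1) (?t (base_pt B 1)) = 0"
  proof -
    have "?t (base_pt B 1) = (0, line ?e)"
    proof -
      have "sigma1 B (base_pt B 1) \<in> fst c" by (simp add: c_def)
      from trivializes_mem(2)[OF tc bp this] show ?thesis
        unfolding b0 bdir by (simp only: c_def snd_conv id_apply)
    qed
    then show ?thesis using local_coords_line[of ?e "ix 1" UNIV 0] by (simp add: axis_def vec_eq_iff)
  qed
  have "(\<lambda>m. (\<chi> j. if j = ix 1 then z m $ j else z m $ j / z m $ ix 1) :: 'n cvec) \<longlonglongrightarrow> 0"
  proof (rule vec_tendstoI)
    fix j
    have "(\<lambda>m. z m $ j) \<longlonglongrightarrow> 0" using tendsto_vec_nth[OF z(2), of j] by simp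
    moreover have "(\<lambda>m. z m $ j / z m $ ix 1) \<longlonglongrightarrow> 0" if "j \<noteq> ix 1"
      using ratio(2)[of j] that by (simp add: axis_def)
    ultimately show "(\<lambda>m. (\<chi> j. if j = ix 1 then z m $ j else z m $ j / z m $ ix 1) $ j) \<longlonglongrightarrow> (0 :: 'n cvec) $ j"
      by (cases "j = ix 1") simp_all
  qed
  moreover have "\<forall>\<^sub>F m in sequentially. (\<chi> j. if j = ix 1 then z m $ j else z m $ j / z m $ ix 1) =
      local_coords UNIV (ix 1) (?t (proj_inv B 1 (z m)))"
    using ev by eventually_elim (rule coords[THEN conjunct2, symmetric])
  ultimately have cl: "(\<lambda>m. local_coords UNIV (ix 1) (?t (proj_inv B 1 (z m)))) \<longlonglongrightarrow> 0"
    by (rule Lim_transform_eventually)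
  have evD: "\<forall>\<^sub>F m in sequentially. proj_inv B 1 (z m) \<in> ?D"
    using ev by eventually_elim (rule coords[THEN conjunct1])
  have "limitin (mtop (Mfd B 1)) (\<lambda>m. proj_inv B 1 (z m)) (base_pt B 1) sequentially"
    by (rule limitin_chartI[OF chart]) (use evD cl bD bc in \<open>simp_all add: o_def\<close>)
  then show ?thesis using True by simp
qed

lemma chart_seq_relation:
  fixes B :: "('a, 'n::{finite,linorder}) tower"
  assumes B: "blowup_tower B" and k: "1 \<le> k" "k \<le> CARD('n)"
    and lift: "lift_tendsto B k z (base_pt B k)" and z: "\<And>m. z m \<noteq> 0"
  shows "\<forall>\<^sub>F m in sequentially. proj_inv B k (z m) \<in> fst (chi B k)"
    "chart_seq B k z \<longlonglongrightarrow> 0"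
    "\<forall>\<^sub>F m in sequentially. chart_relation k (chart_seq B k z m) (z m)"
proof -
  note lc = limitin_chart[OF towerD(4)[OF B k] lift base_pt_chart(1)[OF B k]]
  show ev: "\<forall>\<^sub>F m in sequentially. proj_inv B k (z m) \<in> fst (chi B k)" by (rule lc(1))
  show "chart_seq B k z \<longlonglongrightarrow> 0"
    using lc(2) base_pt_chart(2)[OF B k] by (simp add: chart_seq_def[abs_def])
  show "\<forall>\<^sub>F m in sequentially. chart_relation k (chart_seq B k z m) (z m)"
    using ev
  proof eventually_elim
    case (elim m)
    show ?case using proj_chart(1)[OF B k elim] proj_inv_props(2)[OF B k z] by (simp add: chart_seq_def)
  qed
qed

text \<open>
  All coordinates of the distinguished point vanish; \<open>standard_chart_direction\<close> turns this into a
  direction.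
\<close>

lemma base_pt_direction:
  fixes B :: "('a, 'n::{finite,linorder}) tower"
  assumes B: "blowup_tower B" and k: "1 \<le> k" "k < CARD('n)"
    and h: "trivializes (Mfd B (Suc k)) (sigma B (Suc k)) (chi B k) (blowup_indices (Suc k)) h"
  shows "sigma B (Suc k) (base_pt B (Suc k)) = base_pt B k"
    "snd (h (base_pt B (Suc k))) = line (axis (ix (Suc k)) 1)"
proof -
  let ?K = "Suc k" and ?b = "base_pt B (Suc k)"
  have K: "1 \<le> ?K" "?K \<le> CARD('n)" and kn: "k \<le> CARD('n)" using k by auto
  note b = base_pt_chart[OF B K]
  have s: "sigma B ?K q \<in> fst (chi B k) \<and>
      snd (chi B k) (sigma B ?K q) = blowup_coords (blowup_indices ?K) (ix ?K) (snd (chi B ?K) q)"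
    if "q \<in> fst (chi B ?K)" for q
    using towerD(7)[OF B k that] unfolding sigma_coords_eq[OF K] .
  have "snd (chi B k) (sigma B ?K ?b) = snd (chi B k) (base_pt B k)"
    using s[OF b(1)] b(2) base_pt_chart(2)[OF B k(1) kn] by (simp add: blowup_coords_def vec_eq_iff)
  then show "sigma B ?K ?b = base_pt B k"
    by (rule inj_onD[OF chart_inj[OF towerD(4)[OF B k(1) kn]]])
      (use s[OF b(1)] base_pt_chart(1)[OF B k(1) kn] in auto)
  have iI: "ix ?K \<in> (blowup_indices ?K :: 'n set)" using K by (simp add: blowup_indices_def pos_ix)
  have "snd (h ?b) = line (blowup_dir (blowup_indices ?K) (ix ?K) (snd (chi B ?K) ?b))"
    by (rule standard_chart_direction[OF h towerD(4,5)[OF B K] iI s b(1)])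
  also have "blowup_dir (blowup_indices ?K) (ix ?K) (snd (chi B ?K) ?b) = axis (ix ?K) 1"
    by (simp add: b(2) blowup_dir_def axis_def vec_eq_iff)
  finally show "snd (h ?b) = line (axis (ix ?K) 1)" .
qed

text \<open>
  A sequence of second kind up to level \<open>k\<close> whose lifts to the next level converge must converge to
  the distinguished point: its normal directions along the centre are those of
  \<open>(z\<^sub>1\<^sup>2, z\<^sub>k\<^sub>+\<^sub>1, \<dots>, z\<^sub>n)\<close>, and along an orbit they can only converge to the eigenvector.
\<close>

lemma lifted_orbit_limit_is_base_pt:
  fixes B :: "('a, 'n::{finite,linorder}) tower" and F :: "'n cvec \<Rightarrow> 'n cvec"
  assumes B: "blowup_tower B" and k: "1 \<le> k" "k < CARD('n)"
    and F: "jordan_expansion F c" "c CARD('n) \<noteq> 0" and orbit: "\<And>m. z (Suc m) = F (z m)"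
    and z: "\<And>m. z m \<noteq> 0" "z \<longlonglongrightarrow> 0"
    and lift: "lift_tendsto B k z (base_pt B k)" and p: "lift_tendsto B (Suc k) z p"
  shows "p = base_pt B (Suc k)"
proof -
  let ?K = "Suc k" and ?I = "blowup_indices (Suc k) :: 'n set"
  have K: "1 \<le> ?K" "?K \<le> CARD('n)" and kn: "k \<le> CARD('n)" using k by auto
  have bl: "is_blowup (Mfd B k) (centre B k) (Mfd B ?K) (sigma B ?K)" by (rule towerD(3)[OF B k])
  have I: "ix j \<in> ?I \<longleftrightarrow> j = 1 \<or> k < j" if "1 \<le> j" "j \<le> CARD('n)" for j
    using that k by (auto simp: blowup_indices_def pos_ix)
  have "limitin (mtop (Mfd B k)) (sigma B ?K \<circ> (\<lambda>m. proj_inv B ?K (z m))) (sigma B ?K p) sequentially"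
    by (rule continuous_map_limit[OF blowup_continuous[OF bl] p])
  moreover have "sigma B ?K \<circ> (\<lambda>m. proj_inv B ?K (z m)) = (\<lambda>m. proj_inv B k (z m))"
    using sigma_proj_inv[OF B k z(1)] by (simp add: fun_eq_iff)
  ultimately have "limitin (mtop (Mfd B k)) (\<lambda>m. proj_inv B k (z m)) (sigma B ?K p) sequentially" by simp
  from limitin_Hausdorff_unique[OF this lift sequentially_bot Hausdorff_Mfd[OF B k(1) kn]]
  have sp: "sigma B ?K p = base_pt B k" .
  obtain h where h: "trivializes (Mfd B ?K) (sigma B ?K) (chi B k) ?I h"
    using bl adapted_centre[OF B k] towerD(4)[OF B k(1) kn] unfolding is_blowup_def by blast
  have spc: "sigma B ?K p \<in> fst (chi B k)" unfolding sp by (rule base_pt_chart(1)[OF B k(1) kn])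
  define w where "w = chart_seq B k z"
  note cs = chart_seq_relation[OF B k(1) kn lift z(1), folded w_def]
  have ws: "snd (chi B k) (sigma B ?K (proj_inv B ?K (z m))) = w m" for m
    by (simp add: w_def chart_seq_def sigma_proj_inv[OF B k z(1)])
  obtain i u U where i: "i \<in> ?I" "u $ i = 1" "snd (h p) = line u" "\<And>j. j \<notin> ?I \<Longrightarrow> u $ j = 0"
    and U: "\<And>j. j \<in> ?I \<Longrightarrow> (\<lambda>m. U m $ j) \<longlonglongrightarrow> u $ j"
    and wU: "\<forall>\<^sub>F m in sequentially. \<forall>j\<in>?I. w m $ j = w m $ i * U m $ j"
    using lifted_sequence_direction[OF h p spc] unfolding ws by blast
  obtain l where l: "1 \<le> l" "l \<le> CARD('n)" "i = ix l" by (rule ix_cases)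
  have lI: "l = 1 \<or> k < l" using I[of l] l i(1) by simp
  have n1: "1 \<le> CARD('n)" by (rule one_le_CARD)
  have nc: "\<forall>\<^sub>F m in sequentially. normal_coord (z m) l \<noteq> 0 \<and> z m $ ix 1 \<noteq> 0 \<and>
      (\<forall>j. (j = 1 \<or> k < j) \<longrightarrow> j \<le> CARD('n) \<longrightarrow> normal_coord (z m) j / normal_coord (z m) l = U m $ ix j)"
    using cs(3) wU
  proof eventually_elim
    case (elim m)
    have nz: "z m $ ix 1 \<noteq> 0" "z m $ ix k \<noteq> 0" "w m $ ix 1 \<noteq> 0"
      using chart_relation_nonzero[OF elim(1) k(1) kn z(1)] k by simp_all
    have "w m $ ix 1 = w m $ i * U m $ ix 1" using elim(2) I[of 1] n1 by simp
    then have wi: "w m $ i \<noteq> 0" using nz(3) by auto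
    have coord: "normal_coord (z m) j = w m $ ix j * z m $ ix k" if "j = 1 \<or> k < j" "j \<le> CARD('n)" for j
      using elim(1) that k unfolding chart_relation_def normal_coord_def by auto
    have "normal_coord (z m) j / normal_coord (z m) l = U m $ ix j" if j: "j = 1 \<or> k < j" "j \<le> CARD('n)" for j
    proof -
      have "ix j \<in> ?I" using I[of j] j by auto
      then have "w m $ ix j = w m $ i * U m $ ix j" using elim(2) by blast
      then show ?thesis using coord[OF j] coord[OF lI l(2)] wi nz(2) l(3) by simp
    qed
    then show ?case using coord[OF lI l(2)] wi nz l(3) by simp
  qed
  have ax: "(\<lambda>m. z m $ j / z m $ ix 1) \<longlonglongrightarrow> 0" if "j \<noteq> ix 1" for j
    by (rule chart_sequence_axis[OF cs(3) k(1) kn cs(2) z(1) that])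
  have z1: "\<forall>\<^sub>F m in sequentially. z m $ ix 1 \<noteq> 0" using nc by eventually_elim simp
  have nl: "\<forall>\<^sub>F m in sequentially. normal_coord (z m) l \<noteq> 0" using nc by eventually_elim simp
  have dir: "(\<lambda>m. normal_coord (z m) j / normal_coord (z m) l) \<longlonglongrightarrow> u $ ix j"
    if j: "j = 1 \<or> k < j" "j \<le> CARD('n)" for j
  proof -
    have jI: "ix j \<in> ?I" using I[of j] j by auto
    have ev: "\<forall>\<^sub>F m in sequentially. U m $ ix j = normal_coord (z m) j / normal_coord (z m) l"
      using nc
    proof eventually_elim
      case (elim m)
      then have "normal_coord (z m) j / normal_coord (z m) l = U m $ ix j" using j by blast
      then show ?case by (rule sym)
    qed
    show ?thesis by (rule Lim_transform_eventually[OF U[OF jI] ev])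
  qed
  note eig = normal_direction_eigenvector[where u = "\<lambda>j. u $ ix j", OF F(1) orbit k F(2) z(2) z1 ax lI l(2) nl dir]
  have zero: "u $ ix j = 0" if j: "1 \<le> j" "j \<le> CARD('n)" "j \<noteq> ?K" for j
  proof -
    consider "j = 1" | "1 < j" "j \<le> k" | "?K < j" using j by linarith
    then show ?thesis
    proof cases
      case 1
      then show ?thesis using eig(1) by simp
    next
      case 2
      then show ?thesis using i(4)[of "ix j"] I[of j] j by simp
    next
      case 3
      then show ?thesis using eig(2)[of j] j by simp
    qed
  qed
  \<comment> \<open>Only the coordinate \<open>k + 1\<close> of \<open>u\<close> can be nonzero, so \<open>p\<close> and \<open>e\<^sub>k\<^sub>+\<^sub>1\<close> have the same image under \<open>h\<close>.\<close>
  have lK: "l = ?K" using zero[of l] l i(2) by auto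
  have "u = axis (ix ?K) 1"
  proof -
    have "u $ j = axis (ix ?K) 1 $ j" for j
    proof -
      obtain j' where j': "1 \<le> j'" "j' \<le> CARD('n)" "j = ix j'" by (rule ix_cases)
      show ?thesis
      proof (cases "j' = ?K")
        case True
        then show ?thesis using i(2) l(3) lK j' by (simp add: axis_def)
      next
        case False
        then have "j \<noteq> ix ?K" using j' K by (simp add: ix_eq_iff)
        then show ?thesis using zero[OF j'(1,2) False] j' by (simp add: axis_def)
      qed
    qed
    then show ?thesis by (simp add: vec_eq_iff)
  qed
  then have hp: "snd (h p) = snd (h (base_pt B ?K))" using i(3) base_pt_direction(2)[OF B k h] by simp
  have pp: "p \<in> points (Mfd B ?K)" using p by (rule limitin_topspace)
  have bp: "base_pt B ?K \<in> points (Mfd B ?K)"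
    using chart_subset[OF towerD(4)[OF B K]] base_pt_chart(1)[OF B K] by blast
  have sb: "sigma B ?K (base_pt B ?K) = base_pt B k" by (rule base_pt_direction(1)[OF B k h])
  then have sbc: "sigma B ?K (base_pt B ?K) \<in> fst (chi B k)" using spc sp by simp
  have "h p = h (base_pt B ?K)"
    using trivializes_mem(2)[OF h pp spc] trivializes_mem(2)[OF h bp sbc] hp sp sb by simp
  then show ?thesis by (rule trivializes_inj[OF h pp spc bp sbc])
qed


text \<open>
  A first level of first kind would be an \<open>r\<close> at which the lifts converge to a point other than
  \<open>e\<^sub>r\<close>. For \<open>r = 1\<close> the limit direction is an eigenvector of \<open>J\<^sub>n\<close>, hence \<open>[e\<^sub>1]\<close>.
\<close>

lemma orbit_not_first_kind:
  fixes B :: "('a, 'n::{finite,linorder}) tower" and F :: "'n cvec \<Rightarrow> 'n cvec"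
  assumes B: "blowup_tower B"
    and F: "jordan_expansion F c" "c CARD('n) \<noteq> 0" and orbit: "\<And>m. z (Suc m) = F (z m)"
    and z: "\<And>m. z m \<noteq> 0" "z \<longlonglongrightarrow> 0"
  shows "r \<le> CARD('n) \<Longrightarrow> \<not> regular_first_kind B r z"
proof (induction r)
  case (Suc r)
  show ?case
  proof (cases r)
    case 0
    show ?thesis
    proof
      assume "regular_first_kind B (Suc r) z"
      then obtain L where L: "zero_regular_to z L" "L \<noteq> line (axis (ix 1) 1)" using 0 by auto
      then have lim: "limitin proj_topology (\<lambda>m. line (z m)) L sequentially" by (simp add: zero_regular_to_def)
      obtain v where v: "L = line v" "v \<noteq> 0" by (rule projective_limit_line[OF lim])
      then obtain i where i: "v $ i \<noteq> 0" by (auto simp: vec_eq_iff)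
      have nz: "\<forall>\<^sub>F m in sequentially. z m \<noteq> 0" using z(1) by simp
      note ratio = projective_limit_ratio[OF lim[unfolded v(1)] nz i]
      have zero: "v $ l / v $ i = 0" if "l \<noteq> ix 1" for l
        by (rule orbit_direction_eigenvector[OF F(1) orbit z(2) ratio that])
      have "v = (v $ ix 1) *s axis (ix 1) 1"
        using zero i by (auto simp: vec_eq_iff axis_def)
      moreover have "v $ ix 1 \<noteq> 0" using zero[of i] i by auto
      ultimately have "line v = line (axis (ix 1) 1)" using line_scale by metis
      then show False using L(2) v(1) by simp
    qed
  next
    case (Suc k)
    have k: "1 \<le> r" "r < CARD('n)" and rn: "r \<le> CARD('n)" using Suc Suc.prems \<open>Suc r \<le> CARD('n)\<close> by auto
    show ?thesis
    proof
      assume "regular_first_kind B (Suc r) z"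
      then obtain p where p: "regular_second_kind B r z" "p \<noteq> base_pt B (Suc r)" "lift_tendsto B (Suc r) z p"
        using Suc Suc.IH rn by auto
      from second_kind_lift_tendsto[OF B k(1) rn p(1) z]
      have "p = base_pt B (Suc r)"
        by (rule lifted_orbit_limit_is_base_pt[OF B k F orbit z _ p(3)])
      then show False using p(2) by simp
    qed
  qed
qed simp

section \<open>Regular orbits are standard\<close>

lemma is_lift_of_coordinates:
  fixes B :: "('a, 'n::{finite,linorder}) tower" and F G :: "'n cvec \<Rightarrow> 'n cvec"
  assumes B: "blowup_tower B" and G: "has_power_series G 0 b" "G 0 = 0" and r: "r > 0"
    and lift: "\<And>w. w \<in> ball 0 r \<Longrightarrow> tower_monomials (G w) = F (tower_monomials w)"
  shows "is_lift B F (chart_inv (chi B CARD('n)) \<circ> G \<circ> snd (chi B CARD('n))) b"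
proof -
  let ?n = "CARD('n)"
  let ?c = "chi B ?n"
  let ?F = "chart_inv ?c \<circ> G \<circ> snd ?c"
  have n1: "1 \<le> ?n" by (rule one_le_CARD)
  have c: "is_chart (Mfd B ?n) ?c" "snd ?c ` fst ?c = UNIV" using towerD(4,5)[OF B n1] by simp_all
  note b = base_pt_chart[OF B n1 order_refl]
  have inv: "chart_inv ?c x \<in> fst ?c" "snd ?c (chart_inv ?c x) = x" for x
    using c(2) by (simp_all add: chart_inv_mem chart_inv_right)
  have proj: "proj B ?n p = tower_monomials (snd ?c p)" if p: "p \<in> fst ?c" for p
    by (rule chart_relation_unique[OF proj_chart(1)[OF B n1 order_refl p]])
      (simp only: proj_chart(2)[OF B n1 order_refl p] prod_over_ix)
  define N where "N = {p \<in> fst ?c. snd ?c p \<in> ball 0 r}"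
  have "openin (subtopology (mtop (Mfd B ?n)) (fst ?c))
      {p \<in> topspace (subtopology (mtop (Mfd B ?n)) (fst ?c)). snd ?c p \<in> ball 0 r}"
    by (rule openin_continuous_map_preimage[OF chart_continuous[OF c(1)]]) simp
  then have "openin (mtop (Mfd B ?n))
      {p \<in> topspace (subtopology (mtop (Mfd B ?n)) (fst ?c)). snd ?c p \<in> ball 0 r}"
    using is_chartD(1)[OF c(1)] by (rule openin_trans_full)
  moreover have "topspace (subtopology (mtop (Mfd B ?n)) (fst ?c)) = fst ?c"
    by (rule topspace_subtopology_subset[OF chart_subset[OF c(1)]])
  ultimately have oN: "openin (mtop (Mfd B ?n)) N" unfolding N_def by (simp only:)
  have bN: "base_pt B ?n \<in> N" using b r by (simp add: N_def)
  have "?F p \<in> fst ?c \<and> proj B ?n (?F p) = F (proj B ?n p)" if "p \<in> N" for p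
  proof -
    have p: "p \<in> fst ?c" "snd ?c p \<in> ball 0 r" using that by (simp_all add: N_def)
    have "proj B ?n (?F p) = tower_monomials (G (snd ?c p))" using proj[OF inv(1)] inv(2) by simp
    also have "\<dots> = F (proj B ?n p)" using lift[OF p(2)] proj[OF p(1)] by simp
    finally show ?thesis using inv(1) by simp
  qed
  moreover have "?F (base_pt B ?n) = base_pt B ?n" using b(2) G(2) by (simp add: base_pt_def)
  moreover have "snd ?c \<circ> ?F \<circ> chart_inv ?c = G" using inv(2) by (simp add: fun_eq_iff)
  ultimately show ?thesis unfolding is_lift_def Let_def using oN bN G(1) by auto
qed

theorem theorem4p2:
  fixes B :: "('a, 'n::{finite,linorder}) tower"
    and F :: "'n cvec \<Rightarrow> 'n cvec"
    and a :: "('n \<Rightarrow> nat) \<Rightarrow> 'n cvec"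
    and z :: "nat \<Rightarrow> 'n cvec"
  assumes "CARD('n) \<ge> 2"
    and "blowup_tower B"
    and "has_power_series F 0 a"
    and "F 0 = 0"
    and "(F has_derivative (\<lambda>v. jordan_block *v v)) (at 0)"
    and "a (\<lambda>i. if pos i = 1 then 2 else 0) $ ix (CARD('n)) \<noteq> 0"
    and "regular_orbit B F z"
  shows "standard_orbit B F z"
proof -
  let ?n = "CARD('n)"
  note n2 = assms(1) and B = assms(2) and F = assms(3-5)
  have n1: "1 \<le> ?n" using n2 by simp
  define c where "c = (\<lambda>j. a (\<lambda>i. if pos i = 1 then 2 else 0) $ ix j)"
  have cn: "c ?n \<noteq> 0" using assms(6) by (simp add: c_def)
  have je: "jordan_expansion F c" unfolding c_def by (rule jordan_map_expansion[OF F])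
  have orb: "is_orbit F z" and z0: "z \<longlonglongrightarrow> 0" using assms(7) by (simp_all add: regular_orbit_def)
  then obtain x0 where x0: "z = (\<lambda>m. (F ^^ m) x0)" and zn: "\<And>m. z m \<noteq> 0" by (auto simp: is_orbit_def)
  have zS: "z (Suc m) = F (z m)" for m by (simp add: x0)
  have "\<not> regular_first_kind B ?n z"
    by (rule orbit_not_first_kind[OF B je cn zS zn z0 order_refl])
  then have second: "regular_second_kind B ?n z" using assms(7) by (simp add: regular_orbit_def)
  have lift: "lift_tendsto B ?n z (base_pt B ?n)"
    by (rule second_kind_lift_tendsto[OF B n1 order_refl second zn z0])
  obtain r where "?n = Suc (Suc r)" using n2 by (metis add_2_eq_Suc le_Suc_ex)
  then obtain L where zr: "zero_regular_to (chart_seq B ?n z) L" using second by auto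
  define w where "w = chart_seq B ?n z"
  note cs = chart_seq_relation[OF B n1 order_refl lift zn, folded w_def]
  have limL: "limitin proj_topology (\<lambda>m. line (w m)) L sequentially"
    and wn: "\<forall>\<^sub>F m in sequentially. w m \<noteq> 0"
    using zr by (simp_all add: zero_regular_to_def w_def)
  obtain v0 where v0: "L = line v0" "v0 \<noteq> 0" by (rule projective_limit_line[OF limL])
  then obtain i where i: "v0 $ i \<noteq> 0" by (auto simp: vec_eq_iff)
  obtain p where p: "1 \<le> p" "p \<le> ?n" "i = ix p" by (rule ix_cases)
  note ratio = projective_limit_ratio[OF limL[unfolded v0(1)] wn i]
  \<comment> \<open>With \<open>v\<^sub>p = 1\<close> the coordinate \<open>w\<^sub>p\<close> is a common scale: \<open>w\<^sub>j / w\<^sub>p \<rightarrow> v\<^sub>j\<close> for all \<open>j\<close>.\<close>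
  define v where "v = (1 / v0 $ i) *s v0"
  have Lv: "L = line v" unfolding v_def v0(1) by (rule line_scale[symmetric]) (use i in simp)
  have dir: "(\<lambda>m. w m $ j / w m $ i) \<longlonglongrightarrow> v $ j" for j
    using ratio(2)[of j] by (simp add: v_def)
  have rel': "\<forall>\<^sub>F m in sequentially. chart_relation ?n (w (Suc m)) (F (z m))"
    using cs(3) eventually_sequentially_Suc[of "\<lambda>m. chart_relation ?n (w m) (z m)"] by (simp add: zS)
  have Fn: "F (z m) \<noteq> 0" for m using zn[of "Suc m"] zS by simp
  have wi: "(\<lambda>m. w m $ j) \<longlonglongrightarrow> 0" for j using tendsto_vec_nth[OF cs(2), of j] by simp
  have slope: "(\<lambda>m. (w (Suc m) $ ix j / w m $ ix j - 1) / w m $ ix p) \<longlonglongrightarrow> coord_slope ?n (c ?n) (\<lambda>l. v $ ix l) j"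
    if j: "1 \<le> j" "j \<le> ?n" for j
    by (rule coord_multiplier_slope[OF je j cs(3) rel' z0 zn Fn cs(2) wi])
      (use ratio(1) dir p in simp_all)
  have wnz: "\<forall>\<^sub>F m in sequentially. w m $ ix j \<noteq> 0" if j: "1 \<le> j" "j \<le> ?n" for j
    using cs(3)
  proof eventually_elim
    case (elim m)
    show ?case by (rule chart_relation_nonzero(2)[OF elim n1 order_refl zn j])
  qed
  have dir': "(\<lambda>m. w m $ ix j / w m $ ix p) \<longlonglongrightarrow> v $ ix j" for j using dir p(3) by simp
  have allow: "v $ ix j \<noteq> 0"
    "coord_slope ?n (c ?n) (\<lambda>l. v $ ix l) j = coord_slope ?n (c ?n) (\<lambda>l. v $ ix l) p"
    if j: "1 \<le> j" "j \<le> ?n" for j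
    by (rule tangent_direction_allowable[where w = "\<lambda>m j. w m $ ix j" and v = "\<lambda>j. v $ ix j" and p = p];
        (rule n2 cn wnz wi p dir' slope j; assumption)+)+
  have vnz: "v $ j \<noteq> 0" for j
  proof -
    obtain k where "1 \<le> k" "k \<le> ?n" "j = ix k" by (rule ix_cases)
    then show ?thesis using allow(1) by simp
  qed
  obtain G b r where G: "has_power_series G 0 b" "G 0 = 0" "r > 0"
    "\<And>w. w \<in> ball 0 r \<Longrightarrow> tower_monomials (G w) = F (tower_monomials w)"
    and quad: "\<And>v j. (\<And>i. v $ i \<noteq> 0) \<Longrightarrow> 1 \<le> j \<Longrightarrow> j \<le> ?n \<Longrightarrow>
      quadratic_part b v $ ix j = v $ ix j * coord_slope ?n (c ?n) (\<lambda>i. v $ ix i) j"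
    using lift_in_coordinates[OF F] unfolding c_def by blast
  have "quadratic_part b v = coord_slope ?n (c ?n) (\<lambda>l. v $ ix l) p *s v"
  proof -
    have "quadratic_part b v $ j = (coord_slope ?n (c ?n) (\<lambda>l. v $ ix l) p *s v) $ j" for j
    proof -
      obtain k where k: "1 \<le> k" "k \<le> ?n" "j = ix k" by (rule ix_cases)
      then show ?thesis using quad[of v k] vnz allow(2)[OF k(1,2)] by simp
    qed
    then show ?thesis by (simp add: vec_eq_iff)
  qed
  moreover have "v \<noteq> 0" using vnz[of "ix 1"] by auto
  ultimately have "characteristic_direction (quadratic_part b) v" by (auto simp: characteristic_direction_def)
  moreover have "allowable v" using vnz by (simp add: allowable_def)
  moreover have "zero_regular_to (chart_seq B ?n z) (line v)" using zr Lv by simp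
  ultimately show ?thesis
    unfolding standard_orbit_def using orb lift is_lift_of_coordinates[OF B G] by blast
qed

end
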